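(* Let $0\le r\le n$. The restriction of the Weil representation $\omega=\omega_\psi$ to the maximal compact subgroup $\tilde K_r$ of $\widetilde{\mathrm{Sp}}(W)$ decomposes as $$\omega|_{\tilde K_r}\cong\omega_{r,0}^+\oplus\omega_{r,0}^-\oplus\bigoplus_{m\ge 1}\left(\mu_{r,m}^+\oplus\mu_{r,m}^-\oplus\nu_{r,m}^+\oplus\nu_{r,m}^-\right),$$ where $\omega_{r,0}^\pm$ is the representation of $\tilde K_r$ on $\mathrm S_r[0]^\pm$, $\mu_{r,m}^\pm$ is the representation on $\mathrm S^r[m]^\pm/\mathrm S_r[m-1]^\pm$, and $\nu_{r,m}^\pm$ is the representation on $\mathrm S_r[m]^\pm/\mathrm S^r[m]^\pm$. Each of these representations that is nonzero is irreducible. In particular, $\omega|_{\tilde K_r}$ is multiplicity-free.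
   Context: $F$ is a non-Archimedean local field of characteristic zero (of any residual characteristic), $\mathcal O$ its ring of integers, $\varpi$ a uniformizer. $\psi$ is a nontrivial smooth additive (unitary) character of $F$ with conductor $4\mathcal O$: $\psi(tx)=1$ for all $t\in\mathcal O$ if and only if $x\in 4\mathcal O$. $W$ is a symplectic space over $F$ of dimension $2n$ with symplectic basis $e_1,\dots,e_n,f_1,\dots,f_n$; $X=\mathrm{span}(e_i)$, $Y=\mathrm{span}(f_i)\cong F^n$, $W=X\oplus Y$. Elements of $\mathrm{Sp}(W)=\mathrm{Sp}_{2n}(F)$ are written as $2\times 2$ block matrices in this basis. $\widetilde{\mathrm{Sp}}(W)$ is the metaplectic group, the (nontrivial) twofold central extension of $\mathrm{Sp}(W)$. $\mathrm S(Y)$ is the space of locally constant compactly supported functions $Y\to\mathbb C$. The Weil representation $\omega=\omega_\psi$ of $\widetilde{\mathrm{Sp}}(W)$ is realized on $\mathrm S(Y)$ (Schrödinger model), with suitable lifts of the following elements acting by: - the lift $\tilde x(a)$ of $\begin{pmatrix}1&a\\0&1\end{pmatrix}$, $a$ a symmetric $n\times n$ matrix over $F$: $\varphi(y)\mapsto\psi({}^{\top}y\,a\,y)\varphi(y)$; - the lift $\tilde h(b)$ of $\begin{pmatrix}b&0\\0&{}^{\top}b^{-1}\end{pmatrix}$, $b\in\mathrm{GL}_n(F)$: $\varphi(y)\mapsto\beta_b|\det b|^{1/2}\varphi({}^{\top}b\,y)$; - the lift $\tilde w$ of $\begin{pmatrix}0&1\\-1&0\end{pmatrix}$: $\varphi\mapsto\gamma_1\hat\varphi$,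 where $\hat\varphi(u)=\int_{F^n}\varphi(v)\psi(2\,{}^{\top}u\,v)\,dv$ and the Haar measure is normalized by $\hat{\hat\varphi}(-v)=\varphi(v)$. Here $\beta_b$ and $\gamma_1$ are certain roots of unity. For $0\le r\le n$ let $\mathcal L_r$ be the $\mathcal O$-span of $e_1,\dots,e_n,\varpi f_1,\dots,\varpi f_r,f_{r+1},\dots,f_n$. $K_r$ is the stabilizer of $\mathcal L_r$ in $\mathrm{Sp}(W)$ (an open maximal compact subgroup), and $\tilde K_r$ is its full inverse image in $\widetilde{\mathrm{Sp}}(W)$. Put $L=\mathcal O^n$ and $L_r=(\varpi\mathcal O)^r\times\mathcal O^{n-r}$, lattices in $Y\cong F^n$. For lattices $B\subset A$ in $Y$, $\mathrm S(A/B)\subset\mathrm S(Y)$ is the space of functions supported on $A$ and invariant under translation by $B$. Define $\mathrm S_r[m]=\mathrm S(\varpi^{-m}L/2\varpi^mL_r)$ for $m\ge0$ and $\mathrm S^r[m]=\mathrm S(\varpi^{-m}L_r/2\varpi^mL)$ for $m\ge1$. For a function space $\mathcal U$, $\mathcal U^+$ and $\mathcal U^-$ are its subspaces of even and odd functions. The group $\tilde K_r$ preserves each term of the filtration $\mathrm S_r[0]\subset\mathrm S^r[1]\subset\mathrm S_r[1]\subset\mathrm S^r[2]\subset\mathrm S_r[2]\subset\cdots$ of $\mathrm S(Y)$, and their even and odd parts, so it acts on the quotients. Some of the pieces can be zero ($\mathrm S_0[0]^-$; $\nu_{r,m}^\pm$ if $r=0$; $\mu_{r,m}^\pm$ if $r=n$).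 *)

theory Defs
  imports "HOL-Analysis.Analysis" "HOL-Algebra.QuotRing" "HOL-Algebra.Module"
begin

section \<open>Non-Archimedean local fields of characteristic zero\<close>

text \<open>
  Complete discretely valued fields of characteristic zero with finite residue field.
  The function \<open>absv\<close> is the normalized absolute value: a uniformizer has absolute value
  \<open>1 / q\<close>, where \<open>q\<close> is the number of residue classes of the ring of integers modulo
  its maximal ideal.
\<close>

class nonarch_local_field = field_char_0 + complete_space +
  fixes absv :: "'a \<Rightarrow> real"
  assumes dist_absv: "dist x y = absv (x - y)"
    and absv_mult: "absv (x * y) = absv x * absv y"
    and absv_ultrametric: "absv (x + y) \<le> max (absv x) (absv y)"
    and finite_residue_field: "finite ((\<lambda>x. {y. absv (y - x) < 1}) ` {x. absv x \<le> 1})"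
    and normalized_uniformizer_exists:
      "\<exists>\<pi>. 0 < absv \<pi> \<and> absv \<pi> < 1 \<and> (\<forall>x. absv x < 1 \<longrightarrow> absv x \<le> absv \<pi>) \<and>
         absv \<pi> = 1 / real (card ((\<lambda>x. {y. absv (y - x) < 1}) ` {x. absv x \<le> 1}))"

definition integers :: "'a::nonarch_local_field set" where
  "integers = {x. absv x \<le> 1}"

definition uniformizer :: "'a::nonarch_local_field \<Rightarrow> bool" where
  "uniformizer \<pi> \<longleftrightarrow> \<pi> \<noteq> 0 \<and> (*) \<pi> ` integers = {x. absv x < 1}"

definition locally_constant :: "('x::topological_space \<Rightarrow> 'y) \<Rightarrow> bool" where
  "locally_constant f \<longleftrightarrow> (\<forall>x. \<exists>U. open U \<and> x \<in> U \<and> f constant_on U)"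

definition additive_character :: "('a::nonarch_local_field \<Rightarrow> complex) \<Rightarrow> bool" where
  "additive_character \<psi> \<longleftrightarrow>
     (\<forall>x y. \<psi> (x + y) = \<psi> x * \<psi> y) \<and> (\<forall>x. cmod (\<psi> x) = 1) \<and>
     locally_constant \<psi> \<and> (\<exists>x. \<psi> x \<noteq> 1)"

definition has_conductor_4 :: "('a::nonarch_local_field \<Rightarrow> complex) \<Rightarrow> bool" where
  "has_conductor_4 \<psi> \<longleftrightarrow> (\<forall>x. (\<forall>t\<in>integers. \<psi> (t * x) = 1) \<longleftrightarrow> x \<in> (*) 4 ` integers)"


section \<open>The symplectic and metaplectic groups\<close>

text \<open>
  The space \<open>Y\<close> is \<open>'a^'n\<close> with \<open>n = CARD('n)\<close>, and \<open>W\<close> is \<open>'a^('n + 'n)\<close>: the basis vector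
  \<open>e\<^sub>i\<close> is \<open>axis (Inl i) 1\<close> and \<open>f\<^sub>i\<close> is \<open>axis (Inr i) 1\<close>. Matrices act on column vectors.
\<close>

definition block_matrix ::
    "'a^'n^'n \<Rightarrow> 'a^'n^'n \<Rightarrow> 'a^'n^'n \<Rightarrow> 'a^'n^'n \<Rightarrow> 'a::zero^('n::finite + 'n)^('n + 'n)" where
  "block_matrix a b c d = (\<chi> i j.
     (case (i, j) of
        (Inl k, Inl l) \<Rightarrow> a $ k $ l
      | (Inl k, Inr l) \<Rightarrow> b $ k $ l
      | (Inr k, Inl l) \<Rightarrow> c $ k $ l
      | (Inr k, Inr l) \<Rightarrow> d $ k $ l))"

definition symplectic_form :: "'a::comm_ring_1^('n::finite + 'n)^('n + 'n)" where
  "symplectic_form = block_matrix 0 (mat 1) (- mat 1) 0"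

definition Sp :: "('a::comm_ring_1^('n::finite + 'n)^('n + 'n)) monoid" where
  "Sp = \<lparr>carrier = {g. transpose g ** symplectic_form ** g = symplectic_form},
         mult = (**), one = mat 1\<rparr>"

definition metaplectic_group ::
    "'g monoid \<Rightarrow> ('g \<Rightarrow> 'a::nonarch_local_field^('n::finite + 'n)^('n + 'n)) \<Rightarrow> bool" where
  "metaplectic_group Mp p \<longleftrightarrow>
     group Mp \<and> p \<in> epi Mp Sp \<and>
     card (kernel Mp Sp p) = 2 \<and>
     (\<forall>z\<in>kernel Mp Sp p. \<forall>g\<in>carrier Mp. z \<otimes>\<^bsub>Mp\<^esub> g = g \<otimes>\<^bsub>Mp\<^esub> z) \<and>
     \<not> (\<exists>s\<in>hom Sp Mp. \<forall>g\<in>carrier Sp. p (s g) = g)"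

text \<open>
  The \<open>k\<close>-th element of \<open>'n\<close> in increasing order has position \<open>k - 1\<close>, so that the indices
  \<open>1, \<dots>, r\<close> are those of position less than \<open>r\<close>.
\<close>

definition position :: "'n::{finite,linorder} \<Rightarrow> nat" where
  "position i = card {j. j < i}"

definition lattice_W ::
    "'a::nonarch_local_field \<Rightarrow> nat \<Rightarrow> ('a^('n::{finite,linorder} + 'n)) set" where
  "lattice_W \<pi> r =
     {(\<Sum>i\<in>UNIV. c i *s axis (Inl i) 1) +
      (\<Sum>i\<in>UNIV. d i *s (if position i < r then \<pi> *s axis (Inr i) 1 else axis (Inr i) 1)) | c d.
      range c \<subseteq> integers \<and> range d \<subseteq> integers}"

definition stabilizer_K ::
    "'a::nonarch_local_field \<Rightarrow> nat \<Rightarrow> ('a^('n::{finite,linorder} + 'n)^('n + 'n)) set" where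
  "stabilizer_K \<pi> r = {g \<in> carrier Sp. (*v) g ` lattice_W \<pi> r = lattice_W \<pi> r}"

definition metaplectic_K ::
    "'g monoid \<Rightarrow> ('g \<Rightarrow> 'a::nonarch_local_field^('n::{finite,linorder} + 'n)^('n + 'n)) \<Rightarrow>
     'a \<Rightarrow> nat \<Rightarrow> 'g monoid" where
  "metaplectic_K Mp p \<pi> r = Mp\<lparr>carrier := {g \<in> carrier Mp. p g \<in> stabilizer_K \<pi> r}\<rparr>"


section \<open>Complex representations\<close>

definition complex_ring :: "complex ring" where
  "complex_ring = \<lparr>carrier = UNIV, mult = (*), one = 1, zero = 0, add = (+)\<rparr>"

text \<open>
  A vector space together with an action. The fields \<open>mult\<close> and \<open>one\<close>, which the record of
  modules inherits from rings, are irrelevant.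
\<close>

record ('g, 'v) rep = "(complex, 'v) module" +
  act :: "'g \<Rightarrow> 'v \<Rightarrow> 'v"

definition linear_maps ::
    "(complex, 'v, 'm) module_scheme \<Rightarrow> (complex, 'w, 'k) module_scheme \<Rightarrow> ('v \<Rightarrow> 'w) set" where
  "linear_maps V W = {T \<in> hom (add_monoid V) (add_monoid W).
     \<forall>c. \<forall>x\<in>carrier V. T (c \<odot>\<^bsub>V\<^esub> x) = c \<odot>\<^bsub>W\<^esub> T x}"

definition is_rep :: "'g monoid \<Rightarrow> ('g, 'v) rep \<Rightarrow> bool" where
  "is_rep G V \<longleftrightarrow>
     group G \<and> Module.module complex_ring V \<and>
     (\<forall>g\<in>carrier G. act V g \<in> linear_maps V V) \<and>
     (\<forall>x\<in>carrier V. act V \<one>\<^bsub>G\<^esub> x = x) \<and>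
     (\<forall>g\<in>carrier G. \<forall>h\<in>carrier G. \<forall>x\<in>carrier V.
        act V (g \<otimes>\<^bsub>G\<^esub> h) x = act V g (act V h x))"

definition intertwiners :: "'g monoid \<Rightarrow> ('g, 'v) rep \<Rightarrow> ('g, 'w) rep \<Rightarrow> ('v \<Rightarrow> 'w) set" where
  "intertwiners G V W = {T \<in> linear_maps V W.
     \<forall>g\<in>carrier G. \<forall>x\<in>carrier V. T (act V g x) = act W g (T x)}"

definition rep_iso :: "'g monoid \<Rightarrow> ('g, 'v) rep \<Rightarrow> ('g, 'w) rep \<Rightarrow> bool" where
  "rep_iso G V W \<longleftrightarrow> is_rep G V \<and> is_rep G W \<and>
     (\<exists>T\<in>intertwiners G V W. bij_betw T (carrier V) (carrier W))"

definition nonzero_rep :: "('g, 'v) rep \<Rightarrow> bool" where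
  "nonzero_rep V \<longleftrightarrow> carrier V \<noteq> {\<zero>\<^bsub>V\<^esub>}"

definition irreducible_rep :: "'g monoid \<Rightarrow> ('g, 'v) rep \<Rightarrow> bool" where
  "irreducible_rep G V \<longleftrightarrow>
     is_rep G V \<and> nonzero_rep V \<and>
     (\<forall>U. Module.submodule U complex_ring V \<and> (\<forall>g\<in>carrier G. act V g ` U \<subseteq> U) \<longrightarrow>
        U = {\<zero>\<^bsub>V\<^esub>} \<or> U = carrier V)"

text \<open>
  Every irreducible representation \<open>P\<close> satisfies \<open>dim Hom(P, V) \<le> 1\<close>. Requiring this for \<open>P\<close>
  with elements of the same type as those of \<open>V\<close> loses nothing: an irreducible representation
  with a nonzero intertwiner to \<open>V\<close> is isomorphic to a subrepresentation of \<open>V\<close>.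
\<close>

definition multiplicity_free :: "'g monoid \<Rightarrow> ('g, 'v) rep \<Rightarrow> bool" where
  "multiplicity_free G V \<longleftrightarrow>
     (\<forall>P :: ('g, 'v) rep. irreducible_rep G P \<longrightarrow>
        (\<forall>S\<in>intertwiners G P V. \<forall>T\<in>intertwiners G P V.
           \<exists>a b. (a \<noteq> 0 \<or> b \<noteq> 0) \<and>
             (\<forall>x\<in>carrier P. (a \<odot>\<^bsub>V\<^esub> S x) \<oplus>\<^bsub>V\<^esub> (b \<odot>\<^bsub>V\<^esub> T x) = \<zero>\<^bsub>V\<^esub>)))"

definition sub_rep :: "('g, 'v) rep \<Rightarrow> 'v set \<Rightarrow> ('g, 'v) rep" where
  "sub_rep V U = V\<lparr>carrier := U\<rparr>"

text \<open>
  The representation on \<open>V / U\<close> for an invariant subspace \<open>U\<close>; its elements are the cosets of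
  \<open>U\<close>. The union in \<open>smult\<close> makes \<open>0\<close> times a coset equal to \<open>U\<close> instead of \<open>{0}\<close>; the image of a
  coset under a group element is already a coset.
\<close>

definition quotient_rep :: "('g, 'v) rep \<Rightarrow> 'v set \<Rightarrow> ('g, 'v set) rep" where
  "quotient_rep V U =
     \<lparr>carrier = a_rcosets\<^bsub>V\<^esub> U, mult = undefined, one = undefined,
      zero = U, add = set_add V,
      smult = (\<lambda>c A. \<Union>x\<in>A. U +>\<^bsub>V\<^esub> (c \<odot>\<^bsub>V\<^esub> x)),
      act = (\<lambda>g A. act V g ` A)\<rparr>"

definition rep_plus :: "('g, 'v) rep \<Rightarrow> ('g, 'w) rep \<Rightarrow> ('g, 'v \<times> 'w) rep" (infixr \<open>\<oplus>\<^sub>r\<close> 65) where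
  "V \<oplus>\<^sub>r W =
     \<lparr>carrier = carrier V \<times> carrier W, mult = undefined, one = undefined,
      zero = (\<zero>\<^bsub>V\<^esub>, \<zero>\<^bsub>W\<^esub>),
      add = (\<lambda>x y. (fst x \<oplus>\<^bsub>V\<^esub> fst y, snd x \<oplus>\<^bsub>W\<^esub> snd y)),
      smult = (\<lambda>c x. (c \<odot>\<^bsub>V\<^esub> fst x, c \<odot>\<^bsub>W\<^esub> snd x)),
      act = (\<lambda>g x. (act V g (fst x), act W g (snd x)))\<rparr>"

definition rep_direct_sum :: "'i set \<Rightarrow> ('i \<Rightarrow> ('g, 'v) rep) \<Rightarrow> ('g, 'i \<Rightarrow> 'v) rep" where
  "rep_direct_sum I V =
     \<lparr>carrier = {x \<in> (\<Pi>\<^sub>E i\<in>I. carrier (V i)). finite {i \<in> I. x i \<noteq> \<zero>\<^bsub>V i\<^esub>}},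
      mult = undefined, one = undefined,
      zero = (\<lambda>i\<in>I. \<zero>\<^bsub>V i\<^esub>),
      add = (\<lambda>x y. \<lambda>i\<in>I. x i \<oplus>\<^bsub>V i\<^esub> y i),
      smult = (\<lambda>c x. \<lambda>i\<in>I. c \<odot>\<^bsub>V i\<^esub> x i),
      act = (\<lambda>g x. \<lambda>i\<in>I. act (V i) g (x i))\<rparr>"


section \<open>The Weil representation\<close>

definition schwartz :: "('a::nonarch_local_field^'n::finite \<Rightarrow> complex) set" where
  "schwartz = {\<phi>. locally_constant \<phi> \<and> compact (closure {y. \<phi> y \<noteq> 0})}"

definition schwartz_rep ::
    "('g \<Rightarrow> ('a::nonarch_local_field^'n::finite \<Rightarrow> complex) \<Rightarrow> ('a^'n \<Rightarrow> complex)) \<Rightarrow>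
     ('g, 'a^'n \<Rightarrow> complex) rep" where
  "schwartz_rep A =
     \<lparr>carrier = schwartz, mult = undefined, one = undefined,
      zero = (\<lambda>y. 0), add = (\<lambda>\<phi> \<eta> y. \<phi> y + \<eta> y), smult = (\<lambda>c \<phi> y. c * \<phi> y), act = A\<rparr>"

definition dot :: "'a::comm_ring_1^'n::finite \<Rightarrow> 'a^'n \<Rightarrow> 'a" where
  "dot u v = (\<Sum>i\<in>UNIV. u $ i * v $ i)"

definition haar_measure :: "('a::nonarch_local_field^'n::finite) measure \<Rightarrow> bool" where
  "haar_measure \<mu> \<longleftrightarrow>
     sets \<mu> = sets borel \<and> emeasure \<mu> UNIV \<noteq> 0 \<and>
     (\<forall>C. compact C \<longrightarrow> emeasure \<mu> C < \<infinity>) \<and>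
     (\<forall>v. \<forall>B\<in>sets borel. emeasure \<mu> ((+) v ` B) = emeasure \<mu> B)"

definition fourier ::
    "('a::nonarch_local_field \<Rightarrow> complex) \<Rightarrow> ('a^'n::finite) measure \<Rightarrow>
     ('a^'n \<Rightarrow> complex) \<Rightarrow> ('a^'n \<Rightarrow> complex)" where
  "fourier \<psi> \<mu> \<phi> u = (LINT v|\<mu>. \<phi> v * \<psi> (2 * dot u v))"

definition self_dual_haar_measure ::
    "('a::nonarch_local_field \<Rightarrow> complex) \<Rightarrow> ('a^'n::finite) measure \<Rightarrow> bool" where
  "self_dual_haar_measure \<psi> \<mu> \<longleftrightarrow> haar_measure \<mu> \<and>
     (\<forall>\<phi>\<in>schwartz. \<forall>v. fourier \<psi> \<mu> (fourier \<psi> \<mu> \<phi>) (- v) = \<phi> v)"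

definition root_of_unity :: "complex \<Rightarrow> bool" where
  "root_of_unity z \<longleftrightarrow> (\<exists>k>0::nat. z ^ k = 1)"

text \<open>
  The operators \<open>A g\<close> form the Weil representation of \<open>Mp\<close> in the Schroedinger model. As
  the lifted matrices generate the symplectic group, this prescribes \<open>A\<close> up to scalars.
\<close>

definition weil_representation ::
    "('a::nonarch_local_field \<Rightarrow> complex) \<Rightarrow> ('a^'n::finite) measure \<Rightarrow> 'g monoid \<Rightarrow>
     ('g \<Rightarrow> 'a^('n + 'n)^('n + 'n)) \<Rightarrow>
     ('g \<Rightarrow> ('a^'n \<Rightarrow> complex) \<Rightarrow> ('a^'n \<Rightarrow> complex)) \<Rightarrow> bool" where
  "weil_representation \<psi> \<mu> Mp p A \<longleftrightarrow>
     is_rep Mp (schwartz_rep A) \<and>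
     (\<forall>a. transpose a = a \<longrightarrow>
        (\<exists>g\<in>carrier Mp. p g = block_matrix (mat 1) a 0 (mat 1) \<and>
           (\<forall>\<phi>\<in>schwartz. A g \<phi> = (\<lambda>y. \<psi> (dot y (a *v y)) * \<phi> y)))) \<and>
     (\<forall>b. invertible b \<longrightarrow>
        (\<exists>g\<in>carrier Mp. p g = block_matrix b 0 0 (transpose (matrix_inv b)) \<and>
           (\<exists>\<beta>. root_of_unity \<beta> \<and>
              (\<forall>\<phi>\<in>schwartz. A g \<phi> =
                 (\<lambda>y. \<beta> * complex_of_real (sqrt (absv (det b))) * \<phi> (transpose b *v y)))))) \<and>
     (\<exists>g\<in>carrier Mp. p g = block_matrix 0 (mat 1) (- mat 1) 0 \<and>
        (\<exists>\<gamma>. root_of_unity \<gamma> \<and>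
           (\<forall>\<phi>\<in>schwartz. A g \<phi> = (\<lambda>u. \<gamma> * fourier \<psi> \<mu> \<phi> u))))"


section \<open>The filtration of the Schwartz space\<close>

definition lattice_L :: "('a::nonarch_local_field^'n::finite) set" where
  "lattice_L = {y. \<forall>i. y $ i \<in> integers}"

definition lattice_Lr :: "'a::nonarch_local_field \<Rightarrow> nat \<Rightarrow> ('a^'n::{finite,linorder}) set" where
  "lattice_Lr \<pi> r =
     {y. \<forall>i. y $ i \<in> (if position i < r then (*) \<pi> ` integers else integers)}"

definition schwartz_quotient ::
    "('a::nonarch_local_field^'n::finite) set \<Rightarrow> ('a^'n) set \<Rightarrow> ('a^'n \<Rightarrow> complex) set" where
  "schwartz_quotient A B =
     {\<phi>\<in>schwartz. (\<forall>y. y \<notin> A \<longrightarrow> \<phi> y = 0) \<and> (\<forall>y. \<forall>b\<in>B. \<phi> (y + b) = \<phi> y)}"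

definition S_lower ::
    "'a::nonarch_local_field \<Rightarrow> nat \<Rightarrow> nat \<Rightarrow> ('a^'n::{finite,linorder} \<Rightarrow> complex) set" where
  "S_lower \<pi> r m = schwartz_quotient
     ((*s) (inverse (\<pi> ^ m)) ` lattice_L) ((*s) (2 * \<pi> ^ m) ` lattice_Lr \<pi> r)"

definition S_upper ::
    "'a::nonarch_local_field \<Rightarrow> nat \<Rightarrow> nat \<Rightarrow> ('a^'n::{finite,linorder} \<Rightarrow> complex) set" where
  "S_upper \<pi> r m = schwartz_quotient
     ((*s) (inverse (\<pi> ^ m)) ` lattice_Lr \<pi> r) ((*s) (2 * \<pi> ^ m) ` lattice_L)"

definition even_part :: "('v::uminus \<Rightarrow> complex) set \<Rightarrow> ('v \<Rightarrow> complex) set" where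
  "even_part U = {\<phi>\<in>U. \<forall>y. \<phi> (- y) = \<phi> y}"

definition odd_part :: "('v::uminus \<Rightarrow> complex) set \<Rightarrow> ('v \<Rightarrow> complex) set" where
  "odd_part U = {\<phi>\<in>U. \<forall>y. \<phi> (- y) = - \<phi> y}"

text \<open>
  The pieces of the decomposition. The argument \<open>\<epsilon>\<close> is \<^const>\<open>even_part\<close> or \<^const>\<open>odd_part\<close>,
  and \<open>V\<close> is the Weil representation.
\<close>

definition omega_rep ::
    "'a::nonarch_local_field \<Rightarrow> nat \<Rightarrow> ('g, ('a, 'n::{finite,linorder}) vec \<Rightarrow> complex) rep \<Rightarrow>
     ((('a, 'n) vec \<Rightarrow> complex) set \<Rightarrow> (('a, 'n) vec \<Rightarrow> complex) set) \<Rightarrow> ('g, ('a, 'n) vec \<Rightarrow> complex) rep" where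
  "omega_rep \<pi> r V \<epsilon> = sub_rep V (\<epsilon> (S_lower \<pi> r 0))"

definition mu_rep ::
    "'a::nonarch_local_field \<Rightarrow> nat \<Rightarrow> ('g, ('a, 'n::{finite,linorder}) vec \<Rightarrow> complex) rep \<Rightarrow>
     ((('a, 'n) vec \<Rightarrow> complex) set \<Rightarrow> (('a, 'n) vec \<Rightarrow> complex) set) \<Rightarrow> nat \<Rightarrow>
     ('g, (('a, 'n) vec \<Rightarrow> complex) set) rep" where
  "mu_rep \<pi> r V \<epsilon> m =
     quotient_rep (sub_rep V (\<epsilon> (S_upper \<pi> r m))) (\<epsilon> (S_lower \<pi> r (m - 1)))"

definition nu_rep ::
    "'a::nonarch_local_field \<Rightarrow> nat \<Rightarrow> ('g, ('a, 'n::{finite,linorder}) vec \<Rightarrow> complex) rep \<Rightarrow>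
     ((('a, 'n) vec \<Rightarrow> complex) set \<Rightarrow> (('a, 'n) vec \<Rightarrow> complex) set) \<Rightarrow> nat \<Rightarrow>
     ('g, (('a, 'n) vec \<Rightarrow> complex) set) rep" where
  "nu_rep \<pi> r V \<epsilon> m =
     quotient_rep (sub_rep V (\<epsilon> (S_lower \<pi> r m))) (\<epsilon> (S_upper \<pi> r m))"

end

theory Submission
  imports Defs
begin

text \<open>
  The two filtrations are interleaved to one chain \<open>level 0 \<subseteq> level 1 \<subseteq> \<dots>\<close> whose term \<open>level k\<close>
  consists of the functions supported in \<open>box_at (radius k)\<close> and invariant under
  \<open>box_at (period k)\<close>. The theorem rests on three facts about this chain.

  \<^bold>\<open>Invariance and complements.\<close> For \<open>w = c + b\<close> in \<open>W\<close> let \<open>heis w\<close> be the Heisenberg operator, a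
  translation by \<open>b\<close> times a character given by \<open>c\<close>. The operators of the Weil representation
  satisfy \<open>A g (heis w \<phi>) = heis (g w) (A g \<phi>)\<close> for all elements of the metaplectic group
  (\<open>A_heis\<close>): this can be checked for the prescribed lifts, their images generate the symplectic
  group (\<open>Sp_generated\<close>), and since the extension is not split, the lifts generate the metaplectic
  group. The functions of level \<open>k\<close> are those fixed by \<open>heis w\<close> for all \<open>w\<close> in a lattice
  \<open>period_lattice k\<close>, which is a multiple of the lattice defining the compact group for even \<open>k\<close>
  and of its symplectic dual for odd \<open>k\<close>. So the compact group preserves the level (\<open>A_level\<close>).
  The Heisenberg operators of this lattice commute and have finite orbits; averaging over them
  splits off \<open>level k\<close> from the whole space, and the kernel \<open>avg_kernel k\<close> of the averages is an
  invariant complement. Hence the space is the direct sum of the spaces \<open>component k s\<close> of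
  functions of level \<open>k\<close> and parity \<open>s\<close> in \<open>avg_kernel (k - 1)\<close>, which are isomorphic to the
  quotients of consecutive levels.

  \<^bold>\<open>Irreducibility.\<close> The unipotent elements act by multiplication with the functions
  \<open>y \<mapsto> \<psi> (dot y (a *v y))\<close>. On \<open>box_at (radius k)\<close>, these separate a point outside the inner box
  \<open>box_at (radius (k - 1))\<close> from all others up to sign and periods (\<open>separation\<close>). So an invariant
  subspace with a function that is nonzero at such a point contains a nonzero function supported
  in its class up to sign (\<open>exists_supported_in_class\<close>). Integral matrices of the form \<open>1 + v e\<^sub>i\<^sup>T\<close>
  move any of these points to any other, in at most two steps, so the subspace contains all
  functions of its parity that vanish on the inner box. A Weyl element exchanges the conditions on
  support and period, which takes care of the other functions (\<open>invariant_between_levels\<close>). In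
  level \<open>0\<close>, with \<open>box_at delta\<close> as inner box, odd functions vanish on the inner box, and for even
  functions the Weyl element produces a function without zeros on the support (\<open>invariant_even_level_0\<close>).

  \<^bold>\<open>Multiplicity one.\<close> The image of an irreducible representation under a nonzero intertwiner lies
  in some smallest level, and contains a function supported in a single class up to sign. Its
  eigencharacter under the unipotent elements and its parity determine it up to a scalar within
  its level, so a second intertwiner into the same level agrees with the first one up to a
  scalar on this vector, and hence everywhere (\<open>intertwiners_proportional\<close>).
\<close>

section \<open>The absolute value\<close>

lemma absv_eq_0_iff [simp]: "absv x = 0 \<longleftrightarrow> x = 0" for x :: "'a::nonarch_local_field"
  using dist_absv[of x 0] by auto

lemma absv_nonneg [simp]: "0 \<le> absv x" for x :: "'a::nonarch_local_field"
  using dist_absv[of x 0] zero_le_dist[of x 0] by simp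

lemma absv_pos_iff [simp]: "0 < absv x \<longleftrightarrow> x \<noteq> 0" for x :: "'a::nonarch_local_field"
  by (metis absv_eq_0_iff absv_nonneg less_le)

lemma absv_le_0_iff [simp]: "absv x \<le> 0 \<longleftrightarrow> x = 0" for x :: "'a::nonarch_local_field"
  by (metis absv_eq_0_iff absv_nonneg antisym order.refl)

lemma absv_0 [simp]: "absv (0::'a::nonarch_local_field) = 0"
  by simp

lemma absv_1 [simp]: "absv (1::'a::nonarch_local_field) = 1"
  using absv_mult[of "1::'a" 1] by simp

lemma absv_minus [simp]: "absv (- x) = absv x" for x :: "'a::nonarch_local_field"
  using dist_absv[of x 0] dist_absv[of 0 x] by (simp add: dist_commute)

lemma absv_inverse: "absv (inverse x) = inverse (absv x)" for x :: "'a::nonarch_local_field"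
proof (cases "x = 0")
  case False
  then have "absv x * absv (inverse x) = 1"
    by (simp flip: absv_mult)
  then show ?thesis
    by (metis inverse_unique)
qed simp

lemma absv_divide: "absv (x / y) = absv x / absv y" for x :: "'a::nonarch_local_field"
  by (simp add: divide_inverse absv_mult absv_inverse)

lemma absv_power: "absv (x ^ n) = absv x ^ n" for x :: "'a::nonarch_local_field"
  by (induction n) (simp_all add: absv_mult)

lemmas absv_simps = absv_mult absv_divide absv_inverse absv_power

lemma absv_add_le: "absv x \<le> c \<Longrightarrow> absv y \<le> c \<Longrightarrow> absv (x + y) \<le> c"
  for x :: "'a::nonarch_local_field"
  using absv_ultrametric[of x y] by simp

lemma absv_diff_le: "absv x \<le> c \<Longrightarrow> absv y \<le> c \<Longrightarrow> absv (x - y) \<le> c"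
  for x :: "'a::nonarch_local_field"
  using absv_ultrametric[of x "- y"] by simp

lemma absv_sum_le: "0 \<le> c \<Longrightarrow> (\<And>i. i \<in> I \<Longrightarrow> absv (f i) \<le> c) \<Longrightarrow> absv (\<Sum>i\<in>I. f i) \<le> c"
  for f :: "'i \<Rightarrow> 'a::nonarch_local_field"
  by (induction I rule: infinite_finite_induct) (auto intro: absv_add_le)

lemma absv_add_dominant:
  fixes x y :: "'a::nonarch_local_field"
  assumes "absv x < absv y"
  shows "absv (x + y) = absv y"
proof (rule antisym)
  show "absv (x + y) \<le> absv y"
    using assms by (intro absv_add_le) auto
  show "absv y \<le> absv (x + y)"
    using absv_ultrametric[of "x + y" "- x"] assms by auto
qed

lemma absv_of_nat_le: "absv (of_nat n :: 'a::nonarch_local_field) \<le> 1"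
  by (induction n) (auto intro: absv_add_le)

lemma absv_numeral_le: "absv (numeral n :: 'a::nonarch_local_field) \<le> 1"
  using absv_of_nat_le[of "numeral n", where 'a='a] by simp

lemma in_scaled_integers_iff:
  "c \<noteq> 0 \<Longrightarrow> x \<in> (*) c ` integers \<longleftrightarrow> absv x \<le> absv c" for x :: "'a::nonarch_local_field"
proof
  assume c: "c \<noteq> 0" and "absv x \<le> absv c"
  then have "x / c \<in> integers" "x = c * (x / c)"
    by (simp_all add: integers_def absv_divide divide_le_eq)
  then show "x \<in> (*) c ` integers"
    by blast
qed (auto simp: integers_def absv_mult mult_left_le)

lemma uniformizerD:
  fixes \<pi> :: "'a::nonarch_local_field"
  assumes "uniformizer \<pi>"
  shows "\<pi> \<noteq> 0" "absv \<pi> < 1" "\<And>x::'a. absv x < 1 \<Longrightarrow> absv x \<le> absv \<pi>"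
proof -
  have *: "absv x < 1 \<longleftrightarrow> absv x \<le> absv \<pi>" for x :: 'a
    using assms in_scaled_integers_iff[of \<pi> x] by (auto simp: uniformizer_def)
  show "\<pi> \<noteq> 0"
    using assms by (simp add: uniformizer_def)
  show "absv \<pi> < 1" "\<And>x::'a. absv x < 1 \<Longrightarrow> absv x \<le> absv \<pi>"
    using * by auto
qed

section \<open>Balls modulo smaller balls are finite, and boxes are compact\<close>

text \<open>
  Representatives modulo a power of the uniformizer are refined by adding this power times
  representatives of the residue classes.
\<close>

lemma finite_residues_power:
  fixes \<pi> :: "'a::nonarch_local_field"
  assumes "uniformizer \<pi>"
  shows "\<exists>R::'a set. finite R \<and> (\<forall>x. absv x \<le> 1 \<longrightarrow> (\<exists>y\<in>R. absv (x - y) \<le> absv \<pi> ^ n))"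
proof (induction n)
  case 0
  then show ?case
    by (intro exI[of _ "{0}"]) auto
next
  case (Suc n)
  note \<pi> = uniformizerD[OF assms]
  obtain X where X: "finite X" "X \<subseteq> {x. absv x \<le> 1}"
    "(\<lambda>x. {y::'a. absv (y - x) < 1}) ` {x. absv x \<le> 1} = (\<lambda>x. {y. absv (y - x) < 1}) ` X"
    using finite_subset_image[OF finite_residue_field[where 'a='a] order.refl] by blast
  have R1: "\<exists>y\<in>X. absv (x - y) \<le> absv \<pi>" if x: "absv x \<le> 1" for x
  proof -
    obtain y where y: "y \<in> X" "{z. absv (z - x) < 1} = {z. absv (z - y) < 1}"
      using X(3) x by (metis (mono_tags, lifting) imageE imageI mem_Collect_eq)
    moreover have "x \<in> {z. absv (z - x) < 1}"
      by simp
    ultimately show ?thesis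
      using \<pi>(3) by blast
  qed
  obtain R where R: "finite R" "\<And>x::'a. absv x \<le> 1 \<Longrightarrow> \<exists>y\<in>R. absv (x - y) \<le> absv \<pi> ^ n"
    using Suc by blast
  show ?case
  proof (intro exI[of _ "(\<lambda>(y, z). y + \<pi> ^ n * z) ` (R \<times> X)"] conjI allI impI)
    fix x :: 'a
    assume "absv x \<le> 1"
    then obtain y where y: "y \<in> R" "absv (x - y) \<le> absv \<pi> ^ n"
      using R by blast
    then have "absv ((x - y) / \<pi> ^ n) \<le> 1"
      using \<pi>(1) by (simp add: absv_simps divide_le_eq)
    then obtain z where z: "z \<in> X" "absv ((x - y) / \<pi> ^ n - z) \<le> absv \<pi>"
      using R1 by blast
    have "x - (y + \<pi> ^ n * z) = \<pi> ^ n * ((x - y) / \<pi> ^ n - z)"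
      using \<pi>(1) by (simp add: field_simps)
    then have "absv (x - (y + \<pi> ^ n * z)) \<le> absv \<pi> ^ Suc n"
      using mult_left_mono[OF z(2), of "absv \<pi> ^ n"] by (simp add: absv_simps mult.commute)
    then show "\<exists>w\<in>(\<lambda>(y, z). y + \<pi> ^ n * z) ` (R \<times> X). absv (x - w) \<le> absv \<pi> ^ Suc n"
      using y(1) z(1) by (intro bexI[of _ "y + \<pi> ^ n * z"]) auto
  qed (use R X in auto)
qed

lemma exists_uniformizer: "\<exists>\<pi>::'a::nonarch_local_field. uniformizer \<pi>"
proof -
  obtain \<pi> :: 'a where \<pi>: "0 < absv \<pi>" "absv \<pi> < 1" "\<forall>x::'a. absv x < 1 \<longrightarrow> absv x \<le> absv \<pi>"
    using normalized_uniformizer_exists by blast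
  then have "(*) \<pi> ` integers = {x. absv x < 1}"
    using in_scaled_integers_iff[of \<pi>] by (auto intro: le_less_trans)
  then show ?thesis
    using \<pi> by (auto simp: uniformizer_def)
qed

lemma finite_residues:
  fixes c d :: "'a::nonarch_local_field"
  assumes "d \<noteq> 0"
  shows "\<exists>R::'a set. finite R \<and> (\<forall>x. absv x \<le> absv c \<longrightarrow> (\<exists>y\<in>R. absv (x - y) \<le> absv d))"
proof (cases "c = 0")
  case True
  then show ?thesis
    by (intro exI[of _ "{0}"]) auto
next
  case c: False
  obtain \<pi> :: 'a where u: "uniformizer \<pi>"
    using exists_uniformizer by blast
  note \<pi> = uniformizerD[OF u]
  have "absv d / absv c > 0"
    using c assms by simp
  then obtain n where n: "absv \<pi> ^ n < absv d / absv c"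
    using real_arch_pow_inv \<pi>(2) by blast
  obtain R where R: "finite R" "\<And>x::'a. absv x \<le> 1 \<Longrightarrow> \<exists>y\<in>R. absv (x - y) \<le> absv \<pi> ^ n"
    using finite_residues_power[OF u] by blast
  show ?thesis
  proof (intro exI[of _ "(*) c ` R"] conjI allI impI)
    fix x :: 'a
    assume "absv x \<le> absv c"
    then have "absv (x / c) \<le> 1"
      using c by (simp add: absv_simps)
    then obtain y where y: "y \<in> R" "absv (x / c - y) \<le> absv \<pi> ^ n"
      using R by blast
    have "x - c * y = c * (x / c - y)"
      using c by (simp add: field_simps)
    then have "absv (x - c * y) = absv c * absv (x / c - y)"
      by (simp add: absv_mult)
    also have "\<dots> \<le> absv c * (absv d / absv c)"
      using y n by (intro mult_left_mono) auto
    finally show "\<exists>y\<in>(*) c ` R. absv (x - y) \<le> absv d"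
      using y(1) c by auto
  qed (use R in auto)
qed

text \<open>
  All lattices in this development are boxes: every coordinate ranges over a ball.
\<close>

definition box_at :: "('n \<Rightarrow> 'a) \<Rightarrow> ('a::nonarch_local_field^'n::finite) set" where
  "box_at d = {y. \<forall>i. absv (y $ i) \<le> absv (d i)}"

lemma in_box_at_iff: "y \<in> box_at d \<longleftrightarrow> (\<forall>i. absv (y $ i) \<le> absv (d i))"
  by (simp add: box_at_def)

lemma box_at_0 [simp]: "0 \<in> box_at d"
  by (simp add: box_at_def)

lemma box_at_add: "x \<in> box_at d \<Longrightarrow> y \<in> box_at d \<Longrightarrow> x + y \<in> box_at d"
  by (auto simp: box_at_def intro: absv_add_le)

lemma box_at_diff: "x \<in> box_at d \<Longrightarrow> y \<in> box_at d \<Longrightarrow> x - y \<in> box_at d"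
  by (auto simp: box_at_def intro: absv_diff_le)

lemma box_at_minus [simp]: "- x \<in> box_at d \<longleftrightarrow> x \<in> box_at d"
  by (auto simp: box_at_def)

lemma box_at_mono: "(\<And>i. absv (d i) \<le> absv (e i)) \<Longrightarrow> box_at d \<subseteq> box_at e"
  by (auto simp: box_at_def intro: order_trans)

lemma box_at_add_iff: "b \<in> box_at d \<Longrightarrow> y + b \<in> box_at d \<longleftrightarrow> y \<in> box_at d"
  by (metis add_diff_cancel_right' box_at_add box_at_diff)

lemma finite_residues_vec:
  fixes c d :: "'n::finite \<Rightarrow> 'a::nonarch_local_field"
  assumes "\<And>i. d i \<noteq> 0"
  shows "\<exists>R::('a^'n) set. finite R \<and> (\<forall>x\<in>box_at c. \<exists>y\<in>R. x - y \<in> box_at d)"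
proof -
  have "\<forall>i. \<exists>R::'a set. finite R \<and> (\<forall>x. absv x \<le> absv (c i) \<longrightarrow> (\<exists>y\<in>R. absv (x - y) \<le> absv (d i)))"
    using finite_residues assms by blast
  then obtain R where R: "\<And>i. finite (R i)"
    "\<And>i (x::'a). absv x \<le> absv (c i) \<Longrightarrow> \<exists>y\<in>R i. absv (x - y) \<le> absv (d i)"
    by metis
  define S :: "('a^'n) set" where "S = (\<lambda>f. \<chi> i. f i) ` (\<Pi>\<^sub>E i\<in>UNIV. R i)"
  have "finite S"
    unfolding S_def using R by (intro finite_imageI finite_PiE) auto
  moreover have "\<exists>y\<in>S. x - y \<in> box_at d" if "x \<in> box_at c" for x
  proof -
    have "\<forall>i. \<exists>y\<in>R i. absv (x $ i - y) \<le> absv (d i)"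
      using that R(2) by (simp add: box_at_def)
    then obtain f where f: "\<And>i. f i \<in> R i" "\<And>i. absv (x $ i - f i) \<le> absv (d i)"
      by metis
    then have "(\<chi> i. f i) \<in> S" "x - (\<chi> i. f i) \<in> box_at d"
      by (auto simp: S_def box_at_def)
    then show ?thesis
      by blast
  qed
  ultimately show ?thesis
    by blast
qed

lemma dist_vec_le:
  fixes x y :: "'a::nonarch_local_field^'n::finite"
  assumes "\<And>i. absv (x $ i - y $ i) \<le> e"
  shows "dist x y \<le> real CARD('n) * e"
proof -
  have "dist x y \<le> (\<Sum>i\<in>UNIV. dist (x $ i) (y $ i))"
    unfolding dist_vec_def by (rule L2_set_le_sum) auto
  also have "\<dots> \<le> (\<Sum>i\<in>(UNIV::'n set). e)"
    using assms by (intro sum_mono) (simp add: dist_absv)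
  finally show ?thesis
    by simp
qed

lemma absv_nth_le_dist: "absv (x $ i - y $ i) \<le> dist x y"
  for x y :: "'a::nonarch_local_field^'n::finite"
  using dist_vec_nth_le[of x i y] by (simp add: dist_absv)

lemma exists_small: "0 < e \<Longrightarrow> \<exists>d::'a::nonarch_local_field. d \<noteq> 0 \<and> absv d < e"
proof -
  assume e: "0 < e"
  obtain \<pi> :: 'a where u: "uniformizer \<pi>"
    using exists_uniformizer by blast
  note \<pi> = uniformizerD[OF u]
  obtain n where "absv \<pi> ^ n < e"
    using real_arch_pow_inv \<pi>(2) e by blast
  then show ?thesis
    using \<pi>(1) by (intro exI[of _ "\<pi> ^ n"]) (simp add: absv_power)
qed

lemma exists_below:
  fixes d :: "'n::finite \<Rightarrow> 'a::nonarch_local_field"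
  assumes "\<And>i. d i \<noteq> 0"
  shows "\<exists>e::'a. e \<noteq> 0 \<and> (box_at (\<lambda>_. e) :: ('a^'n) set) \<subseteq> box_at d"
proof -
  have "0 < Min (range (\<lambda>i. absv (d i)))"
    using assms by simp
  then obtain e :: 'a where e: "e \<noteq> 0" "absv e < Min (range (\<lambda>i. absv (d i)))"
    using exists_small by blast
  then have "(box_at (\<lambda>_. e) :: ('a^'n) set) \<subseteq> box_at d"
    by (intro box_at_mono) (auto intro: less_imp_le)
  then show ?thesis
    using e(1) by blast
qed

lemma exists_large: "\<exists>c::'a::nonarch_local_field. c \<noteq> 0 \<and> e < absv c"
proof -
  obtain d :: 'a where "d \<noteq> 0" "absv d < inverse (\<bar>e\<bar> + 1)"
    using exists_small[of "inverse (\<bar>e\<bar> + 1)", where 'a='a] by (auto simp: add_nonneg_pos)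
  then have "inverse d \<noteq> 0" "\<bar>e\<bar> + 1 < absv (inverse d)"
    using less_imp_inverse_less[of "absv d" "inverse (\<bar>e\<bar> + 1)"] by (auto simp: absv_inverse)
  then show ?thesis
    by (intro exI[of _ "inverse d"]) auto
qed

lemma open_if_box_invariant:
  fixes U :: "('a::nonarch_local_field^'n::finite) set"
  assumes "d \<noteq> 0" "\<And>y b. y \<in> U \<Longrightarrow> b \<in> box_at (\<lambda>_. d) \<Longrightarrow> y + b \<in> U"
  shows "open U"
  unfolding open_dist
proof (intro ballI exI[of _ "absv d"] conjI allI impI)
  fix x y
  assume "x \<in> U" "dist y x < absv d"
  moreover then have "y - x \<in> box_at (\<lambda>_. d)"
    using absv_nth_le_dist[of y _ x] by (auto simp: box_at_def) (meson less_le_not_le order_trans linear)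
  ultimately show "y \<in> U"
    using assms(2)[of x "y - x"] by simp
qed (use assms in simp)

lemma closed_box_at:
  fixes c :: "'n::finite \<Rightarrow> 'a::nonarch_local_field"
  assumes "\<And>i. c i \<noteq> 0"
  shows "closed (box_at c)"
proof -
  obtain d :: 'a where d: "d \<noteq> 0" "(box_at (\<lambda>_. d) :: ('a^'n) set) \<subseteq> box_at c"
    using exists_below[of c, OF assms] by blast
  then show ?thesis
    unfolding closed_def by (intro open_if_box_invariant[OF d(1)]) (auto simp: box_at_add_iff)
qed

text \<open>
  Boxes are closed in a complete space, and they are totally bounded because each is covered by
  finitely many translates of any smaller box.
\<close>

lemma compact_box_at:
  fixes c :: "'n::finite \<Rightarrow> 'a::nonarch_local_field"
  assumes "\<And>i. c i \<noteq> 0"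
  shows "compact (box_at c)"
  unfolding compact_eq_totally_bounded
proof (intro conjI allI impI)
  show "complete (box_at c)"
    using closed_box_at[OF assms] by (simp add: complete_eq_closed)
  fix e :: real
  assume "0 < e"
  then have "0 < e / real CARD('n)"
    by simp
  then obtain d :: 'a where d: "d \<noteq> 0" "absv d < e / real CARD('n)"
    using exists_small by blast
  obtain R :: "('a^'n) set" where R: "finite R" "\<And>x. x \<in> box_at c \<Longrightarrow> \<exists>y\<in>R. x - y \<in> box_at (\<lambda>_. d)"
    using finite_residues_vec[of "\<lambda>_. d" c] d(1) by blast
  have "dist x y < e" if "x - y \<in> box_at (\<lambda>_. d)" for x y :: "'a^'n"
  proof -
    have "dist x y \<le> real CARD('n) * absv d"
      using that by (intro dist_vec_le) (simp add: box_at_def)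
    also have "\<dots> < e"
      using d(2) by (simp add: field_simps)
    finally show ?thesis .
  qed
  then show "\<exists>k. finite k \<and> box_at c \<subseteq> (\<Union>x\<in>k. ball x e)"
    using R by (intro exI[of _ R]) (auto simp: dist_commute, blast)
qed

lemma scalar_image_box_at:
  fixes c :: "'a::nonarch_local_field"
  assumes "c \<noteq> 0"
  shows "(*s) c ` box_at d = box_at (\<lambda>i. c * d i)"
proof (intro equalityI subsetI)
  fix y assume "y \<in> box_at (\<lambda>i. c * d i)"
  then have "inverse c *s y \<in> box_at d"
    using assms by (simp add: box_at_def absv_simps field_simps)
  moreover have "y = c *s (inverse c *s y)"
    using assms by (simp add: vector_smult_assoc)
  ultimately show "y \<in> (*s) c ` box_at d"
    by blast
qed (auto simp: box_at_def absv_mult mult_left_mono)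

section \<open>Schwartz functions\<close>

text \<open>
  From left to right, a Lebesgue number of a cover of the compact support by open sets on which the
  function is constant gives the uniform period; the converse holds because boxes are compact. With this
  characterization, Schwartz functions are handled algebraically.
\<close>

lemma schwartz_iff:
  fixes \<phi> :: "'a::nonarch_local_field^'n::finite \<Rightarrow> complex"
  shows "\<phi> \<in> schwartz \<longleftrightarrow>
    (\<exists>c. c \<noteq> 0 \<and> (\<forall>y. \<phi> y \<noteq> 0 \<longrightarrow> y \<in> box_at (\<lambda>_. c))) \<and>
    (\<exists>d. d \<noteq> 0 \<and> (\<forall>y. \<forall>b\<in>box_at (\<lambda>_. d). \<phi> (y + b) = \<phi> y))"
    (is "_ \<longleftrightarrow> ?bdd \<and> ?inv")
proof (intro iffI conjI)
  assume \<phi>: "\<phi> \<in> schwartz"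
  define C where "C = closure {y. \<phi> y \<noteq> 0}"
  have C: "compact C" and lc: "locally_constant \<phi>"
    using \<phi> by (auto simp: schwartz_def C_def)
  have inC: "y \<in> C" if "\<phi> y \<noteq> 0" for y
    unfolding C_def by (rule subsetD[OF closure_subset]) (use that in simp)
  obtain M where M: "\<And>y. y \<in> C \<Longrightarrow> dist 0 y \<le> M"
    using compact_imp_bounded[OF C] bounded_any_center[of C 0] by auto
  obtain c :: 'a where c: "c \<noteq> 0" "M < absv c"
    using exists_large by blast
  have "y \<in> box_at (\<lambda>_. c)" if "\<phi> y \<noteq> 0" for y
  proof -
    have "y \<in> C"
      using that by (rule inC)
    then show ?thesis
      unfolding box_at_def
      using M c(2) absv_nth_le_dist[of 0 _ y] by simp (meson less_imp_le order_trans)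
  qed
  then show ?bdd
    using c(1) by blast
  define \<G> where "\<G> = {U. open U \<and> \<phi> constant_on U}"
  have cover: "C \<subseteq> \<Union>\<G>" and opens: "\<And>G. G \<in> \<G> \<Longrightarrow> open G"
    using lc by (auto simp: \<G>_def locally_constant_def)
  obtain e where e: "0 < e" "\<And>x. x \<in> C \<Longrightarrow> \<exists>G\<in>\<G>. ball x e \<subseteq> G"
    using Heine_Borel_lemma[OF C cover opens] by metis
  then have "0 < e / real CARD('n)"
    by simp
  then obtain d :: 'a where d: "d \<noteq> 0" "absv d < e / real CARD('n)"
    using exists_small by blast
  have near: "\<phi> (y + b) = \<phi> y" if y: "y \<in> C" and b: "b \<in> box_at (\<lambda>_. d)" for y b
  proof -
    have "dist y (y + b) \<le> real CARD('n) * absv d"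
      using b by (intro dist_vec_le) (simp add: box_at_def)
    also have "\<dots> < e"
      using d(2) by (simp add: field_simps)
    finally have "y + b \<in> ball y e" "y \<in> ball y e"
      using e(1) by auto
    moreover obtain G where "G \<in> \<G>" "ball y e \<subseteq> G"
      using e(2)[OF y] by blast
    moreover from this(1) obtain z where "\<And>x. x \<in> G \<Longrightarrow> \<phi> x = z"
      by (auto simp: \<G>_def constant_on_def)
    ultimately show ?thesis
      by (metis subsetD)
  qed
  have "\<phi> (y + b) = \<phi> y" if b: "b \<in> box_at (\<lambda>_. d)" for y b
  proof (cases "y \<in> C")
    case False
    have "y + b \<notin> C \<or> \<phi> (y + b) = \<phi> y"
      using near[of "y + b" "- b"] b by auto
    then show ?thesis
      using False inC by metis
  qed (use near b in blast)
  then show ?inv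
    using d(1) by blast
next
  assume "?bdd \<and> ?inv"
  then obtain c d where c: "c \<noteq> 0" "\<And>y. \<phi> y \<noteq> 0 \<Longrightarrow> y \<in> box_at (\<lambda>_. c)"
    and d: "d \<noteq> 0" "\<And>y b. b \<in> box_at (\<lambda>_. d) \<Longrightarrow> \<phi> (y + b) = \<phi> y"
    by blast
  have "{y. \<phi> y \<noteq> 0} \<subseteq> box_at (\<lambda>_. c)"
    using c(2) by blast
  then have "closure {y. \<phi> y \<noteq> 0} \<subseteq> box_at (\<lambda>_. c)"
    using closed_box_at[of "\<lambda>_. c"] c(1) by (metis closure_minimal)
  then have "compact (closure {y. \<phi> y \<noteq> 0})"
    using compact_box_at[of "\<lambda>_. c"] c(1)
    by (metis closed_closure compact_Int_closed inf.absorb_iff2)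
  moreover have "\<exists>U. open U \<and> x \<in> U \<and> \<phi> constant_on U" for x
  proof (intro exI[of _ "{y. \<phi> y = \<phi> x}"] conjI)
    show "open {y. \<phi> y = \<phi> x}"
      using d by (intro open_if_box_invariant[OF d(1)]) auto
  qed (auto simp: constant_on_def)
  ultimately show "\<phi> \<in> schwartz"
    by (simp add: schwartz_def locally_constant_def)
qed

section \<open>Block matrices and generators of the symplectic group\<close>

definition vec_pair :: "'a^'n \<Rightarrow> 'a^'n \<Rightarrow> 'a^('n::finite + 'n)" where
  "vec_pair c b = (\<chi> k. case k of Inl i \<Rightarrow> c $ i | Inr i \<Rightarrow> b $ i)"

definition vec_left :: "'a^('n::finite + 'n) \<Rightarrow> 'a^'n" where
  "vec_left w = (\<chi> i. w $ Inl i)"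

definition vec_right :: "'a^('n::finite + 'n) \<Rightarrow> 'a^'n" where
  "vec_right w = (\<chi> i. w $ Inr i)"

lemma vec_pair_nth [simp]: "vec_pair c b $ Inl i = c $ i" "vec_pair c b $ Inr i = b $ i"
  by (simp_all add: vec_pair_def)

lemma vec_pair_eta: "vec_pair (vec_left w) (vec_right w) = w"
  by (auto simp: vec_eq_iff vec_pair_def vec_left_def vec_right_def split: sum.split)

lemma vec_left_right_nth [simp]: "vec_left w $ i = w $ Inl i" "vec_right w $ i = w $ Inr i"
  by (simp_all add: vec_left_def vec_right_def)

lemma vec_left_right_pair [simp]: "vec_left (vec_pair c b) = c" "vec_right (vec_pair c b) = b"
  by (simp_all add: vec_eq_iff)

lemma vec_left_right_add [simp]:
  "vec_left (v + w) = vec_left v + vec_left w" "vec_right (v + w) = vec_right v + vec_right w"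
  by (simp_all add: vec_eq_iff)

lemma vec_left_right_minus [simp]:
  "vec_left (- v) = - vec_left v" "vec_right (- v) = - vec_right v"
  for v :: "'a::group_add^('n::finite + 'n)"
  by (simp_all add: vec_eq_iff)

lemma forall_sum_type: "(\<forall>k. P k) \<longleftrightarrow> (\<forall>i. P (Inl i)) \<and> (\<forall>i. P (Inr i))"
  by (metis sum.exhaust)

lemma sum_sum_type:
  "(\<Sum>k\<in>UNIV. f k) = (\<Sum>i\<in>UNIV. f (Inl i)) + (\<Sum>i\<in>UNIV. f (Inr i))"
  for f :: "'n::finite + 'n \<Rightarrow> 'a::comm_monoid_add"
proof -
  have "(\<Sum>k\<in>UNIV. f k) = sum f (Inl ` UNIV) + sum f (Inr ` UNIV)"
    unfolding UNIV_sum by (rule sum.union_disjoint) auto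
  then show ?thesis
    by (simp add: sum.reindex)
qed

lemma block_matrix_nth [simp]:
  "block_matrix a b c d $ Inl i $ Inl j = a $ i $ j"
  "block_matrix a b c d $ Inl i $ Inr j = b $ i $ j"
  "block_matrix a b c d $ Inr i $ Inl j = c $ i $ j"
  "block_matrix a b c d $ Inr i $ Inr j = d $ i $ j"
  by (simp_all add: block_matrix_def)

lemma block_matrix_mult_pair:
  fixes a b c d :: "'a::comm_ring_1^'n::finite^'n"
  shows "block_matrix a b c d *v vec_pair x y = vec_pair (a *v x + b *v y) (c *v x + d *v y)"
  by (simp add: vec_eq_iff forall_sum_type matrix_vector_mult_def sum_sum_type)

lemma block_matrix_mult:
  fixes a b c d :: "'a::comm_ring_1^'n::finite^'n"
  shows "block_matrix a b c d ** block_matrix a' b' c' d' =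
    block_matrix (a ** a' + b ** c') (a ** b' + b ** d') (c ** a' + d ** c') (c ** b' + d ** d')"
  by (simp add: vec_eq_iff forall_sum_type matrix_matrix_mult_def sum_sum_type)

lemma transpose_block_matrix:
  "transpose (block_matrix a b c d) =
    block_matrix (transpose a) (transpose c) (transpose b) (transpose d)"
  by (simp add: vec_eq_iff forall_sum_type transpose_def)

lemma block_matrix_cases:
  obtains a b c d where "g = block_matrix a b c d"
proof
  show "g = block_matrix (\<chi> i j. g $ Inl i $ Inl j) (\<chi> i j. g $ Inl i $ Inr j)
      (\<chi> i j. g $ Inr i $ Inl j) (\<chi> i j. g $ Inr i $ Inr j)"
    by (simp add: vec_eq_iff forall_sum_type)
qed

lemma block_matrix_eq_iff:
  "block_matrix a b c d = block_matrix a' b' c' d' \<longleftrightarrow> a = a' \<and> b = b' \<and> c = c' \<and> d = d'"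
  by (auto simp: vec_eq_iff forall_sum_type)

lemma mat_1_eq_block: "mat 1 = block_matrix (mat 1) 0 0 (mat 1)"
  by (auto simp: vec_eq_iff forall_sum_type mat_def)

lemma transpose_zero [simp]: "transpose 0 = 0"
  by (simp add: vec_eq_iff transpose_def)

lemma transpose_add: "transpose (A + B) = transpose A + transpose B"
  by (simp add: vec_eq_iff transpose_def)

lemma transpose_diff: "transpose (A - B) = transpose A - transpose B"
  by (simp add: vec_eq_iff transpose_def)

lemma transpose_uminus: "transpose (- A) = - transpose A"
  by (simp add: vec_eq_iff transpose_def)

lemma matrix_minus_mult [simp]: "(- A) ** B = - (A ** B)" "A ** (- B) = - (A ** B)"
  for A :: "'a::ring_1^_^_"
  by (simp_all add: vec_eq_iff matrix_matrix_mult_def sum_negf)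

lemma matrix_diff_ldistrib: "A ** (B - C) = A ** B - A ** C" for A :: "'a::ring_1^_^_"
  by (simp add: vec_eq_iff matrix_matrix_mult_def sum_subtractf algebra_simps)

lemma matrix_diff_rdistrib: "(A - B) ** C = A ** C - B ** C" for A :: "'a::ring_1^_^_"
  by (simp add: vec_eq_iff matrix_matrix_mult_def sum_subtractf algebra_simps)

lemma matrix_add_rdistrib': "(A + B) ** C = A ** C + B ** C" for A :: "'a::ring_1^_^_"
  by (simp add: vec_eq_iff matrix_matrix_mult_def sum.distrib algebra_simps)

lemma matrix_minus_vector [simp]: "(- A) *v x = - (A *v x)" for A :: "'a::ring_1^_^_"
  by (simp add: vec_eq_iff matrix_vector_mult_def sum_negf)

lemma matrix_vector_minus [simp]: "A *v (- x) = - (A *v x)" for A :: "'a::ring_1^_^_"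
  by (simp add: vec_eq_iff matrix_vector_mult_def sum_negf)

lemma matrix_inv_inverse:
  assumes "invertible A"
  shows "A ** matrix_inv A = mat 1" "matrix_inv A ** A = mat 1"
  using assms someI_ex[of "\<lambda>B. A ** B = mat 1 \<and> B ** A = mat 1"]
  by (auto simp: invertible_def matrix_inv_def)

lemma matrix_inv_eqI:
  fixes A B :: "'a::semiring_1^'n^'n"
  assumes "A ** B = mat 1" "B ** A = mat 1"
  shows "matrix_inv A = B"
proof -
  have "invertible A"
    using assms by (auto simp: invertible_def)
  then have "matrix_inv A = matrix_inv A ** (A ** B)"
    using assms by simp
  then show ?thesis
    using \<open>invertible A\<close> by (simp add: matrix_mul_assoc matrix_inv_inverse)
qed

lemma block_matrix_in_Sp_iff:
  fixes a b c d :: "'a::comm_ring_1^'n::finite^'n"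
  shows "block_matrix a b c d \<in> carrier Sp \<longleftrightarrow>
    transpose a ** c = transpose c ** a \<and> transpose b ** d = transpose d ** b \<and>
    transpose a ** d - transpose c ** b = mat 1"
proof -
  have "block_matrix a b c d \<in> carrier Sp \<longleftrightarrow>
    transpose a ** c = transpose c ** a \<and> transpose b ** d = transpose d ** b \<and>
    transpose a ** d - transpose c ** b = mat 1 \<and> transpose b ** c - transpose d ** a = - mat 1"
    by (auto simp: Sp_def symplectic_form_def transpose_block_matrix block_matrix_mult
        block_matrix_eq_iff algebra_simps)
  moreover have "transpose b ** c - transpose d ** a = - mat 1"
    if "transpose a ** d - transpose c ** b = mat 1"
  proof -
    have "transpose (transpose a ** d - transpose c ** b) = mat 1"
      using that by (simp add: transpose_mat)
    then show ?thesis
      by (simp add: transpose_diff matrix_transpose_mul algebra_simps)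
  qed
  ultimately show ?thesis
    by blast
qed

lemma dot_commute: "dot u v = dot v u"
  by (simp add: dot_def mult.commute)

lemma dot_add [simp]: "dot (u + v) w = dot u w + dot v w" "dot w (u + v) = dot w u + dot w v"
  by (simp_all add: dot_def algebra_simps sum.distrib)

lemma dot_minus [simp]: "dot (- u) w = - dot u w" "dot w (- u) = - dot w u"
  by (simp_all add: dot_def sum_negf)

lemma dot_diff [simp]: "dot (u - v) w = dot u w - dot v w" "dot w (u - v) = dot w u - dot w v"
  by (simp_all add: dot_def algebra_simps sum_subtractf)

lemma dot_zero [simp]: "dot 0 w = 0" "dot w 0 = 0"
  by (simp_all add: dot_def)

lemma dot_scalar [simp]: "dot (k *s u) w = k * dot u w" "dot w (k *s u) = k * dot w u"
  by (simp_all add: dot_def sum_distrib_left algebra_simps)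

lemma dot_axis [simp]: "dot (axis i t) v = t * v $ i" "dot v (axis i t) = v $ i * t"
  by (simp_all add: dot_def axis_def if_distrib if_distribR cong: if_cong)

lemma dot_matrix_transpose: "dot u (A *v v) = dot (transpose A *v u) v"
  unfolding dot_def matrix_vector_mult_def transpose_def
  by (simp add: sum_distrib_left sum_distrib_right) (subst sum.swap, simp add: mult_ac)

text \<open>
  Adding a diagonal matrix times \<open>a\<close> to \<open>c\<close> can always make \<open>c\<close> invertible: as long as \<open>c\<close>
  has a kernel vector \<open>v\<close>, the vector \<open>a *v v\<close> is nonzero and annihilates the image of \<open>c\<close>, by
  the symmetry condition. If its \<open>i\<close>-th coordinate is nonzero, then \<open>axis i 1\<close> is outside the
  image, and adding the \<open>i\<close>-th row of \<open>a\<close> to the \<open>i\<close>-th row of \<open>c\<close> shrinks the kernel.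
\<close>

lemma exists_shear_invertible:
  fixes a c :: "'a::field^'n::finite^'n"
  assumes "transpose a ** c = transpose c ** a" "\<And>v. a *v v = 0 \<Longrightarrow> c *v v = 0 \<Longrightarrow> v = 0"
  shows "\<exists>s. transpose s = s \<and> invertible (c + s ** a)"
  using assms
proof (induction "vec.dim {v. c *v v = 0}" arbitrary: c rule: less_induct)
  case less
  show ?case
  proof (cases "\<forall>v. c *v v = 0 \<longrightarrow> v = 0")
    case True
    then have "invertible (c + 0 ** a)"
      by (simp add: invertible_left_inverse matrix_left_invertible_ker)
    then show ?thesis
      by (intro exI[of _ 0]) simp
  next
    case False
    then obtain v0 where v0: "c *v v0 = 0" "v0 \<noteq> 0"
      by blast
    then have "a *v v0 \<noteq> 0"
      using less.prems(2) by blast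
    then obtain i where i: "(a *v v0) $ i \<noteq> 0"
      by (auto simp: vec_eq_iff)
    define s0 :: "'a^'n^'n" where "s0 = (\<chi> k l. if k = i \<and> l = i then 1 else 0)"
    have s0: "transpose s0 = s0" "\<And>x. s0 *v x = axis i (x $ i)"
      by (auto simp: s0_def transpose_def vec_eq_iff matrix_vector_mult_def axis_def
          if_distrib if_distribR cong: if_cong)
    define c1 where "c1 = c + s0 ** a"
    have c1v: "c1 *v v = c *v v + axis i ((a *v v) $ i)" for v
      by (simp add: c1_def matrix_vector_mult_add_rdistrib s0 flip: matrix_vector_mul_assoc)
    have "dot (a *v v0) (c *v v) = 0" for v
    proof -
      have "dot (a *v v0) (c *v v) = dot ((transpose c ** a) *v v0) v"
        by (simp add: dot_matrix_transpose matrix_vector_mul_assoc)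
      also have "\<dots> = dot (transpose a *v (c *v v0)) v"
        using less.prems(1) by (simp add: matrix_vector_mul_assoc)
      finally show ?thesis
        using v0 by simp
    qed
    then have "(a *v v) $ i = 0" if "c1 *v v = 0" for v
      using i c1v[of v] that dot_add(2)[of "a *v v0" "c *v v" "axis i ((a *v v) $ i)"] by simp
    then have ker: "c *v v = 0 \<and> (a *v v) $ i = 0" if "c1 *v v = 0" for v
      using c1v[of v] that by (simp add: vec_eq_iff axis_def)
    have "c1 *v v0 \<noteq> 0"
      using ker[of v0] i by blast
    then have psub: "{v. c1 *v v = 0} \<subset> {v. c *v v = 0}"
      using ker v0 by blast
    have sub: "vec.subspace {v. m *v v = 0}" for m :: "'a^'n^'n"
      by (simp add: vec.subspace_def matrix_vector_right_distrib vec.scale)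
    have dim: "vec.dim {v. c1 *v v = 0} < vec.dim {v. c *v v = 0}"
      using psub sub by (intro vec.dim_psubset) (metis vec.span_eq_iff)
    have "transpose a ** c1 = transpose c1 ** a"
      using less.prems(1) s0(1)
      by (simp add: c1_def matrix_add_ldistrib matrix_add_rdistrib' transpose_add
          matrix_transpose_mul matrix_mul_assoc)
    then obtain s where s: "transpose s = s" "invertible (c1 + s ** a)"
      using less.hyps[OF dim] ker less.prems(2) by blast
    then have "transpose (s0 + s) = s0 + s" "invertible (c + (s0 + s) ** a)"
      by (simp_all add: transpose_add s0 c1_def matrix_add_rdistrib' add.assoc)
    then show ?thesis
      by blast
  qed
qed

text \<open>
  A symplectic matrix with invertible lower left block is a product of the generators (the big
  cell of the Bruhat decomposition); every symplectic matrix becomes of this form after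
  multiplication by a lower triangular unipotent one.
\<close>

lemma Sp_generated:
  fixes Q :: "('a::field^('n::finite + 'n)^('n + 'n)) set"
  assumes mult: "\<And>g h. g \<in> Q \<Longrightarrow> h \<in> Q \<Longrightarrow> g ** h \<in> Q"
    and unip: "\<And>a. transpose a = a \<Longrightarrow> block_matrix (mat 1) a 0 (mat 1) \<in> Q"
    and levi: "\<And>b. invertible b \<Longrightarrow> block_matrix b 0 0 (transpose (matrix_inv b)) \<in> Q"
    and weyl: "block_matrix 0 (mat 1) (- mat 1) 0 \<in> Q"
    and g: "g \<in> carrier Sp"
  shows "g \<in> Q"
proof -
  have levi': "block_matrix b 0 0 (transpose b') \<in> Q" if "b ** b' = mat 1" for b b' :: "'a^'n^'n"
  proof -
    have "b' ** b = mat 1"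
      using that matrix_left_right_inverse by blast
    then have "invertible b" "matrix_inv b = b'"
      using that by (auto simp: invertible_def intro: matrix_inv_eqI)
    then show ?thesis
      using levi[of b] by simp
  qed
  have neg: "block_matrix (- mat 1) 0 0 (- mat 1) \<in> Q"
    using levi'[of "- mat 1" "- mat 1"] by (simp add: transpose_uminus)
  have weyl': "block_matrix 0 (- mat 1) (mat 1) 0 \<in> Q"
    using mult[OF neg weyl] by (simp add: block_matrix_mult)
  have lower: "block_matrix (mat 1) 0 s (mat 1) \<in> Q" if "transpose s = s" for s :: "'a^'n^'n"
    using mult[OF mult[OF weyl unip[of "- s"]] weyl'] that
    by (simp add: block_matrix_mult transpose_uminus)
  have cell: "block_matrix a b c d \<in> Q" if Sp: "block_matrix a b c d \<in> carrier Sp"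
    and c: "invertible c" for a b c d :: "'a^'n^'n"
  proof -
    obtain e where e: "c ** e = mat 1" "e ** c = mat 1"
      using c by (auto simp: invertible_def)
    then have et: "transpose e ** transpose c = mat 1" "transpose c ** transpose e = mat 1"
      by (metis matrix_transpose_mul transpose_mat)+
    have rel: "transpose a ** c = transpose c ** a" "transpose b ** d = transpose d ** b"
      "transpose a ** d - transpose c ** b = mat 1"
      using Sp by (auto simp: block_matrix_in_Sp_iff)
    have "transpose (a ** e) = transpose e ** (transpose a ** c) ** e"
      using e by (simp add: matrix_transpose_mul flip: matrix_mul_assoc)
    also have "\<dots> = (transpose e ** transpose c) ** (a ** e)"
      by (simp add: rel(1) matrix_mul_assoc)
    finally have sym1: "transpose (a ** e) = a ** e"
      using et by simp
    have "b = transpose e ** (transpose c ** b)"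
      using et by (simp add: matrix_mul_assoc)
    also have "transpose c ** b = transpose a ** d - mat 1"
      using rel(3) by (simp add: algebra_simps)
    also have "transpose e ** (transpose a ** d - mat 1) = a ** e ** d - transpose e"
      using sym1 by (simp add: matrix_diff_ldistrib matrix_mul_assoc matrix_transpose_mul)
    finally have b: "b = a ** e ** d - transpose e" .
    have "transpose d ** (a ** e ** d - transpose e) = transpose (a ** e ** d - transpose e) ** d"
      using rel(2) b by simp
    also have "\<dots> = transpose d ** (a ** e ** d) - e ** d"
      by (simp add: transpose_diff matrix_transpose_mul[of "a ** e" d] sym1 matrix_diff_rdistrib
          matrix_mul_assoc)
    finally have sym2: "transpose (e ** d) = e ** d"
      by (simp add: matrix_diff_ldistrib matrix_transpose_mul)
    have "block_matrix (- transpose e) 0 0 (transpose (- transpose c)) \<in> Q"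
      using et by (intro levi') simp
    from mult[OF mult[OF unip[OF sym1] mult[OF this weyl]] unip[OF sym2]]
    show ?thesis
      using e by (simp add: block_matrix_mult transpose_uminus matrix_mul_assoc algebra_simps)
        (simp add: e b flip: matrix_mul_assoc)
  qed
  obtain a b c d where gb: "g = block_matrix a b c d"
    by (rule block_matrix_cases)
  then have rel: "transpose a ** c = transpose c ** a" "transpose b ** d = transpose d ** b"
      "transpose a ** d - transpose c ** b = mat 1"
    using g by (auto simp: block_matrix_in_Sp_iff)
  have "v = 0" if "a *v v = 0" "c *v v = 0" for v
  proof -
    have "transpose (transpose a ** d - transpose c ** b) = mat 1"
      using rel(3) by (simp add: transpose_mat)
    then have "transpose d ** a - transpose b ** c = mat 1"
      by (simp add: transpose_diff matrix_transpose_mul)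
    then have "v = (transpose d ** a - transpose b ** c) *v v"
      by simp
    then show ?thesis
      using that by (simp add: matrix_vector_mult_diff_rdistrib flip: matrix_vector_mul_assoc)
  qed
  then obtain s where s: "transpose s = s" "invertible (c + s ** a)"
    using exists_shear_invertible[OF rel(1)] by blast
  have low: "block_matrix (mat 1) 0 s (mat 1) ** g = block_matrix a b (s ** a + c) (s ** b + d)"
    by (simp add: gb block_matrix_mult)
  have "block_matrix a b (s ** a + c) (s ** b + d) \<in> carrier Sp"
    using rel s(1)
    by (simp add: block_matrix_in_Sp_iff transpose_add matrix_transpose_mul matrix_add_ldistrib
        matrix_add_rdistrib' matrix_mul_assoc algebra_simps)
  then have "block_matrix (mat 1) 0 s (mat 1) ** g \<in> Q"
    unfolding low using s(2) by (intro cell) (simp_all add: add.commute)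
  then have "block_matrix (mat 1) 0 (- s) (mat 1) ** (block_matrix (mat 1) 0 s (mat 1) ** g) \<in> Q"
    using s(1) mult[OF lower[of "- s"]] by (simp add: transpose_uminus)
  then show ?thesis
    by (simp add: matrix_mul_assoc block_matrix_mult flip: mat_1_eq_block)
qed

section \<open>Closure properties of the Schwartz space\<close>

lemma schwartzI:
  assumes "c \<noteq> 0" "\<And>y. \<phi> y \<noteq> 0 \<Longrightarrow> y \<in> box_at (\<lambda>_. c)"
    and "d \<noteq> 0" "\<And>y b. b \<in> box_at (\<lambda>_. d) \<Longrightarrow> \<phi> (y + b) = \<phi> y"
  shows "\<phi> \<in> schwartz"
  unfolding schwartz_iff using assms by blast

lemma schwartz_zero [simp]: "(\<lambda>y. 0) \<in> schwartz"
  by (rule schwartzI[of 1 _ 1]) auto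

lemma schwartz_smult: "\<phi> \<in> schwartz \<Longrightarrow> (\<lambda>y. k * \<phi> y) \<in> schwartz"
  unfolding schwartz_iff by auto

lemma schwartz_add:
  fixes \<phi> \<eta> :: "'a::nonarch_local_field^'n::finite \<Rightarrow> complex"
  assumes "\<phi> \<in> schwartz" "\<eta> \<in> schwartz"
  shows "(\<lambda>y. \<phi> y + \<eta> y) \<in> schwartz"
proof -
  obtain c1 d1 where 1: "c1 \<noteq> 0" "\<And>y. \<phi> y \<noteq> 0 \<Longrightarrow> y \<in> box_at (\<lambda>_. c1)"
    "d1 \<noteq> 0" "\<And>y b. b \<in> box_at (\<lambda>_. d1) \<Longrightarrow> \<phi> (y + b) = \<phi> y"
    using assms(1) unfolding schwartz_iff by blast
  obtain c2 d2 where 2: "c2 \<noteq> 0" "\<And>y. \<eta> y \<noteq> 0 \<Longrightarrow> y \<in> box_at (\<lambda>_. c2)"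
    "d2 \<noteq> 0" "\<And>y b. b \<in> box_at (\<lambda>_. d2) \<Longrightarrow> \<eta> (y + b) = \<eta> y"
    using assms(2) unfolding schwartz_iff by blast
  obtain c :: 'a where c: "c \<noteq> 0" "absv c1 \<le> absv c" "absv c2 \<le> absv c"
    using 1(1) 2(1) by (metis linear order.refl)
  obtain d :: 'a where d: "d \<noteq> 0" "absv d \<le> absv d1" "absv d \<le> absv d2"
    using 1(3) 2(3) by (metis linear order.refl)
  have "box_at (\<lambda>_. c1) \<subseteq> box_at (\<lambda>_. c)" "box_at (\<lambda>_. c2) \<subseteq> box_at (\<lambda>_. c)"
    "box_at (\<lambda>_. d) \<subseteq> box_at (\<lambda>_. d1)" "box_at (\<lambda>_. d) \<subseteq> box_at (\<lambda>_. d2)"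
    using c d by (auto intro!: box_at_mono)
  then have *: "y \<in> box_at (\<lambda>_. c1) \<Longrightarrow> y \<in> box_at (\<lambda>_. c)" "y \<in> box_at (\<lambda>_. c2) \<Longrightarrow> y \<in> box_at (\<lambda>_. c)"
    "y \<in> box_at (\<lambda>_. d) \<Longrightarrow> y \<in> box_at (\<lambda>_. d1)" "y \<in> box_at (\<lambda>_. d) \<Longrightarrow> y \<in> box_at (\<lambda>_. d2)"
    for y :: "'a^'n"
    by blast+
  show ?thesis
  proof (rule schwartzI[OF c(1) _ d(1)])
    fix y assume "\<phi> y + \<eta> y \<noteq> 0"
    then have "\<phi> y \<noteq> 0 \<or> \<eta> y \<noteq> 0"
      by auto
    then show "y \<in> box_at (\<lambda>_. c)"
      using 1(2) 2(2) * by blast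
  qed (use 1(4) 2(4) * in simp)
qed

lemma schwartz_sum:
  "(\<And>i. i \<in> I \<Longrightarrow> f i \<in> schwartz) \<Longrightarrow> (\<lambda>y. \<Sum>i\<in>I. f i y) \<in> schwartz"
  by (induction I rule: infinite_finite_induct) (auto intro: schwartz_add)

lemma schwartz_reflect:
  assumes "\<phi> \<in> schwartz"
  shows "(\<lambda>y. \<phi> (- y)) \<in> schwartz"
proof -
  obtain c d where "c \<noteq> 0" "\<And>y. \<phi> y \<noteq> 0 \<Longrightarrow> y \<in> box_at (\<lambda>_. c)"
    "d \<noteq> 0" "\<And>y b. b \<in> box_at (\<lambda>_. d) \<Longrightarrow> \<phi> (y + b) = \<phi> y"
    using assms unfolding schwartz_iff by blast
  note \<phi> = this
  have "y \<in> box_at (\<lambda>_. c)" if "\<phi> (- y) \<noteq> 0" for y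
    using \<phi>(2)[OF that] by simp
  moreover have "\<phi> (- (y + b)) = \<phi> (- y)" if "b \<in> box_at (\<lambda>_. d)" for y b
    using \<phi>(4)[of "- b" "- y"] that by (simp add: algebra_simps)
  ultimately show ?thesis
    using \<phi>(1,3) by (intro schwartzI[of c _ d])
qed

lemma schwartz_mult_invariant:
  fixes \<phi> f :: "'a::nonarch_local_field^'n::finite \<Rightarrow> complex"
  assumes "\<phi> \<in> schwartz" "e \<noteq> 0" "\<And>y b. b \<in> box_at (\<lambda>_. e) \<Longrightarrow> f (y + b) = f y"
  shows "(\<lambda>y. f y * \<phi> y) \<in> schwartz"
proof -
  obtain c d where \<phi>: "c \<noteq> 0" "\<And>y. \<phi> y \<noteq> 0 \<Longrightarrow> y \<in> box_at (\<lambda>_. c)"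
    "d \<noteq> 0" "\<And>y b. b \<in> box_at (\<lambda>_. d) \<Longrightarrow> \<phi> (y + b) = \<phi> y"
    using assms(1) unfolding schwartz_iff by blast
  obtain d' :: 'a where d': "d' \<noteq> 0" "absv d' \<le> absv d" "absv d' \<le> absv e"
    using \<phi>(3) assms(2) by (metis linear order.refl)
  then have "y \<in> box_at (\<lambda>_. d') \<Longrightarrow> y \<in> box_at (\<lambda>_. d)" "y \<in> box_at (\<lambda>_. d') \<Longrightarrow> y \<in> box_at (\<lambda>_. e)"
    for y :: "'a^'n"
    using box_at_mono[of "\<lambda>_. d'" "\<lambda>_. d"] box_at_mono[of "\<lambda>_. d'" "\<lambda>_. e"] by auto
  then show ?thesis
    using \<phi> assms(3) by (intro schwartzI[OF \<phi>(1) _ d'(1)]) auto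
qed

lemma absv_dot_le:
  fixes u v :: "'a::nonarch_local_field^'n::finite"
  assumes "\<And>i. absv (u $ i) * absv (v $ i) \<le> k"
  shows "absv (dot u v) \<le> k"
proof -
  have "0 \<le> absv (u $ undefined) * absv (v $ undefined)"
    by simp
  then have "0 \<le> k"
    using assms order_trans by blast
  then show ?thesis
    unfolding dot_def using assms by (intro absv_sum_le) (simp_all add: absv_mult)
qed

section \<open>Heisenberg operators\<close>

locale conductor_character =
  fixes \<psi> :: "'a::nonarch_local_field \<Rightarrow> complex"
  assumes additive: "additive_character \<psi>"
    and conductor: "has_conductor_4 \<psi>"
begin

lemma psi_add: "\<psi> (x + y) = \<psi> x * \<psi> y"
  using additive by (simp add: additive_character_def)

lemma psi_nonzero [simp]: "\<psi> x \<noteq> 0"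
proof -
  have "cmod (\<psi> x) = 1"
    using additive by (simp add: additive_character_def)
  then show ?thesis
    by auto
qed

lemma psi_0 [simp]: "\<psi> 0 = 1"
  using psi_add[of 0 0] by simp

lemma psi_minus: "\<psi> (- x) = inverse (\<psi> x)"
  using psi_add[of x "- x"] by (simp add: inverse_unique)

lemma psi_diff: "\<psi> (x - y) = \<psi> x / \<psi> y"
  using psi_add[of x "- y"] by (simp add: psi_minus divide_inverse)

lemma psi_trivial_iff: "(\<forall>t\<in>integers. \<psi> (t * x) = 1) \<longleftrightarrow> absv x \<le> absv (4::'a)"
  using conductor unfolding has_conductor_4_def by (simp add: in_scaled_integers_iff)

lemma psi_trivial: "absv x \<le> absv (4::'a) \<Longrightarrow> \<psi> x = 1"
  using psi_trivial_iff[of x] by (metis absv_1 integers_def mem_Collect_eq mult_1 order.refl)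

lemma absv_le_4_if_psi_trivial:
  "(\<And>t::'a. absv t \<le> 1 \<Longrightarrow> \<psi> (t * x) = 1) \<Longrightarrow> absv x \<le> absv (4::'a)"
  using psi_trivial_iff[of x] by (simp add: integers_def)

lemma psi_add_trivial: "absv y \<le> absv (4::'a) \<Longrightarrow> \<psi> (x + y) = \<psi> x"
  by (simp add: psi_add psi_trivial)

text \<open>
  The Heisenberg operator of \<open>w = c + b\<close> with \<open>c \<in> X\<close>, \<open>b \<in> Y\<close>: translation by \<open>b\<close>
  followed by multiplication with a character. The term \<open>dot c b\<close> in the phase makes these
  operators equivariant under the Weil representation without a cocycle.
\<close>

definition heis :: "'a^('n::finite + 'n) \<Rightarrow> ('a^'n \<Rightarrow> complex) \<Rightarrow> ('a^'n \<Rightarrow> complex)" where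
  "heis w \<phi> = (\<lambda>y. \<psi> (2 * dot (vec_left w) y - dot (vec_left w) (vec_right w)) * \<phi> (y - vec_right w))"

lemma heis_add: "heis w (\<lambda>y. \<phi> y + \<eta> y) = (\<lambda>y. heis w \<phi> y + heis w \<eta> y)"
  by (simp add: heis_def algebra_simps)

lemma heis_smult: "heis w (\<lambda>y. k * \<phi> y) = (\<lambda>y. k * heis w \<phi> y)"
  by (simp add: heis_def algebra_simps)

lemma heis_zero [simp]: "heis w (\<lambda>y. 0) = (\<lambda>y. 0)"
  by (simp add: heis_def)

lemma heis_0 [simp]:
  fixes \<phi> :: "'a^'n::finite \<Rightarrow> complex"
  shows "heis 0 \<phi> = \<phi>"
proof -
  have "vec_left (0::'a^('n + 'n)) = 0" "vec_right (0::'a^('n + 'n)) = 0"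
    by (simp_all add: vec_eq_iff)
  then show ?thesis
    by (simp add: heis_def)
qed

lemma heis_sum: "finite I \<Longrightarrow> heis w (\<lambda>y. \<Sum>i\<in>I. f i y) = (\<lambda>y. \<Sum>i\<in>I. heis w (f i) y)"
  by (simp add: heis_def sum_distrib_left)

lemma heis_heis:
  "heis v (heis w \<phi>) = (\<lambda>y. \<psi> (dot (vec_left v) (vec_right w) - dot (vec_left w) (vec_right v)) *
     heis (v + w) \<phi> y)"
proof
  fix y
  have arg: "2 * dot (vec_left v) y - dot (vec_left v) (vec_right v) +
      (2 * dot (vec_left w) (y - vec_right v) - dot (vec_left w) (vec_right w)) =
    dot (vec_left v) (vec_right w) - dot (vec_left w) (vec_right v) +
      (2 * dot (vec_left (v + w)) y - dot (vec_left (v + w)) (vec_right (v + w)))"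
    by (simp add: algebra_simps)
  show "heis v (heis w \<phi>) y =
      \<psi> (dot (vec_left v) (vec_right w) - dot (vec_left w) (vec_right v)) * heis (v + w) \<phi> y"
    unfolding heis_def by (simp only: mult.assoc[symmetric] psi_add[symmetric] arg)
      (simp add: algebra_simps)
qed

lemma heis_reflect: "heis w (\<lambda>y. \<phi> (- y)) = (\<lambda>y. heis (- w) \<phi> (- y))"
  by (simp add: heis_def algebra_simps)

lemma psi_dot_locally_constant:
  fixes c :: "'a^'n::finite"
  shows "\<exists>e. e \<noteq> 0 \<and> (\<forall>y. \<forall>b\<in>box_at (\<lambda>_. e). \<psi> (dot c (y + b)) = \<psi> (dot c y))"
proof -
  define M where "M = Max (range (\<lambda>i. absv (c $ i)))"
  have M: "absv (c $ i) \<le> M" for i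
    by (simp add: M_def)
  then have "0 \<le> M"
    using absv_nonneg order_trans by blast
  then have "0 < absv (4::'a) / (M + 1)"
    by simp
  then obtain e :: 'a where e: "e \<noteq> 0" "absv e < absv (4::'a) / (M + 1)"
    using exists_small by blast
  have "absv (dot c b) \<le> absv (4::'a)" if "b \<in> box_at (\<lambda>_. e)" for b
  proof (rule absv_dot_le)
    fix i
    have "absv (c $ i) * absv (b $ i) \<le> (M + 1) * absv e"
      using M[of i] that \<open>0 \<le> M\<close> by (intro mult_mono) (auto simp: box_at_def)
    also have "\<dots> \<le> absv (4::'a)"
      using e(2) \<open>0 \<le> M\<close> by (simp add: field_simps)
    finally show "absv (c $ i) * absv (b $ i) \<le> absv (4::'a)" .
  qed
  then show ?thesis
    using e(1) by (auto simp: psi_add_trivial)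
qed

lemma schwartz_translate:
  fixes \<phi> :: "'a^'n::finite \<Rightarrow> complex"
  assumes "\<phi> \<in> schwartz"
  shows "(\<lambda>y. \<phi> (y - v)) \<in> schwartz"
proof -
  obtain c d where \<phi>: "c \<noteq> 0" "\<And>y. \<phi> y \<noteq> 0 \<Longrightarrow> y \<in> box_at (\<lambda>_. c)"
    "d \<noteq> 0" "\<And>y b. b \<in> box_at (\<lambda>_. d) \<Longrightarrow> \<phi> (y + b) = \<phi> y"
    using assms unfolding schwartz_iff by blast
  obtain c' :: 'a where c': "c' \<noteq> 0" "max (absv c) (Max (range (\<lambda>i. absv (v $ i)))) < absv c'"
    using exists_large by blast
  have "box_at (\<lambda>_. c) \<subseteq> box_at (\<lambda>_. c')" "v \<in> box_at (\<lambda>_. c')"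
    using c'(2) by (auto intro!: box_at_mono simp: in_box_at_iff intro: less_imp_le)
  then have "y \<in> box_at (\<lambda>_. c')" if "\<phi> (y - v) \<noteq> 0" for y
    using \<phi>(2)[OF that] box_at_add[of "y - v" "\<lambda>_. c'" v] by auto
  moreover have "\<phi> (y + b - v) = \<phi> (y - v)" if "b \<in> box_at (\<lambda>_. d)" for y b
    using \<phi>(4)[OF that, of "y - v"] by (simp add: algebra_simps)
  ultimately show ?thesis
    using c'(1) \<phi>(3) by (intro schwartzI[of c' _ d])
qed

lemma schwartz_psi_dot:
  assumes "\<phi> \<in> schwartz"
  shows "(\<lambda>y. \<psi> (dot c y) * \<phi> y) \<in> schwartz"
proof -
  obtain e where e: "e \<noteq> 0" "\<And>y b. b \<in> box_at (\<lambda>_. e) \<Longrightarrow> \<psi> (dot c (y + b)) = \<psi> (dot c y)"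
    using psi_dot_locally_constant by blast
  from schwartz_mult_invariant[OF assms this] show ?thesis .
qed

lemma schwartz_heis:
  assumes "\<phi> \<in> schwartz"
  shows "heis w \<phi> \<in> schwartz"
proof -
  have "(\<lambda>y. \<psi> (- dot (vec_left w) (vec_right w)) *
      (\<psi> (dot (2 *s vec_left w) y) * \<phi> (y - vec_right w))) \<in> schwartz"
    by (intro schwartz_smult schwartz_psi_dot schwartz_translate assms)
  moreover have "heis w \<phi> = (\<lambda>y. \<psi> (- dot (vec_left w) (vec_right w)) *
      (\<psi> (dot (2 *s vec_left w) y) * \<phi> (y - vec_right w)))"
    by (simp add: heis_def psi_diff psi_minus field_simps)
  ultimately show ?thesis
    by simp
qed

end

section \<open>The Fourier transform exchanges translations and characters\<close>

lemma continuous_if_locally_constant: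
  fixes f :: "'x::topological_space \<Rightarrow> 'y::topological_space"
  assumes "locally_constant f"
  shows "continuous_on UNIV f"
proof -
  have "open (f -` B)" for B
  proof (subst open_subopen, intro ballI)
    fix x
    assume x: "x \<in> f -` B"
    obtain U where U: "open U" "x \<in> U" "f constant_on U"
      using assms by (auto simp: locally_constant_def)
    then have "U \<subseteq> f -` B"
      using x by (auto simp: constant_on_def)
    then show "\<exists>T. open T \<and> x \<in> T \<and> T \<subseteq> f -` B"
      using U by blast
  qed
  then show ?thesis
    by (simp add: continuous_on_open_vimage)
qed

lemma haar_measure_translate:
  fixes \<mu> :: "('a::nonarch_local_field^'n::finite) measure" and f :: "'a^'n \<Rightarrow> complex"
  assumes \<mu>: "haar_measure \<mu>" and f: "f \<in> schwartz"
  shows "(LINT v|\<mu>. f (v + b)) = (LINT v|\<mu>. f v)"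
proof -
  have sets: "sets \<mu> = sets borel"
    and inv: "\<And>v B. B \<in> sets borel \<Longrightarrow> emeasure \<mu> ((+) v ` B) = emeasure \<mu> B"
    using \<mu> by (auto simp: haar_measure_def)
  have space: "space \<mu> = UNIV"
    using sets_eq_imp_space_eq[OF sets] by simp
  have iso: "dist (x + v) (y + v) = dist x y" for x y v :: "'a^'n"
    by (simp add: dist_vec_def dist_absv)
  have "continuous_on UNIV (\<lambda>x. x + v)" for v :: "'a^'n"
    unfolding continuous_on_iff using iso by auto
  then have "(\<lambda>x. x + v) \<in> borel_measurable borel" for v :: "'a^'n"
    by (rule borel_measurable_continuous_onI)
  then have shift: "(\<lambda>x. x + v) \<in> measurable \<mu> \<mu>" for v :: "'a^'n"
    using sets by (simp cong: measurable_cong_sets)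
  have "distr \<mu> \<mu> (\<lambda>x. x + b) = \<mu>"
  proof (rule measure_eqI)
    fix B
    assume "B \<in> sets (distr \<mu> \<mu> (\<lambda>x. x + b))"
    then have B: "B \<in> sets \<mu>"
      by simp
    have "(\<lambda>x. x + b) -` B \<inter> space \<mu> = (+) (- b) ` B"
    proof (intro equalityI subsetI)
      fix x
      assume "x \<in> (\<lambda>x. x + b) -` B \<inter> space \<mu>"
      then have "x + b \<in> B" "x = - b + (x + b)"
        by simp_all
      then show "x \<in> (+) (- b) ` B"
        by blast
    qed (auto simp: space)
    then have "emeasure (distr \<mu> \<mu> (\<lambda>x. x + b)) B = emeasure \<mu> ((+) (- b) ` B)"
      using shift B by (simp only: emeasure_distr)
    then show "emeasure (distr \<mu> \<mu> (\<lambda>x. x + b)) B = emeasure \<mu> B"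
      using inv B sets by metis
  qed simp
  moreover have "f \<in> borel_measurable \<mu>"
  proof -
    have "f \<in> borel_measurable borel"
      using f by (intro borel_measurable_continuous_onI continuous_if_locally_constant)
        (simp add: schwartz_def)
    then show ?thesis
      using sets by (simp cong: measurable_cong_sets)
  qed
  ultimately show ?thesis
    using integral_distr[OF shift, of f b] by simp
qed

context conductor_character
begin

text \<open>
  Substituting \<open>v + b\<close> for the integration variable turns translations into characters.
\<close>

lemma fourier_heis:
  fixes \<mu> :: "('a^'n::finite) measure"
  assumes "haar_measure \<mu>" "\<phi> \<in> schwartz"
  shows "fourier \<psi> \<mu> (heis w \<phi>) =
    heis (vec_pair (vec_right w) (- vec_left w)) (fourier \<psi> \<mu> \<phi>)"
proof
  fix u
  define c where "c = vec_left w"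
  define b where "b = vec_right w"
  define f where "f v = \<psi> (dot (2 *s u) v) * heis w \<phi> v" for v
  have f: "f \<in> schwartz"
    unfolding f_def by (intro schwartz_psi_dot schwartz_heis assms)
  have "fourier \<psi> \<mu> (heis w \<phi>) u = (LINT v|\<mu>. f v)"
    by (simp add: fourier_def f_def mult.commute)
  also have "\<dots> = (LINT v|\<mu>. f (v + b))"
    using haar_measure_translate[OF assms(1) f] by simp
  also have "\<dots> = (LINT v|\<mu>. \<psi> (2 * dot b u + dot b c) * (\<phi> v * \<psi> (2 * dot (u + c) v)))"
  proof (rule Bochner_Integration.integral_cong)
    fix v
    have *: "2 * dot u (v + b) + (2 * dot c (v + b) - dot c b) =
        2 * dot b u + dot b c + 2 * dot (u + c) v"
      by (simp add: algebra_simps dot_commute)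
    have "f (v + b) = \<psi> (2 * dot u (v + b)) * (\<psi> (2 * dot c (v + b) - dot c b) * \<phi> v)"
      by (simp only: f_def heis_def c_def b_def dot_scalar add_diff_cancel_right')
    also have "\<dots> = \<psi> (2 * dot u (v + b) + (2 * dot c (v + b) - dot c b)) * \<phi> v"
      by (simp only: psi_add mult.assoc)
    also have "\<dots> = \<psi> (2 * dot b u + dot b c) * (\<phi> v * \<psi> (2 * dot (u + c) v))"
      by (simp only: * psi_add) (simp only: mult_ac)
    finally show "f (v + b) = \<psi> (2 * dot b u + dot b c) * (\<phi> v * \<psi> (2 * dot (u + c) v))" .
  qed simp
  also have "\<dots> = heis (vec_pair (vec_right w) (- vec_left w)) (fourier \<psi> \<mu> \<phi>) u"
    by (simp add: heis_def fourier_def c_def b_def)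
  finally show "fourier \<psi> \<mu> (heis w \<phi>) u =
    heis (vec_pair (vec_right w) (- vec_left w)) (fourier \<psi> \<mu> \<phi>) u" .
qed

end

section \<open>The Weil representation and the Heisenberg operators\<close>

locale weil_model = conductor_character \<psi>
  for \<psi> :: "'a::nonarch_local_field \<Rightarrow> complex" +
  fixes \<mu> :: "('a, 'n::{finite,linorder}) vec measure"
    and Mp :: "'g monoid"
    and p :: "'g \<Rightarrow> 'a^('n + 'n)^('n + 'n)"
    and A :: "'g \<Rightarrow> (('a, 'n) vec \<Rightarrow> complex) \<Rightarrow> (('a, 'n) vec \<Rightarrow> complex)"
  assumes self_dual: "self_dual_haar_measure \<psi> \<mu>"
    and metaplectic: "metaplectic_group Mp p"
    and weil: "weil_representation \<psi> \<mu> Mp p A"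
begin

lemma group_Mp: "group Mp"
  using metaplectic by (simp add: metaplectic_group_def)

sublocale Mp: group Mp
  by (rule group_Mp)

lemma p_mult: "g \<in> carrier Mp \<Longrightarrow> h \<in> carrier Mp \<Longrightarrow> p (g \<otimes>\<^bsub>Mp\<^esub> h) = p g ** p h"
  using metaplectic by (auto simp: metaplectic_group_def epi_def hom_def Sp_def)

lemma p_Sp: "g \<in> carrier Mp \<Longrightarrow> p g \<in> carrier Sp"
  using metaplectic by (auto simp: metaplectic_group_def epi_def hom_def)

lemma p_surj: "m \<in> carrier Sp \<Longrightarrow> \<exists>g\<in>carrier Mp. p g = m"
  using metaplectic unfolding metaplectic_group_def epi_def by (metis (mono_tags, lifting) imageE mem_Collect_eq)

lemma A_closed: "g \<in> carrier Mp \<Longrightarrow> \<phi> \<in> schwartz \<Longrightarrow> A g \<phi> \<in> schwartz"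
  using weil by (auto simp: weil_representation_def is_rep_def linear_maps_def schwartz_rep_def hom_def)

lemma A_add: "g \<in> carrier Mp \<Longrightarrow> \<phi> \<in> schwartz \<Longrightarrow> \<eta> \<in> schwartz \<Longrightarrow>
    A g (\<lambda>y. \<phi> y + \<eta> y) = (\<lambda>y. A g \<phi> y + A g \<eta> y)"
  using weil by (auto simp: weil_representation_def is_rep_def linear_maps_def schwartz_rep_def hom_def)

lemma A_smult: "g \<in> carrier Mp \<Longrightarrow> \<phi> \<in> schwartz \<Longrightarrow> A g (\<lambda>y. k * \<phi> y) = (\<lambda>y. k * A g \<phi> y)"
  using weil by (auto simp: weil_representation_def is_rep_def linear_maps_def schwartz_rep_def)

lemma A_one: "\<phi> \<in> schwartz \<Longrightarrow> A \<one>\<^bsub>Mp\<^esub> \<phi> = \<phi>"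
  using weil by (auto simp: weil_representation_def is_rep_def schwartz_rep_def)

lemma A_mult: "g \<in> carrier Mp \<Longrightarrow> h \<in> carrier Mp \<Longrightarrow> \<phi> \<in> schwartz \<Longrightarrow>
    A (g \<otimes>\<^bsub>Mp\<^esub> h) \<phi> = A g (A h \<phi>)"
  using weil by (auto simp: weil_representation_def is_rep_def schwartz_rep_def)

lemma A_inv: "g \<in> carrier Mp \<Longrightarrow> \<phi> \<in> schwartz \<Longrightarrow> A (inv\<^bsub>Mp\<^esub> g) (A g \<phi>) = \<phi>"
  "g \<in> carrier Mp \<Longrightarrow> \<phi> \<in> schwartz \<Longrightarrow> A g (A (inv\<^bsub>Mp\<^esub> g) \<phi>) = \<phi>"
  by (simp_all add: A_one flip: A_mult)

lemma A_zero: "g \<in> carrier Mp \<Longrightarrow> A g (\<lambda>y. 0) = (\<lambda>y. 0)"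
  using A_smult[of g "\<lambda>y. 0" 0] by simp

lemma p_one: "p \<one>\<^bsub>Mp\<^esub> = mat 1"
proof -
  obtain g where g: "g \<in> carrier Mp" "p g = mat 1"
    using p_surj[of "mat 1"] by (auto simp: mat_1_eq_block block_matrix_in_Sp_iff transpose_mat)
  then show ?thesis
    using p_mult[of g "\<one>\<^bsub>Mp\<^esub>"] by simp
qed

lemma p_inv:
  assumes "g \<in> carrier Mp"
  shows "p (inv\<^bsub>Mp\<^esub> g) ** p g = mat 1" "p g ** p (inv\<^bsub>Mp\<^esub> g) = mat 1"
  using assms by (simp_all add: p_one flip: p_mult)

lemma p_inv_vec:
  assumes "g \<in> carrier Mp"
  shows "p (inv\<^bsub>Mp\<^esub> g) *v (p g *v w) = w" "p g *v (p (inv\<^bsub>Mp\<^esub> g) *v w) = w"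
  using p_inv[OF assms] by (simp_all add: matrix_vector_mul_assoc)

lemma unipotent_lift:
  assumes "transpose a = a"
  shows "\<exists>g\<in>carrier Mp. p g = block_matrix (mat 1) a 0 (mat 1) \<and>
    (\<forall>\<phi>\<in>schwartz. A g \<phi> = (\<lambda>y. \<psi> (dot y (a *v y)) * \<phi> y))"
  using weil assms by (simp add: weil_representation_def)

lemma levi_lift:
  assumes "b ** b' = mat 1"
  shows "\<exists>g\<in>carrier Mp. p g = block_matrix b 0 0 (transpose b') \<and>
    (\<exists>\<kappa>. \<kappa> \<noteq> 0 \<and> (\<forall>\<phi>\<in>schwartz. A g \<phi> = (\<lambda>y. \<kappa> * \<phi> (transpose b *v y))))"
proof -
  have "b' ** b = mat 1"
    using assms matrix_left_right_inverse by blast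
  then have b: "invertible b" "matrix_inv b = b'"
    using assms by (auto simp: invertible_def intro: matrix_inv_eqI)
  have "\<exists>g\<in>carrier Mp. p g = block_matrix b 0 0 (transpose (matrix_inv b)) \<and>
      (\<exists>\<beta>. root_of_unity \<beta> \<and> (\<forall>\<phi>\<in>schwartz. A g \<phi> =
        (\<lambda>y. \<beta> * complex_of_real (sqrt (absv (det b))) * \<phi> (transpose b *v y))))"
    using weil b(1) unfolding weil_representation_def by (elim conjE) simp
  then obtain g \<beta> where g: "g \<in> carrier Mp" "p g = block_matrix b 0 0 (transpose b')"
    and \<beta>: "root_of_unity \<beta>"
    "\<And>\<phi>. \<phi> \<in> schwartz \<Longrightarrow> A g \<phi> = (\<lambda>y. \<beta> * complex_of_real (sqrt (absv (det b))) * \<phi> (transpose b *v y))"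
    unfolding b(2) by blast
  have "\<beta> \<noteq> 0"
    using \<beta>(1) by (auto simp: root_of_unity_def zero_power)
  moreover have "det b \<noteq> 0"
    using b(1) by (simp add: invertible_det_nz)
  ultimately have "\<beta> * complex_of_real (sqrt (absv (det b))) \<noteq> 0"
    by simp
  then show ?thesis
    using g \<beta>(2) by blast
qed

lemma haar: "haar_measure \<mu>"
  using self_dual by (simp add: self_dual_haar_measure_def)

lemma fourier_lift:
  "\<exists>g\<in>carrier Mp. p g = block_matrix 0 (mat 1) (- mat 1) 0 \<and>
    (\<exists>\<gamma>. \<gamma> \<noteq> 0 \<and> (\<forall>\<phi>\<in>schwartz. A g \<phi> = (\<lambda>u. \<gamma> * fourier \<psi> \<mu> \<phi> u)))"
proof -
  have "\<exists>g\<in>carrier Mp. p g = block_matrix 0 (mat 1) (- mat 1) 0 \<and>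
      (\<exists>\<gamma>. root_of_unity \<gamma> \<and> (\<forall>\<phi>\<in>schwartz. A g \<phi> = (\<lambda>u. \<gamma> * fourier \<psi> \<mu> \<phi> u)))"
    using weil unfolding weil_representation_def by (elim conjE)
  then obtain g \<gamma> where g: "g \<in> carrier Mp" "p g = block_matrix 0 (mat 1) (- mat 1) 0"
    and \<gamma>: "root_of_unity \<gamma>" "\<And>\<phi>. \<phi> \<in> schwartz \<Longrightarrow> A g \<phi> = (\<lambda>u. \<gamma> * fourier \<psi> \<mu> \<phi> u)"
    by blast
  have "\<gamma> \<noteq> 0"
    using \<gamma>(1) by (auto simp: root_of_unity_def zero_power)
  then show ?thesis
    using g \<gamma>(2) by blast
qed

lemma fourier_schwartz:
  assumes "\<phi> \<in> schwartz"
  shows "fourier \<psi> \<mu> \<phi> \<in> schwartz"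
proof -
  obtain g \<gamma> where g: "g \<in> carrier Mp" "\<gamma> \<noteq> 0" "A g \<phi> = (\<lambda>u. \<gamma> * fourier \<psi> \<mu> \<phi> u)"
    using fourier_lift assms by blast
  then show ?thesis
    using schwartz_smult[OF A_closed[OF g(1) assms], of "inverse \<gamma>"] by (simp flip: mult.assoc)
qed

text \<open>
  By self-duality, the reflection \<open>y \<mapsto> - y\<close> acts as the square of the Fourier transform,
  which commutes with the Fourier transform.
\<close>

lemma fourier_reflect:
  assumes "\<phi> \<in> schwartz"
  shows "fourier \<psi> \<mu> (\<lambda>y. \<phi> (- y)) = (\<lambda>y. fourier \<psi> \<mu> \<phi> (- y))"
proof -
  have FF: "fourier \<psi> \<mu> (fourier \<psi> \<mu> \<eta>) = (\<lambda>y. \<eta> (- y))" if "\<eta> \<in> schwartz" for \<eta>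
  proof
    fix y
    have "fourier \<psi> \<mu> (fourier \<psi> \<mu> \<eta>) (- (- y)) = \<eta> (- y)"
      using self_dual that unfolding self_dual_haar_measure_def by blast
    then show "fourier \<psi> \<mu> (fourier \<psi> \<mu> \<eta>) y = \<eta> (- y)"
      by simp
  qed
  have "fourier \<psi> \<mu> (\<lambda>y. \<phi> (- y)) = fourier \<psi> \<mu> (fourier \<psi> \<mu> (fourier \<psi> \<mu> \<phi>))"
    using FF[OF assms] by simp
  also have "\<dots> = (\<lambda>y. fourier \<psi> \<mu> \<phi> (- y))"
    by (rule FF[OF fourier_schwartz[OF assms]])
  finally show ?thesis .
qed

text \<open>
  The condition on reflections is included because the even and the odd functions must be
  preserved as well, and it is verified on the same generators.
\<close>

definition heis_equivariant :: "'g set" where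
  "heis_equivariant = {g \<in> carrier Mp.
     (\<forall>w. \<forall>\<phi>\<in>schwartz. A g (heis w \<phi>) = heis (p g *v w) (A g \<phi>)) \<and>
     (\<forall>\<phi>\<in>schwartz. A g (\<lambda>y. \<phi> (- y)) = (\<lambda>y. A g \<phi> (- y)))}"

lemma heis_equivariant_mult:
  assumes "g \<in> heis_equivariant" "h \<in> heis_equivariant"
  shows "g \<otimes>\<^bsub>Mp\<^esub> h \<in> heis_equivariant"
  using assms
  by (auto simp: heis_equivariant_def A_mult p_mult schwartz_heis schwartz_reflect A_closed
      matrix_vector_mul_assoc)

lemma heis_equivariant_inv:
  assumes "g \<in> heis_equivariant"
  shows "inv\<^bsub>Mp\<^esub> g \<in> heis_equivariant"
proof -
  have g: "g \<in> carrier Mp"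
    and eq: "\<And>w \<phi>. \<phi> \<in> schwartz \<Longrightarrow> A g (heis w \<phi>) = heis (p g *v w) (A g \<phi>)"
    and refl: "\<And>\<phi>. \<phi> \<in> schwartz \<Longrightarrow> A g (\<lambda>y. \<phi> (- y)) = (\<lambda>y. A g \<phi> (- y))"
    using assms by (auto simp: heis_equivariant_def)
  let ?h = "inv\<^bsub>Mp\<^esub> g"
  have h: "?h \<in> carrier Mp"
    using g by simp
  have "A ?h (heis w \<phi>) = heis (p ?h *v w) (A ?h \<phi>)" if \<phi>: "\<phi> \<in> schwartz" for w \<phi>
  proof -
    have "A g (heis (p ?h *v w) (A ?h \<phi>)) = heis w \<phi>"
      using eq[of "A ?h \<phi>"] g \<phi> A_closed[OF h \<phi>] by (simp add: p_inv_vec A_inv)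
    then show ?thesis
      using A_inv(1)[OF g schwartz_heis[OF A_closed[OF h \<phi>]]] by metis
  qed
  moreover have "A ?h (\<lambda>y. \<phi> (- y)) = (\<lambda>y. A ?h \<phi> (- y))" if \<phi>: "\<phi> \<in> schwartz" for \<phi>
  proof -
    have "A g (\<lambda>y. A ?h \<phi> (- y)) = (\<lambda>y. \<phi> (- y))"
      using refl[of "A ?h \<phi>"] g \<phi> A_closed[OF h \<phi>] by (simp add: A_inv)
    then show ?thesis
      using A_inv(1)[OF g schwartz_reflect[OF A_closed[OF h \<phi>]]] by metis
  qed
  ultimately show ?thesis
    using h by (simp add: heis_equivariant_def)
qed

text \<open>
  The image is closed under products, so it suffices to check the generators of the symplectic
  group, whose operators are known explicitly.
\<close>

lemma p_heis_equivariant: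
  assumes "m \<in> carrier Sp"
  shows "m \<in> p ` heis_equivariant"
proof (rule Sp_generated[OF _ _ _ _ assms])
  fix g h
  assume "g \<in> p ` heis_equivariant" "h \<in> p ` heis_equivariant"
  then obtain g' h' where "g' \<in> heis_equivariant" "g = p g'" "h' \<in> heis_equivariant" "h = p h'"
    by blast
  moreover from this have "g ** h = p (g' \<otimes>\<^bsub>Mp\<^esub> h')"
    by (simp add: heis_equivariant_def p_mult)
  ultimately show "g ** h \<in> p ` heis_equivariant"
    using heis_equivariant_mult by blast
next
  fix a :: "(('a, 'n) vec, 'n) vec"
  assume a: "transpose a = a"
  then obtain g where g: "g \<in> carrier Mp" "p g = block_matrix (mat 1) a 0 (mat 1)"
    "\<And>\<phi>. \<phi> \<in> schwartz \<Longrightarrow> A g \<phi> = (\<lambda>y. \<psi> (dot y (a *v y)) * \<phi> y)"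
    using unipotent_lift by blast
  have "A g (heis w \<phi>) = heis (p g *v w) (A g \<phi>)" if "\<phi> \<in> schwartz" for w \<phi>
  proof
    fix y
    define c where "c = vec_left w"
    define b where "b = vec_right w"
    have w: "p g *v w = vec_pair (c + a *v b) b"
      using block_matrix_mult_pair[of "mat 1" a 0 "mat 1" c b]
      by (simp add: g(2) c_def b_def vec_pair_eta)
    have sym: "dot b (a *v y) = dot y (a *v b)" "dot (a *v b) y = dot y (a *v b)"
        "dot (a *v b) b = dot b (a *v b)"
      using dot_matrix_transpose[of b a y] a by (simp_all add: dot_commute)
    have arg: "dot y (a *v y) + (2 * dot c y - dot c b) =
        2 * dot (c + a *v b) y - dot (c + a *v b) b + dot (y - b) (a *v (y - b))"
      by (simp add: matrix_vector_mult_diff_distrib sym algebra_simps)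
    have "A g (heis w \<phi>) y = \<psi> (dot y (a *v y) + (2 * dot c y - dot c b)) * \<phi> (y - b)"
      by (simp only: g(3)[OF schwartz_heis[OF that]])
        (simp only: heis_def psi_add c_def b_def mult.assoc)
    also have "\<dots> = heis (p g *v w) (A g \<phi>) y"
      using that by (simp only: arg w g(3) heis_def vec_left_right_pair psi_add mult.assoc)
    finally show "A g (heis w \<phi>) y = heis (p g *v w) (A g \<phi>) y" .
  qed
  then have "g \<in> heis_equivariant"
    using g by (simp add: heis_equivariant_def schwartz_reflect)
  then show "block_matrix (mat 1) a 0 (mat 1) \<in> p ` heis_equivariant"
    using g(2) by force
next
  fix b :: "(('a, 'n) vec, 'n) vec"
  assume "invertible b"
  then have binv: "b ** matrix_inv b = mat 1" "matrix_inv b ** b = mat 1"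
    by (simp_all add: matrix_inv_inverse)
  then obtain g \<kappa> where g: "g \<in> carrier Mp" "p g = block_matrix b 0 0 (transpose (matrix_inv b))"
    "\<And>\<phi>. \<phi> \<in> schwartz \<Longrightarrow> A g \<phi> = (\<lambda>y. \<kappa> * \<phi> (transpose b *v y))"
    using levi_lift[OF binv(1)] by blast
  have bt: "transpose b ** transpose (matrix_inv b) = mat 1"
    using binv(2) by (metis matrix_transpose_mul transpose_mat)
  have "A g (heis w \<phi>) = heis (p g *v w) (A g \<phi>)" if "\<phi> \<in> schwartz" for w \<phi>
  proof
    fix y
    define c where "c = vec_left w"
    define d where "d = vec_right w"
    have w: "p g *v w = vec_pair (b *v c) (transpose (matrix_inv b) *v d)"
      using block_matrix_mult_pair[of b 0 0 "transpose (matrix_inv b)" c d]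
      by (simp add: g(2) c_def d_def vec_pair_eta)
    have 1: "dot (b *v c) y = dot c (transpose b *v y)" for y
      by (simp only: dot_matrix_transpose transpose_transpose)
    have 2: "transpose b *v (transpose (matrix_inv b) *v d) = d"
      using bt by (simp only: matrix_vector_mul_assoc matrix_vector_mul_lid)
    show "A g (heis w \<phi>) y = heis (p g *v w) (A g \<phi>) y"
      unfolding g(3)[OF schwartz_heis[OF that]] g(3)[OF that]
      by (simp add: heis_def w 1 2 matrix_vector_mult_diff_distrib
          flip: c_def d_def del: transpose_matrix_vector)
  qed
  then have "g \<in> heis_equivariant"
    using g by (simp add: heis_equivariant_def schwartz_reflect del: transpose_matrix_vector)
  then show "block_matrix b 0 0 (transpose (matrix_inv b)) \<in> p ` heis_equivariant"
    using g(2) by force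
next
  obtain g \<gamma> where g: "g \<in> carrier Mp" "p g = block_matrix 0 (mat 1) (- mat 1) 0"
    "\<And>\<phi>. \<phi> \<in> schwartz \<Longrightarrow> A g \<phi> = (\<lambda>u. \<gamma> * fourier \<psi> \<mu> \<phi> u)"
    using fourier_lift by blast
  have "p g *v w = vec_pair (vec_right w) (- vec_left w)" for w
    using block_matrix_mult_pair[of 0 "mat 1" "- mat 1" 0 "vec_left w" "vec_right w"]
    by (simp add: g(2) vec_pair_eta)
  then have "g \<in> heis_equivariant"
    using g by (simp add: heis_equivariant_def schwartz_reflect schwartz_heis fourier_heis[OF haar]
        heis_smult fourier_reflect)
  then show "block_matrix 0 (mat 1) (- mat 1) 0 \<in> p ` heis_equivariant"
    using g(2) by force
qed

text \<open>
  The lifts with prescribed action generate a subgroup that surjects onto \<open>Sp\<close>. If it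
  were proper, it would meet the kernel of order two trivially and split the extension.
\<close>

lemma heis_equivariant_eq: "heis_equivariant = carrier Mp"
proof -
  have sub: "heis_equivariant \<subseteq> carrier Mp"
    by (auto simp: heis_equivariant_def)
  have "\<not> inj_on p heis_equivariant"
  proof
    assume inj: "inj_on p heis_equivariant"
    define s where "s = inv_into heis_equivariant p"
    have s: "s m \<in> heis_equivariant" "p (s m) = m" if "m \<in> carrier Sp" for m
      using p_heis_equivariant[OF that] by (simp_all add: s_def inv_into_into f_inv_into_f)
    have Sp_mult: "m \<otimes>\<^bsub>Sp\<^esub> n = m ** n" for m n :: "'a^('n + 'n)^('n + 'n)"
      by (simp add: Sp_def)
    have "s (m ** n) = s m \<otimes>\<^bsub>Mp\<^esub> s n" if "m \<in> carrier Sp" "n \<in> carrier Sp" for m n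
    proof (rule inj_onD[OF inj])
      have pr: "p (s m \<otimes>\<^bsub>Mp\<^esub> s n) = m ** n"
        using s that sub by (simp add: p_mult subset_iff)
      have "s m \<otimes>\<^bsub>Mp\<^esub> s n \<in> carrier Mp"
        using s that sub by blast
      then have mn: "m ** n \<in> carrier Sp"
        using pr p_Sp by metis
      then show "p (s (m ** n)) = p (s m \<otimes>\<^bsub>Mp\<^esub> s n)"
        using pr s by simp
      show "s (m ** n) \<in> heis_equivariant" "s m \<otimes>\<^bsub>Mp\<^esub> s n \<in> heis_equivariant"
        using s mn that heis_equivariant_mult by blast+
    qed
    then have "s \<in> hom Sp Mp"
      using s sub by (auto simp: hom_def Sp_mult)
    then show False
      using metaplectic s by (auto simp: metaplectic_group_def)
  qed
  then obtain h1 h2 where h: "h1 \<in> heis_equivariant" "h2 \<in> heis_equivariant" "p h1 = p h2" "h1 \<noteq> h2"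
    by (auto simp: inj_on_def)
  \<comment> \<open>Two lifts of the same matrix differ by the nontrivial element of the kernel.\<close>
  define z where "z = h1 \<otimes>\<^bsub>Mp\<^esub> inv\<^bsub>Mp\<^esub> h2"
  have z: "z \<in> heis_equivariant"
    using h heis_equivariant_mult heis_equivariant_inv by (simp add: z_def)
  have ker_iff: "x \<in> kernel Mp Sp p \<longleftrightarrow> x \<in> carrier Mp \<and> p x = mat 1" for x
    by (simp add: kernel_def Sp_def)
  have "z \<in> kernel Mp Sp p"
    using h sub by (simp add: ker_iff z_def p_mult p_inv subset_iff)
  moreover have "z \<noteq> \<one>\<^bsub>Mp\<^esub>"
  proof
    assume "z = \<one>\<^bsub>Mp\<^esub>"
    then have "z \<otimes>\<^bsub>Mp\<^esub> h2 = h2"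
      using h sub by auto
    then show False
      using h sub by (simp add: z_def Mp.m_assoc subset_iff)
  qed
  moreover have one: "\<one>\<^bsub>Mp\<^esub> \<in> kernel Mp Sp p"
    by (simp add: ker_iff p_one)
  moreover have "card (kernel Mp Sp p) = 2"
    using metaplectic by (simp add: metaplectic_group_def)
  ultimately have ker: "kernel Mp Sp p = {\<one>\<^bsub>Mp\<^esub>, z}"
    unfolding card_2_iff by auto
  have one_in: "\<one>\<^bsub>Mp\<^esub> \<in> heis_equivariant"
    using heis_equivariant_mult[OF h(1) heis_equivariant_inv[OF h(1)]] h(1) sub
    by (simp add: subset_iff)
  show ?thesis
  proof (intro equalityI subsetI)
    fix g
    assume g: "g \<in> carrier Mp"
    obtain h where h': "h \<in> heis_equivariant" "p h = p g"
      using p_heis_equivariant[OF p_Sp[OF g]] by force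
    have "g \<otimes>\<^bsub>Mp\<^esub> inv\<^bsub>Mp\<^esub> h \<in> kernel Mp Sp p"
      using g h' sub by (simp add: ker_iff p_mult subset_iff) (metis p_inv(2))
    then have "g \<otimes>\<^bsub>Mp\<^esub> inv\<^bsub>Mp\<^esub> h \<in> heis_equivariant"
      using ker z one_in by auto
    then have "(g \<otimes>\<^bsub>Mp\<^esub> inv\<^bsub>Mp\<^esub> h) \<otimes>\<^bsub>Mp\<^esub> h \<in> heis_equivariant"
      using h' heis_equivariant_mult by blast
    then show "g \<in> heis_equivariant"
      using g h' sub by (simp add: Mp.m_assoc subset_iff)
  qed (use sub in blast)
qed

lemma A_heis: "g \<in> carrier Mp \<Longrightarrow> \<phi> \<in> schwartz \<Longrightarrow> A g (heis w \<phi>) = heis (p g *v w) (A g \<phi>)"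
  using heis_equivariant_eq by (auto simp: heis_equivariant_def)

lemma A_reflect: "g \<in> carrier Mp \<Longrightarrow> \<phi> \<in> schwartz \<Longrightarrow> A g (\<lambda>y. \<phi> (- y)) = (\<lambda>y. A g \<phi> (- y))"
  using heis_equivariant_eq by (auto simp: heis_equivariant_def)

end

section \<open>Transport of representations along linear bijections\<close>

lemma complex_ring_simps [simp]:
  "carrier complex_ring = UNIV" "mult complex_ring = (*)" "one complex_ring = 1"
  "zero complex_ring = 0" "add complex_ring = (+)"
  by (simp_all add: complex_ring_def)

lemma cring_complex_ring: "cring complex_ring"
proof (rule cringI)
  show "abelian_group complex_ring"
    by (rule abelian_groupI) (auto simp: algebra_simps intro: exI[of _ "- _"] add.left_inverse)
  show "Group.comm_monoid complex_ring"
    by (rule comm_monoidI) (auto simp: mult.assoc mult.commute)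
qed (simp add: distrib_right)

text \<open>
  Over the complex numbers, closure under scalar multiplication covers additive inverses.
\<close>

lemma complex_submoduleI:
  assumes "Module.module complex_ring V" "U \<subseteq> carrier V" "\<zero>\<^bsub>V\<^esub> \<in> U"
    and add: "\<And>x y. x \<in> U \<Longrightarrow> y \<in> U \<Longrightarrow> x \<oplus>\<^bsub>V\<^esub> y \<in> U" and smult: "\<And>c x. x \<in> U \<Longrightarrow> c \<odot>\<^bsub>V\<^esub> x \<in> U"
  shows "Module.submodule U complex_ring V"
proof -
  interpret V: Module.module complex_ring V
    by (rule assms(1))
  have "\<ominus>\<^bsub>V\<^esub> x \<in> U" if x: "x \<in> U" for x
  proof -
    have xV: "x \<in> carrier V"
      using x assms(2) by blast
    have "(- 1) \<odot>\<^bsub>V\<^esub> x \<oplus>\<^bsub>V\<^esub> x = \<zero>\<^bsub>V\<^esub>"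
      using V.smult_l_distr[of "- 1" 1 x] V.smult_l_null[of x] V.smult_one[of x] xV by simp
    then have "\<ominus>\<^bsub>V\<^esub> x = (- 1) \<odot>\<^bsub>V\<^esub> x"
      using xV smult[OF x] assms(2) by (intro V.minus_equality) auto
    then show ?thesis
      using smult[OF x] by simp
  qed
  then show ?thesis
    using assms by (intro V.submoduleI) auto
qed

text \<open>
  For \<open>W\<close> a quotient or a direct sum, the module axioms and the axioms of an action are inherited
  from \<open>V\<close> instead of being checked on cosets and tuples.
\<close>

locale rep_transport =
  fixes G :: "'g monoid" and V :: "('g, 'v) rep" and W :: "('g, 'w) rep" and T :: "'v \<Rightarrow> 'w"
  assumes rep: "is_rep G V"
    and bij: "bij_betw T (carrier V) (carrier W)"
    and T_zero: "T \<zero>\<^bsub>V\<^esub> = \<zero>\<^bsub>W\<^esub>"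
    and T_add: "\<And>x y. x \<in> carrier V \<Longrightarrow> y \<in> carrier V \<Longrightarrow> T (x \<oplus>\<^bsub>V\<^esub> y) = T x \<oplus>\<^bsub>W\<^esub> T y"
    and T_smult: "\<And>c x. x \<in> carrier V \<Longrightarrow> T (c \<odot>\<^bsub>V\<^esub> x) = c \<odot>\<^bsub>W\<^esub> T x"
    and T_act: "\<And>g x. g \<in> carrier G \<Longrightarrow> x \<in> carrier V \<Longrightarrow> T (act V g x) = act W g (T x)"
begin

lemma module_V: "Module.module complex_ring V"
  using rep by (simp add: is_rep_def)

sublocale V: Module.module complex_ring V
  by (rule module_V)

lemma V_smult_closed: "x \<in> carrier V \<Longrightarrow> c \<odot>\<^bsub>V\<^esub> x \<in> carrier V"
  by (rule V.smult_closed) simp_all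

lemma act_closed: "g \<in> carrier G \<Longrightarrow> x \<in> carrier V \<Longrightarrow> act V g x \<in> carrier V"
  using rep by (auto simp: is_rep_def linear_maps_def hom_def)

lemma act_add: "g \<in> carrier G \<Longrightarrow> x \<in> carrier V \<Longrightarrow> y \<in> carrier V \<Longrightarrow>
    act V g (x \<oplus>\<^bsub>V\<^esub> y) = act V g x \<oplus>\<^bsub>V\<^esub> act V g y"
  using rep by (auto simp: is_rep_def linear_maps_def hom_def)

lemma act_smult: "g \<in> carrier G \<Longrightarrow> x \<in> carrier V \<Longrightarrow> act V g (c \<odot>\<^bsub>V\<^esub> x) = c \<odot>\<^bsub>V\<^esub> act V g x"
  using rep by (auto simp: is_rep_def linear_maps_def)

lemma T_carrier: "x \<in> carrier V \<Longrightarrow> T x \<in> carrier W"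
  using bij by (auto simp: bij_betw_def)

lemma T_cases:
  assumes "w \<in> carrier W"
  obtains x where "x \<in> carrier V" "w = T x"
  using assms bij by (auto simp: bij_betw_def)

lemma module_W: "Module.module complex_ring W"
proof (rule Module.moduleI[OF cring_complex_ring])
  show "abelian_group W"
  proof (rule abelian_groupI)
    show "\<zero>\<^bsub>W\<^esub> \<in> carrier W"
      using T_carrier[OF V.zero_closed] by (simp add: T_zero)
    fix u
    assume "u \<in> carrier W"
    then obtain x where x: "x \<in> carrier V" "u = T x"
      by (rule T_cases)
    show "\<zero>\<^bsub>W\<^esub> \<oplus>\<^bsub>W\<^esub> u = u"
      using x by (simp flip: T_zero T_add)
    show "\<exists>v\<in>carrier W. v \<oplus>\<^bsub>W\<^esub> u = \<zero>\<^bsub>W\<^esub>"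
      using x T_carrier by (intro bexI[of _ "T (\<ominus>\<^bsub>V\<^esub> x)"]) (simp_all add: V.l_neg flip: T_zero T_add)
    fix v
    assume "v \<in> carrier W"
    then obtain y where y: "y \<in> carrier V" "v = T y"
      by (rule T_cases)
    show "u \<oplus>\<^bsub>W\<^esub> v \<in> carrier W"
      using x y T_carrier by (simp flip: T_add)
    show "u \<oplus>\<^bsub>W\<^esub> v = v \<oplus>\<^bsub>W\<^esub> u"
      using x y by (simp add: V.a_comm flip: T_add)
    fix w
    assume "w \<in> carrier W"
    then obtain z where z: "z \<in> carrier V" "w = T z"
      by (rule T_cases)
    show "u \<oplus>\<^bsub>W\<^esub> v \<oplus>\<^bsub>W\<^esub> w = u \<oplus>\<^bsub>W\<^esub> (v \<oplus>\<^bsub>W\<^esub> w)"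
      using x y z by (simp add: V.a_assoc flip: T_add)
  qed
next
  fix a b :: complex and u v
  assume u: "u \<in> carrier W"
  then obtain x where x: "x \<in> carrier V" "u = T x"
    by (rule T_cases)
  note closed = V_smult_closed[OF x(1)]
  show "a \<odot>\<^bsub>W\<^esub> u \<in> carrier W"
    using x closed T_carrier by (simp flip: T_smult)
  show "(a \<oplus>\<^bsub>complex_ring\<^esub> b) \<odot>\<^bsub>W\<^esub> u = a \<odot>\<^bsub>W\<^esub> u \<oplus>\<^bsub>W\<^esub> b \<odot>\<^bsub>W\<^esub> u"
    using x closed V.smult_l_distr[of a b x] by (simp flip: T_smult T_add)
  show "(a \<otimes>\<^bsub>complex_ring\<^esub> b) \<odot>\<^bsub>W\<^esub> u = a \<odot>\<^bsub>W\<^esub> (b \<odot>\<^bsub>W\<^esub> u)"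
    using x closed V.smult_assoc1[of a b x] by (simp flip: T_smult)
  show "\<one>\<^bsub>complex_ring\<^esub> \<odot>\<^bsub>W\<^esub> u = u"
    using x V.smult_one[of x] by (simp flip: T_smult)
  assume "v \<in> carrier W"
  then obtain y where y: "y \<in> carrier V" "v = T y"
    by (rule T_cases)
  show "a \<odot>\<^bsub>W\<^esub> (u \<oplus>\<^bsub>W\<^esub> v) = a \<odot>\<^bsub>W\<^esub> u \<oplus>\<^bsub>W\<^esub> a \<odot>\<^bsub>W\<^esub> v"
    using x y V_smult_closed V.smult_r_distr[of a x y] by (simp flip: T_smult T_add)
qed

lemma is_rep_W: "is_rep G W"
  unfolding is_rep_def
proof (intro conjI ballI)
  show "group G"
    using rep by (simp add: is_rep_def)
  show "Module.module complex_ring W"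
    by (rule module_W)
next
  fix g
  assume g: "g \<in> carrier G"
  have cl: "act W g w \<in> carrier W" if "w \<in> carrier W" for w
    using that g T_carrier act_closed by (elim T_cases) (simp flip: T_act)
  have ad: "act W g (u \<oplus>\<^bsub>W\<^esub> v) = act W g u \<oplus>\<^bsub>W\<^esub> act W g v" if "u \<in> carrier W" "v \<in> carrier W" for u v
    using that g by (elim T_cases) (simp add: act_closed act_add flip: T_act T_add)
  have sm: "act W g (c \<odot>\<^bsub>W\<^esub> u) = c \<odot>\<^bsub>W\<^esub> act W g u" if "u \<in> carrier W" for u c
    using that g by (elim T_cases) (simp add: act_closed act_smult V_smult_closed flip: T_act T_smult)
  show "act W g \<in> linear_maps W W"
    using cl ad sm by (auto simp: linear_maps_def hom_def)
  fix h w
  assume h: "h \<in> carrier G" and w: "w \<in> carrier W"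
  have "group G"
    using rep by (simp add: is_rep_def)
  then have gh: "g \<otimes>\<^bsub>G\<^esub> h \<in> carrier G"
    using g h by (simp add: group.is_monoid monoid.m_closed)
  have "act V (g \<otimes>\<^bsub>G\<^esub> h) x = act V g (act V h x)" if "x \<in> carrier V" for x
    using rep g h that by (simp add: is_rep_def)
  then show "act W (g \<otimes>\<^bsub>G\<^esub> h) w = act W g (act W h w)"
    using w g h gh act_closed by (elim T_cases) (simp flip: T_act)
next
  fix w
  assume w: "w \<in> carrier W"
  have "group G"
    using rep by (simp add: is_rep_def)
  then have one: "\<one>\<^bsub>G\<^esub> \<in> carrier G"
    by (simp add: group.is_monoid)
  have "act V \<one>\<^bsub>G\<^esub> x = x" if "x \<in> carrier V" for x
    using rep that by (simp add: is_rep_def)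
  then show "act W \<one>\<^bsub>G\<^esub> w = w"
    using w one by (elim T_cases) (simp flip: T_act)
qed

lemma intertwiner: "T \<in> intertwiners G V W"
  using T_carrier T_add T_smult T_act by (auto simp: intertwiners_def linear_maps_def hom_def)

lemma rep_iso: "rep_iso G V W"
  using rep is_rep_W intertwiner bij by (auto simp: rep_iso_def)

lemma irreducible_W:
  assumes irr: "irreducible_rep G V"
  shows "irreducible_rep G W"
  unfolding irreducible_rep_def
proof (intro conjI allI impI)
  show "is_rep G W"
    by (rule is_rep_W)
  have "carrier V \<noteq> {\<zero>\<^bsub>V\<^esub>}"
    using irr by (simp add: irreducible_rep_def nonzero_rep_def)
  then obtain x where x: "x \<in> carrier V" "x \<noteq> \<zero>\<^bsub>V\<^esub>"
    using V.zero_closed by blast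
  then have "T x \<noteq> \<zero>\<^bsub>W\<^esub>"
    using bij V.zero_closed unfolding T_zero[symmetric] bij_betw_def by (metis inj_on_eq_iff)
  then show "nonzero_rep W"
    using T_carrier[OF x(1)] by (auto simp: nonzero_rep_def)
next
  fix U
  assume U: "Module.submodule U complex_ring W \<and> (\<forall>g\<in>carrier G. act W g ` U \<subseteq> U)"
  interpret W: Module.module complex_ring W
    by (rule module_W)
  note sub = W.submoduleE[OF conjunct1[OF U]]
  have zeroU: "\<zero>\<^bsub>W\<^esub> \<in> U"
    using U subgroup.one_closed[of U "add_monoid W"] by (simp add: submodule_def)
  define U' where "U' = {x \<in> carrier V. T x \<in> U}"
  have "Module.submodule U' complex_ring V"
    using zeroU sub(4,5) by (intro complex_submoduleI module_V)
      (auto simp: U'_def T_zero T_add T_smult V_smult_closed)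
  moreover have "act V g ` U' \<subseteq> U'" if g: "g \<in> carrier G" for g
  proof -
    have "act W g u \<in> U" if "u \<in> U" for u
      using U g that by blast
    then show ?thesis
      using g act_closed by (auto simp: U'_def T_act)
  qed
  ultimately have "U' = {\<zero>\<^bsub>V\<^esub>} \<or> U' = carrier V"
    using irr by (simp add: irreducible_rep_def)
  moreover have "U = T ` U'"
    using sub(1) by (auto simp: U'_def elim!: T_cases)
  ultimately show "U = {\<zero>\<^bsub>W\<^esub>} \<or> U = carrier W"
    using bij by (auto simp: T_zero bij_betw_def)
qed

end


section \<open>The filtration and the compact group\<close>

locale weil_compact = weil_model \<psi> \<mu> Mp p A
  for \<psi> :: "'a::nonarch_local_field \<Rightarrow> complex"
    and \<mu> :: "('a, 'n::{finite,linorder}) vec measure"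
    and Mp :: "'g monoid"
    and p :: "'g \<Rightarrow> 'a^('n + 'n)^('n + 'n)"
    and A :: "'g \<Rightarrow> (('a, 'n) vec \<Rightarrow> complex) \<Rightarrow> (('a, 'n) vec \<Rightarrow> complex)" +
  fixes \<pi> :: 'a and r :: nat
  assumes uniformizer: "uniformizer \<pi>"
begin

lemma pi_nonzero [simp]: "\<pi> \<noteq> 0"
  and absv_pi_less: "absv \<pi> < 1"
  and absv_le_pi: "\<And>x::'a. absv x < 1 \<Longrightarrow> absv x \<le> absv \<pi>"
  using uniformizerD[OF uniformizer] by auto

text \<open>
  The \<open>i\<close>-th coordinates of \<open>lattice_Lr \<pi> r\<close> are the multiples of \<open>delta i\<close>.
\<close>

definition delta :: "'n \<Rightarrow> 'a" where
  "delta i = (if position i < r then \<pi> else 1)"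

lemma delta_nonzero [simp]: "delta i \<noteq> 0"
  by (simp add: delta_def)

lemma absv_delta_le [simp]: "absv (delta i) \<le> 1" and absv_pi_le_delta: "absv \<pi> \<le> absv (delta i)"
  using absv_pi_less by (auto simp: delta_def)

text \<open>
  The two interleaved filtrations become one: level \<open>2 * m\<close> is \<open>S_lower \<pi> r m\<close> and level
  \<open>2 * m - 1\<close> is \<open>S_upper \<pi> r m\<close>. All functions of level \<open>k\<close> are supported in
  \<open>box_at (radius k)\<close> and invariant under \<open>box_at (period k)\<close>.
\<close>

definition radius :: "nat \<Rightarrow> 'n \<Rightarrow> 'a" where
  "radius k i = (if even k then inverse (\<pi> ^ (k div 2)) else inverse (\<pi> ^ (Suc k div 2)) * delta i)"

definition period :: "nat \<Rightarrow> 'n \<Rightarrow> 'a" where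
  "period k i = 2 * delta i / radius k i"

text \<open>
  The radius of the previous level. For \<open>k = 0\<close> it is \<open>delta\<close>, which the formula for odd levels
  would give at \<open>- 1\<close>; this allows the arguments about positive even levels to cover the odd
  functions of level \<open>0\<close>.
\<close>

definition inner_radius :: "nat \<Rightarrow> 'n \<Rightarrow> 'a" where
  "inner_radius k i = radius k i * (if even k then delta i else \<pi> / delta i)"

lemma radius_nonzero [simp]: "radius k i \<noteq> 0"
  by (simp add: radius_def)

lemma period_nonzero [simp]: "period k i \<noteq> 0"
  by (simp add: period_def)

lemma inner_radius_Suc: "inner_radius (Suc k) i = radius k i"
  by (auto simp: inner_radius_def radius_def elim!: evenE oddE)

lemma inner_radius_0: "inner_radius 0 i = delta i"
  by (simp add: inner_radius_def radius_def)

lemma absv_inner_radius_le: "absv (inner_radius k i) \<le> absv (radius k i)"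
proof -
  have "absv (if even k then delta i else \<pi> / delta i) \<le> 1"
    using absv_pi_le_delta[of i] by (simp add: absv_divide)
  then show ?thesis
    by (simp add: inner_radius_def absv_mult mult_left_le)
qed

lemma absv_radius_Suc: "absv (radius k i) \<le> absv (radius (Suc k) i)"
  using absv_inner_radius_le[of "Suc k" i] by (simp add: inner_radius_Suc)

lemma one_le_absv_inverse_power: "1 \<le> absv (inverse (\<pi> ^ m))"
  using absv_pi_less by (simp add: absv_simps one_le_inverse_iff power_le_one)

text \<open>
  This inequality is behind the inclusion of the periods in the support, and it makes the
  Heisenberg operators that fix the functions of a level commute with each other.
\<close>

lemma absv_delta_le_radius: "absv (delta i) \<le> absv (radius k i) ^ 2"
proof (cases "even k")
  case True
  then have "1 \<le> absv (radius k i) ^ 2"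
    using one_le_absv_inverse_power by (simp add: radius_def one_le_power)
  then show ?thesis
    using absv_delta_le[of i] by linarith
next
  case False
  define m where "m = Suc k div 2"
  have m: "m = Suc (m - 1)"
    using False by (auto simp: m_def elim!: oddE)
  have "absv \<pi> ^ m * absv \<pi> ^ m \<le> absv \<pi> * 1"
    using absv_pi_less by (subst m) (intro mult_mono; simp add: power_le_one mult_left_le)
  also have "\<dots> \<le> absv (delta i)"
    using absv_pi_le_delta by simp
  finally have le: "absv \<pi> ^ m * absv \<pi> ^ m \<le> absv (delta i)" .
  have "radius k i = inverse (\<pi> ^ m) * delta i"
    using False by (simp add: radius_def m_def)
  then have eq: "absv \<pi> ^ m * absv (radius k i) = absv (delta i)"
    by (simp add: absv_simps)
  have "absv (delta i) * absv (delta i) =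
      (absv \<pi> ^ m * absv \<pi> ^ m) * absv (radius k i) ^ 2"
    unfolding eq[symmetric] by (simp add: power2_eq_square)
  also have "\<dots> \<le> absv (delta i) * absv (radius k i) ^ 2"
    using le by (intro mult_right_mono) auto
  finally show ?thesis
    using mult_le_cancel_left_pos[of "absv (delta i)" "absv (delta i)"] by simp
qed

lemma absv_period_le_radius: "absv (period k i) \<le> absv (radius k i)"
proof -
  have "absv (2::'a) * absv (delta i) \<le> 1 * absv (radius k i) ^ 2"
    using absv_delta_le_radius absv_numeral_le by (intro mult_mono) auto
  then show ?thesis
    by (simp add: period_def absv_simps divide_le_eq power2_eq_square)
qed

lemma absv_period_Suc: "absv (period (Suc k) i) \<le> absv (period k i)"
  unfolding period_def absv_divide using absv_radius_Suc[of k i] by (intro divide_left_mono) auto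

lemma absv_period_le_inner_radius: "absv (period k i) \<le> absv (inner_radius k i)"
proof (cases k)
  case 0
  then show ?thesis
    using absv_numeral_le[of "num.Bit0 num.One", where 'a='a]
    by (simp add: period_def inner_radius_0 radius_def absv_mult mult_left_le_one_le)
next
  case (Suc l)
  then show ?thesis
    using absv_period_Suc[of l i] absv_period_le_radius[of l i] by (simp add: inner_radius_Suc)
qed

definition supp_inv :: "('n \<Rightarrow> 'a) \<Rightarrow> ('n \<Rightarrow> 'a) \<Rightarrow> (('a, 'n) vec \<Rightarrow> complex) set" where
  "supp_inv a b = {\<phi> \<in> schwartz. (\<forall>y. \<phi> y \<noteq> 0 \<longrightarrow> y \<in> box_at a) \<and>
     (\<forall>y. \<forall>v\<in>box_at b. \<phi> (y + v) = \<phi> y)}"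

definition level :: "nat \<Rightarrow> (('a, 'n) vec \<Rightarrow> complex) set" where
  "level k = supp_inv (radius k) (period k)"

lemma lattice_L_eq: "lattice_L = box_at (\<lambda>_::'n. 1 :: 'a)"
  by (auto simp: lattice_L_def box_at_def integers_def)

lemma lattice_Lr_eq: "lattice_Lr \<pi> r = box_at delta"
proof -
  have "x \<in> (if position i < r then (*) \<pi> ` integers else integers) \<longleftrightarrow> absv x \<le> absv (delta i)"
    for x and i :: 'n
    using in_scaled_integers_iff[OF pi_nonzero, of x] by (simp add: delta_def integers_def)
  then show ?thesis
    by (simp add: lattice_Lr_def box_at_def)
qed

lemma schwartz_quotient_eq_supp_inv: "schwartz_quotient (box_at a) (box_at b) = supp_inv a b"
  unfolding schwartz_quotient_def supp_inv_def by blast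

lemma S_lower_eq_level: "S_lower \<pi> r m = level (2 * m)"
proof -
  have "period (2 * m) = (\<lambda>i. 2 * \<pi> ^ m * delta i)" "radius (2 * m) = (\<lambda>i. inverse (\<pi> ^ m) * 1)"
    by (auto simp: period_def radius_def fun_eq_iff field_simps)
  then show ?thesis
    by (simp add: S_lower_def level_def lattice_L_eq lattice_Lr_eq scalar_image_box_at
        schwartz_quotient_eq_supp_inv)
qed

lemma S_upper_eq_level: "1 \<le> m \<Longrightarrow> S_upper \<pi> r m = level (2 * m - 1)"
proof -
  assume "1 \<le> m"
  then have k: "odd (2 * m - 1)" "Suc (2 * m - 1) div 2 = m"
    by auto
  have "period (2 * m - 1) = (\<lambda>i. 2 * \<pi> ^ m * 1)" "radius (2 * m - 1) = (\<lambda>i. inverse (\<pi> ^ m) * delta i)"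
    using k by (auto simp: period_def radius_def fun_eq_iff field_simps)
  then show ?thesis
    by (simp add: S_upper_def level_def lattice_L_eq lattice_Lr_eq scalar_image_box_at
        schwartz_quotient_eq_supp_inv)
qed

lemma supp_inv_mono:
  assumes "\<And>i. absv (a i) \<le> absv (a' i)" "\<And>i. absv (b' i) \<le> absv (b i)"
  shows "supp_inv a b \<subseteq> supp_inv a' b'"
  using box_at_mono[of a a'] box_at_mono[of b' b] assms unfolding supp_inv_def by blast

lemma level_Suc: "level k \<subseteq> level (Suc k)"
  unfolding level_def by (intro supp_inv_mono absv_radius_Suc absv_period_Suc)

lemma level_mono: "j \<le> k \<Longrightarrow> level j \<subseteq> level k"
  using level_Suc by (rule lift_Suc_mono_le)

lemma level_schwartz: "\<phi> \<in> level k \<Longrightarrow> \<phi> \<in> schwartz"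
  by (simp add: level_def supp_inv_def)

lemma in_some_level:
  assumes "\<phi> \<in> schwartz"
  shows "\<exists>k. \<phi> \<in> level k"
proof -
  obtain c d where \<phi>: "c \<noteq> 0" "\<And>y. \<phi> y \<noteq> 0 \<Longrightarrow> y \<in> box_at (\<lambda>_. c)"
    "d \<noteq> 0" "\<And>y b. b \<in> box_at (\<lambda>_. d) \<Longrightarrow> \<phi> (y + b) = \<phi> y"
    using assms unfolding schwartz_iff by blast
  have "0 < min (inverse (absv c)) (absv d)"
    using \<phi>(1,3) by simp
  then obtain m where m: "absv \<pi> ^ m < min (inverse (absv c)) (absv d)"
    using real_arch_pow_inv absv_pi_less by blast
  have "absv c \<le> absv (radius (2 * m) i)" for i
    using m \<phi>(1) by (simp add: radius_def absv_simps field_simps)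
  moreover have "absv (period (2 * m) i) \<le> absv d" for i
  proof -
    have "absv (period (2 * m) i) = absv (2::'a) * absv (delta i) * absv \<pi> ^ m"
      by (simp add: period_def radius_def absv_simps divide_inverse)
    also have "\<dots> \<le> 1 * 1 * absv \<pi> ^ m"
      using absv_numeral_le absv_delta_le by (intro mult_mono) auto
    finally show ?thesis
      using m by simp
  qed
  moreover have "\<phi> \<in> supp_inv (\<lambda>_. c) (\<lambda>_. d)"
    using \<phi> assms by (simp add: supp_inv_def)
  ultimately show ?thesis
    using supp_inv_mono[of "\<lambda>_. c" "radius (2 * m)" "period (2 * m)" "\<lambda>_. d"] unfolding level_def
    by blast
qed

text \<open>
  Both conditions defining \<open>supp_inv a b\<close> are invariance under Heisenberg operators: being
  supported in \<open>box_at a\<close> is invariance under the multiplications with the characters in the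
  dual lattice \<open>box_at (2 / a)\<close>.
\<close>

lemma supp_inv_iff_heis:
  assumes nz: "\<And>i. a i \<noteq> 0" and \<phi>: "\<phi> \<in> schwartz"
  shows "\<phi> \<in> supp_inv a b \<longleftrightarrow> (\<forall>c\<in>box_at (\<lambda>i. 2 / a i). heis (vec_pair c 0) \<phi> = \<phi>) \<and>
    (\<forall>v\<in>box_at b. heis (vec_pair 0 v) \<phi> = \<phi>)"
proof -
  have mod: "heis (vec_pair c 0) \<phi> = (\<lambda>y. \<psi> (2 * dot c y) * \<phi> y)" for c
    by (simp add: heis_def)
  have trans: "heis (vec_pair 0 v) \<phi> = (\<lambda>y. \<phi> (y - v))" for v
    by (simp add: heis_def)
  have "(\<forall>y. \<phi> y \<noteq> 0 \<longrightarrow> y \<in> box_at a) \<longleftrightarrow> (\<forall>c\<in>box_at (\<lambda>i. 2 / a i). heis (vec_pair c 0) \<phi> = \<phi>)"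
  proof (intro iffI allI ballI impI)
    fix c
    assume supp: "\<forall>y. \<phi> y \<noteq> 0 \<longrightarrow> y \<in> box_at a" and c: "c \<in> box_at (\<lambda>i. 2 / a i)"
    have "\<psi> (2 * dot c y) = 1" if "y \<in> box_at a" for y
    proof (rule psi_trivial)
      have "absv (dot c y) \<le> absv (2::'a)"
      proof (rule absv_dot_le)
        fix i
        have "absv (c $ i) * absv (y $ i) \<le> absv (2 / a i) * absv (a i)"
          using c that by (intro mult_mono) (auto simp: box_at_def)
        then show "absv (c $ i) * absv (y $ i) \<le> absv (2::'a)"
          using nz[of i] by (simp add: absv_divide)
      qed
      then have "absv (2::'a) * absv (dot c y) \<le> absv (2::'a) * absv (2::'a)"
        by (intro mult_left_mono) auto
      then show "absv (2 * dot c y) \<le> absv (4::'a)"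
        by (simp flip: absv_mult)
    qed
    then show "heis (vec_pair c 0) \<phi> = \<phi>"
      unfolding mod fun_eq_iff using supp by (metis mult_1 mult_zero_right)
  next
    fix y
    assume inv: "\<forall>c\<in>box_at (\<lambda>i. 2 / a i). heis (vec_pair c 0) \<phi> = \<phi>" and "\<phi> y \<noteq> 0"
    show "y \<in> box_at a"
      unfolding in_box_at_iff
    proof
      fix i
      have "absv (4 / a i * y $ i) \<le> absv (4::'a)"
      proof (rule absv_le_4_if_psi_trivial)
        fix t :: 'a
        assume "absv t \<le> 1"
        then have "absv (t * (2 / a i)) \<le> absv (2 / a i)"
          by (simp add: absv_simps mult_left_le_one_le divide_right_mono)
        then have "axis i (t * (2 / a i)) \<in> box_at (\<lambda>i. 2 / a i)"
          by (auto simp: box_at_def axis_def)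
        with inv have "heis (vec_pair (axis i (t * (2 / a i))) 0) \<phi> = \<phi>"
          by blast
        then have "\<psi> (2 * dot (axis i (t * (2 / a i))) y) * \<phi> y = \<phi> y"
          unfolding mod by metis
        then show "\<psi> (t * (4 / a i * y $ i)) = 1"
          using \<open>\<phi> y \<noteq> 0\<close> by (simp add: mult_ac)
      qed
      then have "absv (4::'a) * absv (y $ i) \<le> absv (4::'a) * absv (a i)"
        using nz[of i] by (simp add: absv_simps field_simps)
      moreover have "0 < absv (4::'a)"
        by simp
      ultimately show "absv (y $ i) \<le> absv (a i)"
        using mult_le_cancel_left_pos by blast
    qed
  qed
  moreover have "(\<forall>y. \<forall>v\<in>box_at b. \<phi> (y + v) = \<phi> y) \<longleftrightarrow> (\<forall>v\<in>box_at b. heis (vec_pair 0 v) \<phi> = \<phi>)"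
    unfolding trans fun_eq_iff
  proof (intro iffI ballI allI)
    fix v y
    assume "\<forall>y. \<forall>v\<in>box_at b. \<phi> (y + v) = \<phi> y" "v \<in> box_at b"
    then have "\<phi> (y - v + v) = \<phi> (y - v)"
      by blast
    then show "\<phi> (y - v) = \<phi> y"
      by simp
  next
    fix y v
    assume "\<forall>v\<in>box_at b. \<forall>y. \<phi> (y - v) = \<phi> y" "v \<in> box_at b"
    then have "\<phi> (y + v - v) = \<phi> (y + v)"
      by blast
    then show "\<phi> (y + v) = \<phi> y"
      by simp
  qed
  ultimately show ?thesis
    using \<phi> by (simp add: supp_inv_def)
qed

text \<open>
  The lattice in \<open>W\<close> whose Heisenberg operators fix exactly the functions of level \<open>k\<close>; see
  \<open>level_iff_heis\<close> below.
\<close>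

definition period_lattice :: "nat \<Rightarrow> ('a^('n + 'n)) set" where
  "period_lattice k = {w. vec_left w \<in> box_at (\<lambda>i. 2 / radius k i) \<and> vec_right w \<in> box_at (period k)}"

lemma absv_dot_period_lattice:
  assumes "c \<in> box_at (\<lambda>i. 2 / radius k i)" "v \<in> box_at (period k)"
  shows "absv (dot c v) \<le> absv (4::'a)"
proof (rule absv_dot_le)
  fix i
  have "absv (c $ i) * absv (v $ i) \<le> absv (2 / radius k i) * absv (period k i)"
    using assms by (intro mult_mono) (auto simp: box_at_def)
  also have "\<dots> = absv (4::'a) * (absv (delta i) / absv (radius k i) ^ 2)"
    by (simp add: period_def power2_eq_square flip: absv_simps)
  also have "\<dots> \<le> absv (4::'a)"
    using absv_delta_le_radius[of i k] by (intro mult_left_le) (auto simp: divide_le_eq)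
  finally show "absv (c $ i) * absv (v $ i) \<le> absv (4::'a)" .
qed

lemma heis_eq_compose:
  assumes "w \<in> period_lattice k"
  shows "heis w \<phi> = heis (vec_pair (vec_left w) 0) (heis (vec_pair 0 (vec_right w)) \<phi>)"
proof -
  have "\<psi> (dot (vec_left w) (vec_right w)) = 1"
    using assms absv_dot_period_lattice by (auto simp: period_lattice_def intro: psi_trivial)
  then show ?thesis
    by (simp add: heis_def psi_diff)
qed

lemma level_iff_heis:
  assumes "\<phi> \<in> schwartz"
  shows "\<phi> \<in> level k \<longleftrightarrow> (\<forall>w\<in>period_lattice k. heis w \<phi> = \<phi>)"
proof -
  have sub: "vec_pair c 0 \<in> period_lattice k" if "c \<in> box_at (\<lambda>i. 2 / radius k i)" for c
    using that by (simp add: period_lattice_def)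
  have sub': "vec_pair 0 v \<in> period_lattice k" if "v \<in> box_at (period k)" for v
    using that by (simp add: period_lattice_def)
  have "(\<forall>w\<in>period_lattice k. heis w \<phi> = \<phi>) \<longleftrightarrow>
      (\<forall>c\<in>box_at (\<lambda>i. 2 / radius k i). heis (vec_pair c 0) \<phi> = \<phi>) \<and>
      (\<forall>v\<in>box_at (period k). heis (vec_pair 0 v) \<phi> = \<phi>)" (is "?L \<longleftrightarrow> ?R")
  proof (intro iffI ballI)
    fix w
    assume R: ?R and w: "w \<in> period_lattice k"
    then have "vec_left w \<in> box_at (\<lambda>i. 2 / radius k i)" "vec_right w \<in> box_at (period k)"
      by (simp_all add: period_lattice_def)
    then have "heis (vec_pair 0 (vec_right w)) \<phi> = \<phi>" "heis (vec_pair (vec_left w) 0) \<phi> = \<phi>"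
      using R by blast+
    then show "heis w \<phi> = \<phi>"
      using heis_eq_compose[OF w, of \<phi>] by metis
  qed (use sub sub' in blast)
  then show ?thesis
    unfolding level_def supp_inv_iff_heis[OF radius_nonzero assms] by blast
qed

lemma period_lattice_add:
  "v \<in> period_lattice k \<Longrightarrow> w \<in> period_lattice k \<Longrightarrow> v + w \<in> period_lattice k"
  by (simp add: period_lattice_def box_at_add)

lemma period_lattice_minus: "w \<in> period_lattice k \<Longrightarrow> - w \<in> period_lattice k"
  by (simp add: period_lattice_def)

lemma period_lattice_0: "0 \<in> period_lattice k"
  by (simp add: period_lattice_def in_box_at_iff)

lemma period_lattice_mono:
  assumes "j \<le> k"
  shows "period_lattice k \<subseteq> period_lattice j"
  using assms
proof (induction k rule: dec_induct)
  case (step k)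
  have "absv (2 / radius (Suc k) i) \<le> absv (2 / radius k i)" for i
    unfolding absv_divide using absv_radius_Suc[of k i] by (intro divide_left_mono) auto
  then have "period_lattice (Suc k) \<subseteq> period_lattice k"
    unfolding period_lattice_def
    using absv_period_Suc box_at_mono[of "\<lambda>i. 2 / radius (Suc k) i" "\<lambda>i. 2 / radius k i"]
      box_at_mono[of "period (Suc k)" "period k"] by blast
  then show ?case
    using step by blast
qed simp

text \<open>
  On a period lattice, the symplectic form takes values in \<open>4\<close> times the integers, where \<open>\<psi>\<close> is
  trivial.
\<close>

lemma heis_heis_period_lattice:
  assumes "v \<in> period_lattice k" "w \<in> period_lattice k"
  shows "heis v (heis w \<phi>) = heis (v + w) \<phi>"
proof -
  have "absv (dot (vec_left v) (vec_right w) - dot (vec_left w) (vec_right v)) \<le> absv (4::'a)"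
    using assms by (intro absv_diff_le absv_dot_period_lattice[of _ k]) (auto simp: period_lattice_def)
  then show ?thesis
    by (simp add: heis_heis psi_trivial)
qed

definition K :: "'g set" where
  "K = {g \<in> carrier Mp. p g \<in> stabilizer_K \<pi> r}"

lemma lattice_W_eq: "lattice_W \<pi> r = {w. vec_left w \<in> box_at (\<lambda>_. 1) \<and> vec_right w \<in> box_at delta}"
    (is "_ = ?W")
proof -
  have comb: "(\<Sum>i\<in>UNIV. c i *s axis (Inl i) 1) +
      (\<Sum>i\<in>UNIV. d i *s (if position i < r then \<pi> *s axis (Inr i) 1 else axis (Inr i) 1)) =
      vec_pair (\<chi> i. c i) (\<chi> i. d i * delta i)" for c d :: "'n \<Rightarrow> 'a"
  proof -
    have "(\<Sum>i\<in>UNIV. d i *s (if position i < r then \<pi> *s axis (Inr i) 1 else axis (Inr i) 1)) =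
        (\<Sum>i\<in>UNIV. (d i * delta i) *s (axis (Inr i) 1 :: 'a^('n + 'n)))"
      by (intro sum.cong) (auto simp: delta_def vector_smult_assoc)
    moreover have "(\<Sum>i\<in>UNIV. e i *s (axis (Inl i) 1 :: 'a^('n + 'n))) = vec_pair (\<chi> i. e i) 0" for e
      by (rule vec_eq_iff[THEN iffD2])
        (auto simp: forall_sum_type axis_def if_distrib cong: if_cong)
    moreover have "(\<Sum>i\<in>UNIV. e i *s (axis (Inr i) 1 :: 'a^('n + 'n))) = vec_pair 0 (\<chi> i. e i)" for e
      by (rule vec_eq_iff[THEN iffD2])
        (auto simp: forall_sum_type axis_def if_distrib cong: if_cong)
    moreover have "vec_pair x 0 + vec_pair 0 y = vec_pair x y" for x y :: "('a, 'n) vec"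
      by (simp add: vec_eq_iff forall_sum_type)
    ultimately show ?thesis
      by simp
  qed
  show ?thesis
  proof (intro equalityI subsetI)
    fix w :: "'a^('n + 'n)"
    assume "w \<in> lattice_W \<pi> r"
    then obtain c d where w: "w = vec_pair (\<chi> i. c i) (\<chi> i. d i * delta i)"
        "range c \<subseteq> integers" "range d \<subseteq> integers"
      unfolding lattice_W_def mem_Collect_eq comb by blast
    then have "absv (c i) \<le> 1" "absv (d i) \<le> 1" for i
      by (auto simp: integers_def)
    then show "w \<in> ?W"
      by (simp add: w(1) in_box_at_iff absv_mult mult_left_le_one_le)
  next
    fix w
    assume w: "w \<in> ?W"
    define c where "c = (\<lambda>i. w $ Inl i)"
    define d where "d = (\<lambda>i. w $ Inr i / delta i)"
    have "w = vec_pair (\<chi> i. c i) (\<chi> i. d i * delta i)"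
      by (simp add: c_def d_def vec_eq_iff forall_sum_type)
    moreover have "range c \<subseteq> integers" "range d \<subseteq> integers"
      using w by (auto simp: c_def d_def integers_def in_box_at_iff absv_divide divide_le_eq)
    ultimately show "w \<in> lattice_W \<pi> r"
      unfolding lattice_W_def mem_Collect_eq comb by blast
  qed
qed

lemma K_memI:
  assumes "g \<in> carrier Mp" "p g ** m = mat 1"
    "\<And>w. w \<in> lattice_W \<pi> r \<Longrightarrow> p g *v w \<in> lattice_W \<pi> r"
    "\<And>w. w \<in> lattice_W \<pi> r \<Longrightarrow> m *v w \<in> lattice_W \<pi> r"
  shows "g \<in> K"
proof -
  have "w = p g *v (m *v w)" for w
    using assms(2) by (simp add: matrix_vector_mul_assoc)
  then have "(*v) (p g) ` lattice_W \<pi> r = lattice_W \<pi> r"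
    using assms(3,4) by (auto intro!: image_eqI)
  then show ?thesis
    using assms(1) p_Sp by (simp add: K_def stabilizer_K_def)
qed

lemma K_carrier: "g \<in> K \<Longrightarrow> g \<in> carrier Mp"
  by (simp add: K_def)

lemma K_lattice_W: "g \<in> K \<Longrightarrow> w \<in> lattice_W \<pi> r \<Longrightarrow> p g *v w \<in> lattice_W \<pi> r"
  by (auto simp: K_def stabilizer_K_def)

lemma subgroup_K: "subgroup K Mp"
proof (rule Mp.subgroupI)
  have "\<one>\<^bsub>Mp\<^esub> \<in> K"
    by (rule K_memI[of _ "mat 1"]) (simp_all add: p_one)
  then show "K \<noteq> {}"
    by blast
next
  fix g
  assume g: "g \<in> K"
  then have G: "g \<in> carrier Mp"
    by (rule K_carrier)
  show "inv\<^bsub>Mp\<^esub> g \<in> K"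
  proof (rule K_memI)
    show "inv\<^bsub>Mp\<^esub> g \<in> carrier Mp" "p (inv\<^bsub>Mp\<^esub> g) ** p g = mat 1"
      using G by (simp_all add: p_inv)
    fix w :: "'a^('n + 'n)"
    assume "w \<in> lattice_W \<pi> r"
    then obtain v where "v \<in> lattice_W \<pi> r" "w = p g *v v"
      using g unfolding K_def stabilizer_K_def by blast
    then show "p (inv\<^bsub>Mp\<^esub> g) *v w \<in> lattice_W \<pi> r"
      using G by (simp add: p_inv_vec)
  qed (rule K_lattice_W[OF g])
next
  fix g h
  assume gh: "g \<in> K" "h \<in> K"
  then have G: "g \<in> carrier Mp" "h \<in> carrier Mp"
    by (auto intro: K_carrier)
  have "(*v) (p (g \<otimes>\<^bsub>Mp\<^esub> h)) ` lattice_W \<pi> r = (*v) (p g) ` ((*v) (p h) ` lattice_W \<pi> r)"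
    using G by (simp add: p_mult image_image matrix_vector_mul_assoc)
  then show "g \<otimes>\<^bsub>Mp\<^esub> h \<in> K"
    using gh G p_Sp[of "g \<otimes>\<^bsub>Mp\<^esub> h"] by (simp add: K_def stabilizer_K_def)
qed (use K_carrier in blast)

lemma K_inv: "g \<in> K \<Longrightarrow> inv\<^bsub>Mp\<^esub> g \<in> K"
  using subgroup_K by (rule subgroup.m_inv_closed)

section \<open>The compact group preserves the filtration\<close>

definition symp :: "'a^('n + 'n) \<Rightarrow> 'a^('n + 'n) \<Rightarrow> 'a" where
  "symp v w = dot (vec_left v) (vec_right w) - dot (vec_right v) (vec_left w)"

lemma symp_eq_dot: "symp v w = dot v (symplectic_form *v w)"
proof -
  have "symplectic_form *v w = vec_pair (vec_right w) (- vec_left w)"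
    using block_matrix_mult_pair[of 0 "mat 1" "- mat 1" 0 "vec_left w" "vec_right w"]
    by (simp add: symplectic_form_def vec_pair_eta)
  then show ?thesis
    by (simp add: symp_def dot_def sum_sum_type sum_negf)
qed

lemma symp_Sp: "g \<in> carrier Sp \<Longrightarrow> symp (g *v v) (g *v w) = symp v w"
proof -
  assume "g \<in> carrier Sp"
  then have "transpose g ** symplectic_form ** g = symplectic_form"
    by (simp add: Sp_def)
  then have "transpose g *v (symplectic_form *v (g *v w)) = symplectic_form *v w"
    by (simp only: matrix_vector_mul_assoc matrix_mul_assoc)
  then show ?thesis
    unfolding symp_eq_dot by (metis dot_matrix_transpose transpose_transpose)
qed

lemma period_lattice_even_iff:
  "w \<in> period_lattice (2 * m) \<longleftrightarrow> inverse (2 * \<pi> ^ m) *s w \<in> lattice_W \<pi> r"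
proof -
  define t where "t = 2 * \<pi> ^ m"
  have t: "t \<noteq> 0"
    by (simp add: t_def)
  have "vec_left (inverse t *s w) = inverse t *s vec_left w"
    "vec_right (inverse t *s w) = inverse t *s vec_right w"
    by (simp_all add: vec_eq_iff)
  moreover have "absv (2 / radius (2 * m) i) = absv t * 1"
    "absv (period (2 * m) i) = absv t * absv (delta i)" for i
    by (simp_all add: t_def radius_def period_def absv_simps divide_inverse)
  moreover have "absv (inverse t * x) \<le> d \<longleftrightarrow> absv x \<le> absv t * d" for x d
    using t by (simp add: absv_simps field_simps)
  ultimately show ?thesis
    unfolding period_lattice_def lattice_W_eq t_def[symmetric]
    by (simp add: in_box_at_iff)
qed

text \<open>
  The period lattices of odd level are, up to a scalar, the symplectic duals of the lattice
  that defines the compact group.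
\<close>

lemma period_lattice_odd_iff:
  assumes "1 \<le> m"
  shows "w \<in> period_lattice (2 * m - 1) \<longleftrightarrow> (\<forall>v\<in>lattice_W \<pi> r. absv (symp v w) \<le> absv (2 * \<pi> ^ m))"
proof -
  have k: "odd (2 * m - 1)" "Suc (2 * m - 1) div 2 = m"
    using assms by auto
  have rad: "2 / radius (2 * m - 1) i = 2 * \<pi> ^ m / delta i" and per: "period (2 * m - 1) i = 2 * \<pi> ^ m" for i
    using k by (auto simp: period_def radius_def field_simps)
  show ?thesis
  proof (intro iffI ballI)
    fix v :: "'a^('n + 'n)"
    assume w: "w \<in> period_lattice (2 * m - 1)" and v: "v \<in> lattice_W \<pi> r"
    show "absv (symp v w) \<le> absv (2 * \<pi> ^ m)"
      unfolding symp_def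
    proof (intro absv_diff_le absv_dot_le)
      fix i
      have "absv (vec_left v $ i) * absv (vec_right w $ i) \<le> 1 * absv (2 * \<pi> ^ m)"
        using v w by (intro mult_mono) (auto simp: lattice_W_eq period_lattice_def in_box_at_iff per simp del: One_nat_def)
      then show "absv (vec_left v $ i) * absv (vec_right w $ i) \<le> absv (2 * \<pi> ^ m)"
        by simp
      have "absv (vec_right v $ i) * absv (vec_left w $ i) \<le> absv (delta i) * absv (2 * \<pi> ^ m / delta i)"
        using v w by (intro mult_mono) (auto simp: lattice_W_eq period_lattice_def in_box_at_iff rad simp del: One_nat_def)
      then show "absv (vec_right v $ i) * absv (vec_left w $ i) \<le> absv (2 * \<pi> ^ m)"
        by (simp add: absv_divide)
    qed
  next
    assume dual: "\<forall>v\<in>lattice_W \<pi> r. absv (symp v w) \<le> absv (2 * \<pi> ^ m)"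
    have "absv (vec_right w $ i) \<le> absv (2 * \<pi> ^ m)" for i
    proof -
      have "vec_pair (axis i 1) 0 \<in> lattice_W \<pi> r"
        by (auto simp: lattice_W_eq in_box_at_iff axis_def)
      then have "absv (symp (vec_pair (axis i 1) 0) w) \<le> absv (2 * \<pi> ^ m)"
        using dual by blast
      then show ?thesis
        by (simp add: symp_def)
    qed
    moreover have "absv (vec_left w $ i) \<le> absv (2 * \<pi> ^ m / delta i)" for i
    proof -
      have "vec_pair 0 (axis i (delta i)) \<in> lattice_W \<pi> r"
        by (auto simp: lattice_W_eq in_box_at_iff axis_def)
      then have "absv (symp (vec_pair 0 (axis i (delta i))) w) \<le> absv (2 * \<pi> ^ m)"
        using dual by blast
      then show ?thesis
        by (simp add: symp_def absv_mult absv_divide field_simps)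
    qed
    ultimately show "w \<in> period_lattice (2 * m - 1)"
      by (simp add: period_lattice_def in_box_at_iff rad per del: One_nat_def)
  qed
qed

lemma K_period_lattice:
  assumes g: "g \<in> K" and w: "w \<in> period_lattice k"
  shows "p g *v w \<in> period_lattice k"
proof (cases "even k")
  case True
  then obtain m where k: "k = 2 * m"
    by blast
  have "inverse (2 * \<pi> ^ m) *s (p g *v w) = p g *v (inverse (2 * \<pi> ^ m) *s w)"
    by (simp add: vec.scale)
  then show ?thesis
    using K_lattice_W[OF g] w unfolding k period_lattice_even_iff by metis
next
  case False
  then obtain n where "k = 2 * n + 1"
    by (rule oddE)
  then obtain m where k: "k = 2 * m - 1" "1 \<le> m"
    using that[of "Suc n"] by simp
  have G: "g \<in> carrier Mp"
    using g by (rule K_carrier)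
  show ?thesis
    unfolding k(1) period_lattice_odd_iff[OF k(2)]
  proof
    fix v :: "'a^('n + 'n)"
    assume v: "v \<in> lattice_W \<pi> r"
    have "symp v (p g *v w) = symp (p g *v (p (inv\<^bsub>Mp\<^esub> g) *v v)) (p g *v w)"
      using G by (simp add: p_inv_vec)
    also have "\<dots> = symp (p (inv\<^bsub>Mp\<^esub> g) *v v) w"
      using G by (intro symp_Sp p_Sp)
    finally show "absv (symp v (p g *v w)) \<le> absv (2 * \<pi> ^ m)"
      using w K_lattice_W[OF K_inv[OF g] v] unfolding k(1) period_lattice_odd_iff[OF k(2)] by metis
  qed
qed

text \<open>
  The compact group stabilizes the period lattice, and the level
  consists of the common fixed vectors of the corresponding Heisenberg operators.
\<close>

lemma A_level:
  assumes g: "g \<in> K" and \<phi>: "\<phi> \<in> level k"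
  shows "A g \<phi> \<in> level k"
proof -
  have G: "g \<in> carrier Mp"
    using g by (rule K_carrier)
  have S: "\<phi> \<in> schwartz"
    using \<phi> by (rule level_schwartz)
  have "heis w (A g \<phi>) = A g \<phi>" if w: "w \<in> period_lattice k" for w
  proof -
    have "heis w (A g \<phi>) = A g (heis (p (inv\<^bsub>Mp\<^esub> g) *v w) \<phi>)"
      using G S by (simp add: A_heis p_inv_vec)
    also have "heis (p (inv\<^bsub>Mp\<^esub> g) *v w) \<phi> = \<phi>"
      using \<phi> K_period_lattice[OF K_inv[OF g] w] level_iff_heis[OF S] by blast
    finally show ?thesis .
  qed
  then show ?thesis
    using level_iff_heis[OF A_closed[OF G S]] by blast
qed

section \<open>Elements of the compact group\<close>

text \<open>
  The element with \<open>e\<^sub>i \<mapsto> - delta i f\<^sub>i\<close> and \<open>f\<^sub>i \<mapsto> e\<^sub>i / delta i\<close>. As it exchanges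
  characters and translations, it exchanges the conditions on the support and on the period.
\<close>

lemma weyl_element:
  obtains w where "w \<in> K"
    "\<And>x. p w *v x = vec_pair (\<chi> i. x $ Inr i / delta i) (\<chi> i. - delta i * x $ Inl i)"
    "\<And>a b \<phi>. (\<And>i. a i \<noteq> 0) \<Longrightarrow> (\<And>i. b i \<noteq> 0) \<Longrightarrow>
      \<phi> \<in> supp_inv a (\<lambda>i. 2 * delta i / b i) \<Longrightarrow> A w \<phi> \<in> supp_inv b (\<lambda>i. 2 * delta i / a i)"
proof -
  define D :: "(('a, 'n) vec, 'n) vec" where "D = (\<chi> i j. if i = j then delta i else 0)"
  define D' :: "(('a, 'n) vec, 'n) vec" where "D' = (\<chi> i j. if i = j then inverse (delta i) else 0)"
  have Dv: "D *v x = (\<chi> i. delta i * x $ i)" "D' *v x = (\<chi> i. x $ i / delta i)" for x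
    by (auto simp: D_def D'_def vec_eq_iff matrix_vector_mult_def divide_inverse if_distrib if_distribR
        cong: if_cong)
  have "(D ** D') *v x = mat 1 *v x" for x
    by (simp only: matrix_vector_mul_assoc[symmetric] Dv) (simp add: vec_eq_iff)
  then have Dinv: "D ** D' = mat 1"
    by (simp add: matrix_eq)
  have "transpose D = D"
    by (auto simp: D_def transpose_def vec_eq_iff)
  with Dinv have "block_matrix 0 D' (- D) 0 \<in> carrier Sp"
    by (simp add: block_matrix_in_Sp_iff transpose_uminus)
  then obtain g where g: "g \<in> carrier Mp" "p g = block_matrix 0 D' (- D) 0"
    using p_surj by blast
  have pg: "p g *v w = vec_pair (\<chi> i. w $ Inr i / delta i) (\<chi> i. - delta i * w $ Inl i)" for w
    using block_matrix_mult_pair[of 0 D' "- D" 0 "vec_left w" "vec_right w"]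
    by (simp add: g(2) vec_pair_eta Dv) (simp add: vec_eq_iff forall_sum_type)
  have "p g ** block_matrix 0 (- D') D 0 = mat 1"
    using Dinv matrix_left_right_inverse[of D D'] by (simp add: g(2) block_matrix_mult mat_1_eq_block)
  moreover have "block_matrix 0 (- D') D 0 *v w =
      vec_pair (\<chi> i. - w $ Inr i / delta i) (\<chi> i. delta i * w $ Inl i)" for w
    using block_matrix_mult_pair[of 0 "- D'" D 0 "vec_left w" "vec_right w"]
    by (simp add: vec_pair_eta Dv) (simp add: vec_eq_iff forall_sum_type)
  ultimately have K: "g \<in> K"
    by (intro K_memI[OF g(1)])
      (auto simp: pg lattice_W_eq in_box_at_iff absv_simps divide_le_eq mult_left_le)
  have "A g \<phi> \<in> supp_inv b (\<lambda>i. 2 * delta i / a i)"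
    if nz: "\<And>i. a i \<noteq> 0" "\<And>i. b i \<noteq> 0" and \<phi>: "\<phi> \<in> supp_inv a (\<lambda>i. 2 * delta i / b i)" for a b \<phi>
  proof -
    have S: "\<phi> \<in> schwartz"
      using \<phi> by (simp add: supp_inv_def)
    note \<phi>' = \<phi>[unfolded supp_inv_iff_heis[OF nz(1) S]]
    have "heis (vec_pair c 0) (A g \<phi>) = A g \<phi>" if c: "c \<in> box_at (\<lambda>i. 2 / b i)" for c
    proof -
      have "vec_pair c 0 = p g *v vec_pair 0 (\<chi> i. delta i * c $ i)"
        by (simp add: pg vec_eq_iff forall_sum_type)
      then have "heis (vec_pair c 0) (A g \<phi>) = A g (heis (vec_pair 0 (\<chi> i. delta i * c $ i)) \<phi>)"
        using A_heis[OF g(1) S] by metis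
      moreover have "(\<chi> i. delta i * c $ i) \<in> box_at (\<lambda>i. 2 * delta i / b i)"
        unfolding in_box_at_iff
      proof
        fix i
        have "absv (delta i) * absv (c $ i) \<le> absv (delta i) * absv (2 / b i)"
          using c by (intro mult_left_mono) (auto simp: in_box_at_iff)
        then show "absv ((\<chi> i. delta i * c $ i) $ i) \<le> absv (2 * delta i / b i)"
          by (simp add: absv_simps mult_ac)
      qed
      ultimately show ?thesis
        using \<phi>' by simp
    qed
    moreover have "heis (vec_pair 0 v) (A g \<phi>) = A g \<phi>" if v: "v \<in> box_at (\<lambda>i. 2 * delta i / a i)" for v
    proof -
      have "vec_pair 0 v = p g *v vec_pair (\<chi> i. - v $ i / delta i) 0"
        by (simp add: pg vec_eq_iff forall_sum_type)
      then have "heis (vec_pair 0 v) (A g \<phi>) = A g (heis (vec_pair (\<chi> i. - v $ i / delta i) 0) \<phi>)"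
        using A_heis[OF g(1) S] by metis
      moreover have "(\<chi> i. - v $ i / delta i) \<in> box_at (\<lambda>i. 2 / a i)"
        unfolding in_box_at_iff
      proof
        fix i
        have "absv (v $ i) / absv (delta i) \<le> absv (2 * delta i / a i) / absv (delta i)"
          using v by (intro divide_right_mono) (auto simp: in_box_at_iff)
        then show "absv ((\<chi> i. - v $ i / delta i) $ i) \<le> absv (2 / a i)"
          by (simp add: absv_simps)
      qed
      ultimately show ?thesis
        using \<phi>' by simp
    qed
    ultimately show ?thesis
      unfolding supp_inv_iff_heis[OF nz(2) A_closed[OF g(1) S]] by blast
  qed
  from that[OF K pg this] show thesis .
qed

text \<open>
  The symmetric matrices \<open>a\<close> for which the unipotent matrix with upper right block \<open>a\<close> maps
  \<open>lattice_W \<pi> r\<close> to itself.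
\<close>

definition unipotents :: "(('a, 'n) vec, 'n) vec set" where
  "unipotents = {a. transpose a = a \<and> (\<forall>i j. absv (a $ i $ j * delta j) \<le> 1)}"

definition chi :: "(('a, 'n) vec, 'n) vec \<Rightarrow> ('a, 'n) vec \<Rightarrow> complex" where
  "chi a y = \<psi> (dot y (a *v y))"

lemma unipotent_K:
  assumes a: "a \<in> unipotents"
  shows "\<exists>g\<in>K. \<forall>\<phi>\<in>schwartz. A g \<phi> = (\<lambda>y. chi a y * \<phi> y)"
proof -
  have at: "transpose a = a"
    using a by (simp add: unipotents_def)
  obtain g where g: "g \<in> carrier Mp" "p g = block_matrix (mat 1) a 0 (mat 1)"
    "\<And>\<phi>. \<phi> \<in> schwartz \<Longrightarrow> A g \<phi> = (\<lambda>y. \<psi> (dot y (a *v y)) * \<phi> y)"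
    using unipotent_lift[OF at] by blast
  have av: "a *v x \<in> box_at (\<lambda>_. 1)" if x: "x \<in> box_at delta" for x
    unfolding in_box_at_iff matrix_vector_mult_def vec_lambda_beta
  proof (intro allI absv_sum_le)
    fix i j
    have "absv (a $ i $ j) * absv (x $ j) \<le> absv (a $ i $ j) * absv (delta j)"
      using x by (intro mult_left_mono) (auto simp: in_box_at_iff)
    also have "\<dots> \<le> 1"
      using a by (simp add: unipotents_def flip: absv_mult)
    finally show "absv (a $ i $ j * x $ j) \<le> absv (1::'a)"
      by (simp add: absv_mult)
  qed simp
  have "block_matrix (mat 1) a' 0 (mat 1) *v w = vec_pair (vec_left w + a' *v vec_right w) (vec_right w)"
    for a' :: "(('a, 'n) vec, 'n) vec" and w
    using block_matrix_mult_pair[of "mat 1" a' 0 "mat 1" "vec_left w" "vec_right w"]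
    by (simp add: vec_pair_eta)
  then have "g \<in> K"
    using av by (intro K_memI[OF g(1), of "block_matrix (mat 1) (- a) 0 (mat 1)"])
      (auto simp: g(2) block_matrix_mult mat_1_eq_block lattice_W_eq intro: box_at_add box_at_diff)
  then show ?thesis
    using g(3) by (auto simp: chi_def)
qed

lemma levi_K:
  assumes inv: "m ** m' = mat 1"
    and m: "\<And>i j. absv (m $ i $ j) \<le> 1" "\<And>i j. absv (m $ i $ j * delta j) \<le> absv (delta i)"
    and m': "\<And>i j. absv (m' $ i $ j) \<le> 1" "\<And>i j. absv (m' $ i $ j * delta j) \<le> absv (delta i)"
  shows "\<exists>g\<in>K. \<exists>\<kappa>. \<kappa> \<noteq> 0 \<and> (\<forall>\<phi>\<in>schwartz. A g \<phi> = (\<lambda>y. \<kappa> * \<phi> (m *v y)))"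
proof -
  have inv': "m' ** m = mat 1"
    using inv matrix_left_right_inverse by blast
  then have tinv: "transpose m ** transpose m' = mat 1"
    by (metis matrix_transpose_mul transpose_mat)
  obtain g \<kappa> where g: "g \<in> carrier Mp" "p g = block_matrix (transpose m) 0 0 m'" "\<kappa> \<noteq> 0"
    "\<And>\<phi>. \<phi> \<in> schwartz \<Longrightarrow> A g \<phi> = (\<lambda>y. \<kappa> * \<phi> (m *v y))"
    using levi_lift[OF tinv] unfolding transpose_transpose by blast
  have box1: "transpose b *v x \<in> box_at (\<lambda>_. 1)" if "x \<in> box_at (\<lambda>_. 1)" "\<And>i j. absv (b $ i $ j) \<le> 1"
    for b :: "(('a, 'n) vec, 'n) vec" and x
    unfolding in_box_at_iff matrix_vector_mult_def vec_lambda_beta transpose_def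
    using that by (auto intro!: absv_sum_le simp: in_box_at_iff absv_mult mult_le_one)
  have box2: "b *v x \<in> box_at delta" if "x \<in> box_at delta"
      "\<And>i j. absv (b $ i $ j * delta j) \<le> absv (delta i)"
    for b :: "(('a, 'n) vec, 'n) vec" and x
    unfolding in_box_at_iff matrix_vector_mult_def vec_lambda_beta
  proof (intro allI absv_sum_le)
    fix i j
    have "absv (b $ i $ j) * absv (x $ j) \<le> absv (b $ i $ j) * absv (delta j)"
      using that by (intro mult_left_mono) (auto simp: in_box_at_iff)
    also have "\<dots> \<le> absv (delta i)"
      using that by (simp flip: absv_mult)
    finally show "absv (b $ i $ j * x $ j) \<le> absv (delta i)"
      by (simp add: absv_mult)
  qed simp
  have blk: "block_matrix b 0 0 d *v w = vec_pair (b *v vec_left w) (d *v vec_right w)"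
    for b d :: "(('a, 'n) vec, 'n) vec" and w
    using block_matrix_mult_pair[of b 0 0 d "vec_left w" "vec_right w"]
    by (simp add: vec_pair_eta)
  have "g \<in> K"
  proof (rule K_memI[OF g(1)])
    show "p g ** block_matrix (transpose m') 0 0 m = mat 1"
      by (simp add: g(2) block_matrix_mult tinv inv' mat_1_eq_block)
    show "p g *v w \<in> lattice_W \<pi> r" if "w \<in> lattice_W \<pi> r" for w
      using that box1[OF _ m(1)] box2[OF _ m'(2)]
      by (simp add: g(2) blk lattice_W_eq del: transpose_matrix_vector)
    show "block_matrix (transpose m') 0 0 m *v w \<in> lattice_W \<pi> r" if "w \<in> lattice_W \<pi> r" for w
      using that box1[OF _ m'(1)] box2[OF _ m(2)]
      by (simp add: blk lattice_W_eq del: transpose_matrix_vector)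
  qed
  then show ?thesis
    using g(3,4) by blast
qed

lemma reflection_K: "\<exists>g\<in>K. \<exists>\<kappa>. \<kappa> \<noteq> 0 \<and> (\<forall>\<phi>\<in>schwartz. A g \<phi> = (\<lambda>y. \<kappa> * \<phi> (- y)))"
proof -
  have "absv ((- mat 1 :: (('a, 'n) vec, 'n) vec) $ i $ j) \<le> 1"
    "absv ((- mat 1 :: (('a, 'n) vec, 'n) vec) $ i $ j * delta j) \<le> absv (delta i)" for i j
    by (simp_all add: mat_def)
  then show ?thesis
    using levi_K[of "- mat 1" "- mat 1"] by simp
qed

section \<open>Unipotent characters separate points up to sign\<close>

text \<open>
  The factors \<open>y - y'\<close> and \<open>y + y'\<close> of the difference add up to \<open>2 * y\<close>. The square of the
  smaller one is at most the absolute value of \<open>4 * d\<close>, hence less than that of the square of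
  \<open>2 * y\<close>; therefore the larger factor has the absolute value of \<open>2 * y\<close>, which improves the bound
  for the smaller one.
\<close>

lemma absv_square_separation:
  fixes y y' d :: 'a
  assumes "absv (y\<^sup>2 - y'\<^sup>2) \<le> absv (4 * d)" "absv d < absv y ^ 2"
  shows "absv (y - y') * absv y \<le> absv (2 * d) \<or> absv (y + y') * absv y \<le> absv (2 * d)"
proof -
  have key: "absv u * absv y \<le> absv (2 * d)"
    if uv: "absv (u * v) \<le> absv (4 * d)" "u + v = 2 * y" "absv u \<le> absv v" for u v
  proof -
    have "absv u ^ 2 \<le> absv (u * v)"
      using that(3) by (simp add: absv_mult power2_eq_square mult_left_mono)
    also have "\<dots> \<le> absv (4 * d)"
      by (rule uv)
    also have "\<dots> = absv (2::'a) ^ 2 * absv d"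
      by (simp add: power2_eq_square flip: absv_mult)
    also have "\<dots> < absv (2::'a) ^ 2 * absv y ^ 2"
      using assms(2) by simp
    also have "\<dots> = absv (2 * y) ^ 2"
      by (simp add: absv_mult power_mult_distrib)
    finally have "absv (- u) < absv (2 * y)"
      using power2_less_imp_less by fastforce
    then have "absv (- u + 2 * y) = absv (2 * y)"
      by (rule absv_add_dominant)
    moreover have "v = - u + 2 * y"
      using uv(2) by (simp add: algebra_simps)
    ultimately have "absv v = absv (2 * y)"
      by simp
    then have "absv (u * v) = absv (2::'a) * (absv u * absv y)"
      by (simp add: absv_mult)
    moreover have "absv (4 * d) = absv (2::'a) * absv (2 * d)"
      by (simp flip: absv_mult)
    ultimately have "absv (2::'a) * (absv u * absv y) \<le> absv (2::'a) * absv (2 * d)"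
      using uv(1) by simp
    moreover have "0 < absv (2::'a)"
      by simp
    ultimately show ?thesis
      using mult_le_cancel_left_pos by blast
  qed
  have "y\<^sup>2 - y'\<^sup>2 = (y - y') * (y + y')"
    by (simp add: power2_eq_square algebra_simps)
  then show ?thesis
    using key[of "y - y'" "y + y'"] key[of "y + y'" "y - y'"] assms(1)
    by (cases "absv (y - y') \<le> absv (y + y')") (auto simp: mult.commute)
qed

definition same_chi :: "('a, 'n) vec \<Rightarrow> ('a, 'n) vec \<Rightarrow> bool" where
  "same_chi y y' \<longleftrightarrow> (\<forall>a\<in>unipotents. chi a y = chi a y')"

text \<open>
  The set \<open>unipotents\<close> is closed under multiplication by integers, so the conductor of \<open>\<psi>\<close> bounds
  the difference of the exponents.
\<close>

lemma same_chi_quadratic: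
  assumes "same_chi y y'" "a \<in> unipotents"
  shows "absv (dot y (a *v y) - dot y' (a *v y')) \<le> absv (4::'a)"
proof (rule absv_le_4_if_psi_trivial)
  fix t :: 'a
  assume t: "absv t \<le> 1"
  define b :: "(('a, 'n) vec, 'n) vec" where "b = (\<chi> i j. t * a $ i $ j)"
  have b: "b *v x = t *s (a *v x)" for x
    by (simp add: b_def matrix_vector_mult_def vec_eq_iff sum_distrib_left mult.assoc)
  have "absv (t * (a $ i $ j * delta j)) \<le> 1" for i j
    using assms(2) t unfolding absv_mult[of t] by (intro mult_le_one) (auto simp: unipotents_def)
  then have "b \<in> unipotents"
    using assms(2) by (auto simp: unipotents_def b_def transpose_def vec_eq_iff mult.assoc)
  then have "chi b y = chi b y'"
    using assms(1) by (simp add: same_chi_def)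
  then have "\<psi> (t * dot y (a *v y)) = \<psi> (t * dot y' (a *v y'))"
    by (simp add: chi_def b)
  then show "\<psi> (t * (dot y (a *v y) - dot y' (a *v y'))) = 1"
    by (simp add: right_diff_distrib psi_diff)
qed

lemma same_chi_square:
  assumes "same_chi y y'"
  shows "absv ((y $ i)\<^sup>2 - (y' $ i)\<^sup>2) \<le> absv (4 * delta i)"
proof -
  define a :: "(('a, 'n) vec, 'n) vec" where
    "a = (\<chi> k l. if k = i \<and> l = i then inverse (delta i) else 0)"
  have a: "a *v x = axis i (x $ i / delta i)" for x
    by (auto simp: a_def matrix_vector_mult_def vec_eq_iff axis_def divide_inverse
        if_distrib if_distribR cong: if_cong)
  have "a \<in> unipotents"
    by (auto simp: unipotents_def a_def transpose_def vec_eq_iff)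
  from same_chi_quadratic[OF assms this]
  have "absv (((y $ i)\<^sup>2 - (y' $ i)\<^sup>2) / delta i) \<le> absv (4::'a)"
    by (simp add: a power2_eq_square diff_divide_distrib)
  then show ?thesis
    by (simp add: absv_simps divide_le_eq)
qed

lemma same_chi_product:
  fixes \<eta> :: 'a
  assumes "same_chi y y'" "i \<noteq> j" "\<eta> \<noteq> 0" "absv (delta i) \<le> absv \<eta>" "absv (delta j) \<le> absv \<eta>"
  shows "absv (y $ i * y $ j - y' $ i * y' $ j) \<le> absv (2 * \<eta>)"
proof -
  define a :: "(('a, 'n) vec, 'n) vec" where
    "a = (\<chi> k l. if k = i \<and> l = j \<or> k = j \<and> l = i then inverse \<eta> else 0)"
  have a: "a *v x = axis i (x $ j / \<eta>) + axis j (x $ i / \<eta>)" for x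
  proof -
    have "(if k = i \<and> l = j \<or> k = j \<and> l = i then inverse \<eta> else 0) * x $ l =
        (if l = j then if k = i then x $ j / \<eta> else 0 else 0) +
        (if l = i then if k = j then x $ i / \<eta> else 0 else 0)" for k l
      using assms(2) by (auto simp: divide_inverse)
    then show ?thesis
      by (auto simp: a_def matrix_vector_mult_def vec_eq_iff axis_def sum.distrib)
  qed
  have "a \<in> unipotents"
    using assms by (auto simp: unipotents_def a_def transpose_def vec_eq_iff absv_simps field_simps)
  from same_chi_quadratic[OF assms(1) this]
  have "absv (2 * ((y $ i * y $ j - y' $ i * y' $ j) / \<eta>)) \<le> absv (2 * 2::'a)"
    by (simp add: a algebra_simps diff_divide_distrib)
  then have "absv ((y $ i * y $ j - y' $ i * y' $ j) / \<eta>) \<le> absv (2::'a)"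
    unfolding absv_mult by simp
  then show ?thesis
    using assms(3) by (simp add: absv_simps divide_le_eq)
qed

lemma same_chi_sym: "same_chi y y' \<Longrightarrow> same_chi y' y"
  by (simp add: same_chi_def)

lemma same_chi_minus: "same_chi y (- y') \<longleftrightarrow> same_chi y y'"
  by (simp add: same_chi_def chi_def)

text \<open>
  The coordinates in which the support at level \<open>k\<close> exceeds the inner box. A point outside the
  inner box has maximal absolute value in one of them, and these are the coordinates at
  which separation and transitivity start.
\<close>

definition critical :: "nat \<Rightarrow> 'n \<Rightarrow> bool" where
  "critical k i \<longleftrightarrow> absv (inner_radius k i) < absv (radius k i)"

lemma critical_cases:
  assumes "critical k i"
  obtains R where "even k" "delta i = \<pi>" "1 \<le> absv R" "\<And>j. radius k j = R"
  | R where "odd k" "delta i = 1" "1 < absv R" "\<And>j. radius k j = R * delta j"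
proof (cases "even k")
  case True
  then have "absv (radius k i) * absv (delta i) < absv (radius k i)"
    using assms by (simp add: critical_def inner_radius_def absv_mult)
  then have "delta i = \<pi>"
    by (auto simp: delta_def split: if_splits)
  then show thesis
    using True one_le_absv_inverse_power that(1)[of "inverse (\<pi> ^ (k div 2))"]
    by (simp add: radius_def)
next
  case False
  then have "absv (radius k i) * absv (\<pi> / delta i) < absv (radius k i) * 1"
    using assms unfolding absv_mult[symmetric] by (simp add: critical_def inner_radius_def)
  then have "absv (\<pi> / delta i) < 1"
    using mult_less_cancel_left_pos[of "absv (radius k i)" "absv (\<pi> / delta i)" 1] by simp
  then have "delta i = 1"
    by (auto simp: delta_def split: if_splits)
  moreover have "1 < absv (inverse (\<pi> ^ (Suc k div 2)))"
  proof -
    have "Suc k div 2 \<noteq> 0"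
      using False by (auto elim!: oddE)
    then have "absv \<pi> ^ (Suc k div 2) < 1"
      using absv_pi_less by (simp add: power_less_one_iff)
    then show ?thesis
      by (simp add: absv_simps one_less_inverse)
  qed
  ultimately show thesis
    using False that(2)[of "inverse (\<pi> ^ (Suc k div 2))"] by (simp add: radius_def)
qed

lemma critical_delta: "critical k i \<Longrightarrow> absv (delta i) < absv (radius k i) ^ 2"
proof (erule critical_cases)
  fix R :: 'a
  assume R: "delta i = \<pi>" "1 \<le> absv R" "\<And>j. radius k j = R"
  then have "1 \<le> absv R ^ 2"
    by simp
  then show ?thesis
    using R absv_pi_less by (simp add: less_le_trans)
next
  fix R :: 'a
  assume "delta i = 1" "1 < absv R" "\<And>j. radius k j = R * delta j"
  then show ?thesis
    by simp
qed

lemma critical_radius: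
  "critical k i \<Longrightarrow> absv (radius k j) \<le> absv (radius k i)"
  "critical k i \<Longrightarrow> absv (radius k j) * absv (delta i) \<le> absv (radius k i) * absv (delta j)"
  using absv_pi_le_delta[of j]
  by (auto elim!: critical_cases simp: absv_mult mult_left_le mult_left_mono)

text \<open>
  The radius and the inner radius differ by a unit or a uniformizer, so no absolute value lies
  strictly between theirs.
\<close>

lemma absv_eq_radius:
  fixes x :: 'a
  assumes "absv x \<le> absv (radius k i)" "absv (inner_radius k i) < absv x"
  shows "critical k i" "absv x = absv (radius k i)"
proof -
  show crit: "critical k i"
    using assms by (simp add: critical_def)
  have inner: "absv (inner_radius k i) = absv (radius k i) * absv \<pi>"
    using crit by (auto elim!: critical_cases simp: inner_radius_def absv_mult)
  show "absv x = absv (radius k i)"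
  proof (rule ccontr)
    assume "absv x \<noteq> absv (radius k i)"
    then have "absv (x / radius k i) < 1"
      using assms(1) by (simp add: absv_divide)
    then have "absv (x / radius k i) \<le> absv \<pi>"
      by (rule absv_le_pi)
    then show False
      using assms(2) by (simp add: inner absv_divide divide_le_eq mult.commute)
  qed
qed

lemma exists_critical:
  assumes "y \<in> box_at (radius k)" "y \<notin> box_at (inner_radius k)"
  shows "\<exists>i. critical k i \<and> absv (y $ i) = absv (radius k i)"
proof -
  obtain i where i: "absv (inner_radius k i) < absv (y $ i)"
    using assms(2) by (auto simp: in_box_at_iff not_le)
  moreover have "absv (y $ i) \<le> absv (radius k i)"
    using assms(1) by (simp add: in_box_at_iff)
  ultimately show ?thesis
    using absv_eq_radius by blast
qed

text \<open>
  The coordinate \<open>i\<close> is controlled by the last assumption. For another coordinate \<open>j\<close>, use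
  \<open>y\<^sub>i (y\<^sub>j - y'\<^sub>j) = (y\<^sub>i y\<^sub>j - y'\<^sub>i y'\<^sub>j) - (y\<^sub>i - y'\<^sub>i) y'\<^sub>j\<close>: the characters bound
  the first difference on the right, and division by the large \<open>y\<^sub>i\<close> gives the period.
\<close>

lemma separation_same_sign:
  assumes crit: "critical k i" "absv (y $ i) = absv (radius k i)"
    and y: "y \<in> box_at (radius k)" and y': "y' \<in> box_at (radius k)" and same: "same_chi y y'"
    and i: "absv (y $ i - y' $ i) * absv (y $ i) \<le> absv (2 * delta i)"
  shows "y - y' \<in> box_at (period k)"
  unfolding in_box_at_iff
proof
  fix j
  have pos: "0 < absv (radius k i)" "0 < absv (radius k j)"
    by simp_all
  have di: "absv (y $ i - y' $ i) \<le> absv (2 * delta i) / absv (radius k i)"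
    using i crit(2) by (simp add: le_divide_eq)
  show "absv ((y - y') $ j) \<le> absv (period k j)"
  proof (cases "j = i")
    case True
    then show ?thesis
      using di by (simp add: period_def absv_divide)
  next
    case False
    note rad = critical_radius[OF crit(1), of j]
    obtain \<eta> :: 'a where \<eta>: "\<eta> \<noteq> 0" "absv (delta i) \<le> absv \<eta>" "absv (delta j) \<le> absv \<eta>"
      "absv \<eta> * absv (radius k j) \<le> absv (delta j) * absv (radius k i)"
    proof (cases "absv (delta i) \<le> absv (delta j)")
      case True
      then show thesis
        using rad(1) by (intro that[of "delta j"]) (auto intro: mult_left_mono)
    next
      case False
      then show thesis
        using rad(2) by (intro that[of "delta i"]) (auto simp: mult.commute)
    qed
    have bound: "absv (radius k i) * absv (period k j) = absv (2::'a) * (absv (delta j) * absv (radius k i)) / absv (radius k j)"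
      by (simp add: period_def absv_simps)
    have "absv (y $ i * y $ j - y' $ i * y' $ j) \<le> absv (2 * \<eta>)"
      using same False \<eta> by (intro same_chi_product) auto
    also have "\<dots> = absv (2::'a) * (absv \<eta> * absv (radius k j)) / absv (radius k j)"
      by (simp add: absv_mult)
    also have "\<dots> \<le> absv (radius k i) * absv (period k j)"
      unfolding bound using \<eta>(4) by (intro divide_right_mono mult_left_mono) auto
    finally have 1: "absv (y $ i * y $ j - y' $ i * y' $ j) \<le> absv (radius k i) * absv (period k j)" .
    have "absv ((y $ i - y' $ i) * y' $ j) \<le> absv (2 * delta i) / absv (radius k i) * absv (radius k j)"
      unfolding absv_mult[of "y $ i - y' $ i"] using di y' by (intro mult_mono) (auto simp: in_box_at_iff)
    also have "\<dots> = absv (2::'a) * (absv (radius k j) * absv (delta i) * absv (radius k j)) /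
        (absv (radius k i) * absv (radius k j))"
      by (simp add: absv_mult)
    also have "\<dots> \<le> absv (2::'a) * (absv (radius k i) * absv (delta j) * absv (radius k i)) /
        (absv (radius k i) * absv (radius k j))"
      by (intro divide_right_mono mult_left_mono mult_mono[OF rad(2) rad(1)]) auto
    also have "\<dots> = absv (radius k i) * absv (period k j)"
      unfolding bound by (simp add: field_simps)
    finally have 2: "absv ((y $ i - y' $ i) * y' $ j) \<le> absv (radius k i) * absv (period k j)" .
    have "y $ i * (y $ j - y' $ j) = (y $ i * y $ j - y' $ i * y' $ j) - (y $ i - y' $ i) * y' $ j"
      by (simp add: algebra_simps)
    then have "absv (y $ i * (y $ j - y' $ j)) \<le> absv (radius k i) * absv (period k j)"
      using absv_diff_le[OF 1 2] by simp
    then have "absv (radius k i) * absv (y $ j - y' $ j) \<le> absv (radius k i) * absv (period k j)"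
      using crit(2) by (simp add: absv_mult)
    then show ?thesis
      using pos(1) mult_le_cancel_left_pos by simp
  qed
qed

lemma separation:
  assumes y: "y \<in> box_at (radius k)" "y \<notin> box_at (inner_radius k)" and y': "y' \<in> box_at (radius k)"
    and same: "same_chi y y'"
  shows "y - y' \<in> box_at (period k) \<or> y + y' \<in> box_at (period k)"
proof -
  obtain i where i: "critical k i" "absv (y $ i) = absv (radius k i)"
    using exists_critical y by blast
  have "absv (y $ i - y' $ i) * absv (y $ i) \<le> absv (2 * delta i) \<or>
      absv (y $ i + y' $ i) * absv (y $ i) \<le> absv (2 * delta i)"
    using same_chi_square[OF same] critical_delta[OF i(1)] i(2)
    by (intro absv_square_separation) auto
  then show ?thesis
    using separation_same_sign[OF i y(1) y' same] separation_same_sign[OF i y(1), of "- y'"] same y'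
    by (auto simp: same_chi_minus)
qed

text \<open>
  In the smallest space, the characters separate also the points of the sublattice
  \<open>box_at delta\<close>; for these, \<open>y\<close> and \<open>- y\<close> have the same class.
\<close>

lemma separation_0:
  assumes y: "y \<in> box_at (radius 0)" and y': "y' \<in> box_at (radius 0)" and same: "same_chi y y'"
  shows "y - y' \<in> box_at (period 0) \<or> y + y' \<in> box_at (period 0)"
proof -
  consider "y \<notin> box_at (inner_radius 0)" | "y' \<notin> box_at (inner_radius 0)" |
    "y \<in> box_at (inner_radius 0)" "y' \<in> box_at (inner_radius 0)"
    by blast
  then show ?thesis
  proof cases
    case 1
    then show ?thesis
      using separation y y' same by blast
  next
    case 2
    then have "y' - y \<in> box_at (period 0) \<or> y' + y \<in> box_at (period 0)"
      using separation y y' same_chi_sym[OF same] by blast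
    then show ?thesis
      using box_at_minus[of "y' - y" "period 0"] by (auto simp: add.commute simp del: box_at_minus)
  next
    case 3
    have "absv (y $ i - y' $ i) \<le> absv (2 * delta i)" for i
    proof (rule ccontr)
      \<comment> \<open>Otherwise the sum of the coordinates has the same absolute value as their difference
        \<open>u\<close>, so the square of \<open>u / 2\<close> is bounded by \<open>delta i\<close>, and \<open>u / 2\<close> is larger than
        \<open>delta i\<close>. This is impossible because \<open>delta i\<close> is \<open>1\<close> or a uniformizer.\<close>
      define u where "u = y $ i - y' $ i"
      assume "\<not> absv (y $ i - y' $ i) \<le> absv (2 * delta i)"
      then have u: "absv (2 * delta i) < absv u"
        by (simp add: u_def)
      have "absv (2::'a) * absv (y $ i) \<le> absv (2::'a) * absv (delta i)"
        using 3(1) by (intro mult_left_mono) (auto simp: in_box_at_iff inner_radius_0)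
      then have "absv (2 * y $ i) < absv (- u)"
        using u unfolding absv_minus absv_mult by linarith
      then have "absv (2 * y $ i + - u) = absv (- u)"
        by (rule absv_add_dominant)
      moreover have "y $ i + y' $ i = 2 * y $ i + - u"
        by (simp add: u_def)
      ultimately have "absv (y $ i + y' $ i) = absv u"
        by simp
      moreover have "(y $ i)\<^sup>2 - (y' $ i)\<^sup>2 = u * (y $ i + y' $ i)"
        by (simp add: u_def power2_eq_square algebra_simps)
      ultimately have "absv u * absv u \<le> absv (4 * delta i)"
        using same_chi_square[OF same, of i] by (simp add: absv_mult)
      then have "absv (u / 2 * (u / 2)) \<le> absv (delta i)"
        by (simp add: absv_simps divide_le_eq) (simp add: mult.commute flip: absv_mult)
      then have le: "absv (u / 2) * absv (u / 2) \<le> absv (delta i)"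
        by (simp only: absv_mult)
      have gt: "absv (delta i) < absv (u / 2)"
        using u by (simp add: absv_simps field_simps)
      have "1 \<le> absv (u / 2)"
        using gt absv_le_pi[of "u / 2"] absv_pi_le_delta[of i] by linarith
      then have "absv (u / 2) * 1 \<le> absv (u / 2) * absv (u / 2)"
        by (intro mult_left_mono) auto
      then show False
        using le gt by linarith
    qed
    then show ?thesis
      by (simp add: in_box_at_iff period_def radius_def)
  qed
qed

text \<open>
  At these points of the support, the unipotent characters separate the class up to sign from all
  other classes; see \<open>good_separation\<close> below.
\<close>

definition good :: "nat \<Rightarrow> ('a, 'n) vec \<Rightarrow> bool" where
  "good k y \<longleftrightarrow> y \<in> box_at (radius k) \<and> (k = 0 \<or> y \<notin> box_at (inner_radius k))"

definition near :: "nat \<Rightarrow> ('a, 'n) vec \<Rightarrow> ('a, 'n) vec set" where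
  "near k y = {z. z - y \<in> box_at (period k) \<or> z + y \<in> box_at (period k)}"

lemma good_separation:
  assumes "good k y" "z \<in> box_at (radius k)" "same_chi y z"
  shows "z \<in> near k y"
proof -
  have "y - z \<in> box_at (period k) \<or> y + z \<in> box_at (period k)"
    using assms separation separation_0 by (cases "k = 0") (auto simp: good_def)
  then show ?thesis
    using box_at_minus[of "y - z" "period k"] by (simp add: near_def add.commute del: box_at_minus)
qed

section \<open>Transitivity on points with a common critical coordinate\<close>

text \<open>
  With \<open>v = (y' - y) / y\<^sub>i\<close>, the map \<open>z \<mapsto> z + z\<^sub>i v\<close> sends \<open>y\<close> to \<open>y'\<close>. The bounds at a critical
  coordinate say that it preserves both lattices, and so does its inverse, which is the map of
  the same form with \<open>y\<close> and \<open>y'\<close> exchanged.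
\<close>

lemma levi_transport:
  assumes crit: "critical k i" and y: "y \<in> box_at (radius k)" "absv (y $ i) = absv (radius k i)"
    and y': "y' \<in> box_at (radius k)" "absv (y' $ i) = absv (radius k i)"
  shows "\<exists>g\<in>K. \<exists>\<kappa> m. \<kappa> \<noteq> 0 \<and> (\<forall>\<phi>\<in>schwartz. A g \<phi> = (\<lambda>z. \<kappa> * \<phi> (m *v z))) \<and> m *v y = y'"
proof -
  define T :: "('a, 'n) vec \<Rightarrow> ('a, 'n) vec \<Rightarrow> (('a, 'n) vec, 'n) vec" where
    "T x x' = (\<chi> j l. (if j = l then 1 else 0) + (if l = i then (x' $ j - x $ j) / x $ i else 0))"
    for x x'
  have Tv: "T x x' *v z = (\<chi> j. z $ j + z $ i * ((x' $ j - x $ j) / x $ i))" for x x' z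
  proof -
    have "(\<Sum>l\<in>UNIV. T x x' $ j $ l * z $ l) =
        (\<Sum>l\<in>UNIV. if j = l then z $ l else 0) + (\<Sum>l\<in>UNIV. if l = i then z $ l * ((x' $ j - x $ j) / x $ i) else 0)"
      for j
      unfolding sum.distrib[symmetric] T_def by (intro sum.cong) (auto simp: algebra_simps)
    then show ?thesis
      by (simp add: matrix_vector_mult_def vec_eq_iff)
  qed
  have nz: "y $ i \<noteq> 0" "y' $ i \<noteq> 0"
    using y(2) y'(2) by (metis absv_0 absv_eq_0_iff radius_nonzero)+
  have "T y y' *v (T y' y *v z) = z" for z
    using nz by (auto simp: Tv vec_eq_iff field_simps)
  then have inv: "T y y' ** T y' y = mat 1"
    by (simp add: matrix_eq matrix_vector_mul_assoc)
  have bounds: "absv (T x x' $ j $ l) \<le> 1" "absv (T x x' $ j $ l * delta l) \<le> absv (delta j)"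
    if x: "x \<in> box_at (radius k)" "x' \<in> box_at (radius k)" "absv (x $ i) = absv (radius k i)" for x x' j l
  proof -
    have d: "absv (x' $ j - x $ j) \<le> absv (radius k j)"
      using x by (intro absv_diff_le) (auto simp: in_box_at_iff)
    then have v: "absv ((x' $ j - x $ j) / x $ i) \<le> 1"
      using critical_radius(1)[OF crit, of j] x(3) by (simp add: absv_divide divide_le_eq)
    then show "absv (T x x' $ j $ l) \<le> 1"
      unfolding T_def vec_lambda_beta by (intro absv_add_le) auto
    have "absv (x' $ j - x $ j) * absv (delta i) \<le> absv (radius k j) * absv (delta i)"
      using d by (intro mult_right_mono) auto
    also have "\<dots> \<le> absv (radius k i) * absv (delta j)"
      by (rule critical_radius(2)[OF crit])
    finally have "absv ((x' $ j - x $ j) / x $ i * delta i) \<le> absv (delta j)"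
      using x(3) by (simp add: absv_simps divide_le_eq mult.commute)
    then show "absv (T x x' $ j $ l * delta l) \<le> absv (delta j)"
      unfolding T_def vec_lambda_beta distrib_right by (intro absv_add_le) auto
  qed
  obtain g \<kappa> where "g \<in> K" "\<kappa> \<noteq> 0" "\<forall>\<phi>\<in>schwartz. A g \<phi> = (\<lambda>z. \<kappa> * \<phi> (T y y' *v z))"
    using levi_K[OF inv bounds[OF y(1) y'(1) y(2)] bounds[OF y'(1) y(1) y'(2)]] by blast
  moreover have "T y y' *v y = y'"
    using nz by (simp add: Tv vec_eq_iff)
  ultimately show ?thesis
    by blast
qed

section \<open>Invariant subspaces between consecutive levels\<close>

definition fun_subspace :: "(('a, 'n) vec \<Rightarrow> complex) set \<Rightarrow> bool" where
  "fun_subspace U \<longleftrightarrow> U \<subseteq> schwartz \<and> (\<lambda>y. 0) \<in> U \<and>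
     (\<forall>\<phi>\<in>U. \<forall>\<eta>\<in>U. (\<lambda>y. \<phi> y + \<eta> y) \<in> U) \<and> (\<forall>c. \<forall>\<phi>\<in>U. (\<lambda>y. c * \<phi> y) \<in> U)"

definition K_subspace :: "(('a, 'n) vec \<Rightarrow> complex) set \<Rightarrow> bool" where
  "K_subspace U \<longleftrightarrow> fun_subspace U \<and> (\<forall>g\<in>K. \<forall>\<phi>\<in>U. A g \<phi> \<in> U)"

text \<open>
  Encoding the sign as a number treats even (\<open>s = 1\<close>) and odd (\<open>s = - 1\<close>) functions at once.
\<close>

definition parity :: "complex \<Rightarrow> (('a, 'n) vec \<Rightarrow> complex) set \<Rightarrow> (('a, 'n) vec \<Rightarrow> complex) set" where
  "parity s U = {\<phi> \<in> U. \<forall>y. \<phi> (- y) = s * \<phi> y}"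

lemma fun_subspaceD:
  assumes "fun_subspace U"
  shows "\<phi> \<in> U \<Longrightarrow> \<phi> \<in> schwartz" "(\<lambda>y. 0) \<in> U"
    "\<phi> \<in> U \<Longrightarrow> \<eta> \<in> U \<Longrightarrow> (\<lambda>y. \<phi> y + \<eta> y) \<in> U" "\<phi> \<in> U \<Longrightarrow> (\<lambda>y. c * \<phi> y) \<in> U"
    "\<phi> \<in> U \<Longrightarrow> \<eta> \<in> U \<Longrightarrow> (\<lambda>y. \<phi> y - \<eta> y) \<in> U"
proof -
  show 1: "\<phi> \<in> U \<Longrightarrow> \<phi> \<in> schwartz" "(\<lambda>y. 0) \<in> U"
    and 2: "\<phi> \<in> U \<Longrightarrow> \<eta> \<in> U \<Longrightarrow> (\<lambda>y. \<phi> y + \<eta> y) \<in> U" "\<phi> \<in> U \<Longrightarrow> (\<lambda>y. c * \<phi> y) \<in> U"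
    for \<phi> \<eta> c
    using assms by (auto simp: fun_subspace_def)
  show "(\<lambda>y. \<phi> y - \<eta> y) \<in> U" if "\<phi> \<in> U" "\<eta> \<in> U"
    using 2(1)[OF that(1) 2(2)[OF that(2), of "- 1"]] by simp
qed

lemma K_subspaceD:
  assumes "K_subspace U"
  shows "fun_subspace U" "g \<in> K \<Longrightarrow> \<phi> \<in> U \<Longrightarrow> A g \<phi> \<in> U"
  using assms by (auto simp: K_subspace_def)

lemma fun_subspace_schwartz: "fun_subspace schwartz"
  by (auto simp: fun_subspace_def intro: schwartz_add schwartz_smult)

lemma fun_subspace_supp_inv: "fun_subspace (supp_inv a b)"
  unfolding fun_subspace_def
proof (intro conjI ballI allI)
  fix \<phi> \<eta>
  assume \<phi>: "\<phi> \<in> supp_inv a b" and \<eta>: "\<eta> \<in> supp_inv a b"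
  have "y \<in> box_at a" if "\<phi> y + \<eta> y \<noteq> 0" for y
  proof -
    have "\<phi> y \<noteq> 0 \<or> \<eta> y \<noteq> 0"
      using that by auto
    then show ?thesis
      using \<phi> \<eta> by (auto simp: supp_inv_def)
  qed
  then show "(\<lambda>y. \<phi> y + \<eta> y) \<in> supp_inv a b"
    using \<phi> \<eta> by (auto simp: supp_inv_def schwartz_add)
qed (auto simp: supp_inv_def schwartz_smult)

lemma fun_subspace_parity: "fun_subspace U \<Longrightarrow> fun_subspace (parity s U)"
  by (auto simp: fun_subspace_def parity_def algebra_simps)

lemma fun_subspace_Int: "fun_subspace U \<Longrightarrow> fun_subspace V \<Longrightarrow> fun_subspace (U \<inter> V)"
  by (auto simp: fun_subspace_def)

lemma fun_subspace_level: "fun_subspace (level k)"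
  by (simp add: level_def fun_subspace_supp_inv)

lemma A_parity: "g \<in> carrier Mp \<Longrightarrow> \<phi> \<in> parity s schwartz \<Longrightarrow> A g \<phi> \<in> parity s schwartz"
proof -
  assume g: "g \<in> carrier Mp" and "\<phi> \<in> parity s schwartz"
  then have \<phi>: "\<phi> \<in> schwartz" "(\<lambda>y. \<phi> (- y)) = (\<lambda>y. s * \<phi> y)"
    by (auto simp: parity_def)
  have "(\<lambda>y. A g \<phi> (- y)) = (\<lambda>y. s * A g \<phi> y)"
    using A_reflect[OF g \<phi>(1)] A_smult[OF g \<phi>(1), of s] by (simp add: \<phi>(2))
  then show ?thesis
    using A_closed[OF g \<phi>(1)] by (simp add: parity_def fun_eq_iff)
qed

lemma K_subspace_parity_level: "K_subspace (parity s (level k))"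
proof -
  have "A g \<phi> \<in> parity s (level k)" if "g \<in> K" "\<phi> \<in> parity s (level k)" for g \<phi>
  proof -
    have "A g \<phi> \<in> level k"
      using A_level that by (auto simp: parity_def)
    moreover have "A g \<phi> \<in> parity s schwartz"
      using that K_carrier level_schwartz by (intro A_parity) (auto simp: parity_def)
    ultimately show ?thesis
      by (simp add: parity_def)
  qed
  then show ?thesis
    by (simp add: K_subspace_def fun_subspace_parity fun_subspace_level)
qed

lemma K_subspace_chi:
  assumes "K_subspace U" "\<phi> \<in> U" "a \<in> unipotents"
  shows "(\<lambda>y. chi a y * \<phi> y) \<in> U"
proof -
  obtain g where g: "g \<in> K" "\<And>\<phi>. \<phi> \<in> schwartz \<Longrightarrow> A g \<phi> = (\<lambda>y. chi a y * \<phi> y)"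
    using unipotent_K[OF assms(3)] by blast
  have "\<phi> \<in> schwartz"
    using fun_subspaceD(1)[OF K_subspaceD(1)[OF assms(1)] assms(2)] .
  then show ?thesis
    using K_subspaceD(2)[OF assms(1) g(1) assms(2)] g(2) by simp
qed

lemma level_periodic:
  assumes "\<phi> \<in> level k" "z - y \<in> box_at (period k)"
  shows "\<phi> z = \<phi> y"
proof -
  have "\<phi> (y + (z - y)) = \<phi> y"
    using assms unfolding level_def supp_inv_def by blast
  then show ?thesis
    by simp
qed

lemma level_support: "\<phi> \<in> level k \<Longrightarrow> \<phi> y \<noteq> 0 \<Longrightarrow> y \<in> box_at (radius k)"
  by (auto simp: level_def supp_inv_def)

lemma period_cover: "\<exists>R. finite R \<and> (\<forall>y\<in>box_at (radius k). \<exists>x\<in>R. y - x \<in> box_at (period k))"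
  by (rule finite_residues_vec) simp

text \<open>
  A function that does not vanish at a good point \<open>y0\<close> yields a function supported in the
  class of \<open>y0\<close> up to sign: a point \<open>z\<close> of another class is separated from \<open>y0\<close> by some
  character \<open>chi a\<close>, and \<open>chi a \<phi> - chi a z \<phi>\<close> vanishes at \<open>z\<close> but not at \<open>y0\<close>.
\<close>

lemma exists_supported_in_class:
  assumes U: "K_subspace U" and u: "u \<in> U" "u \<in> level k" and y0: "good k y0" "u y0 \<noteq> 0"
  shows "\<exists>g\<in>U. g \<in> level k \<and> g y0 \<noteq> 0 \<and> (\<forall>z. g z \<noteq> 0 \<longrightarrow> z \<in> near k y0)"
proof -
  obtain R :: "('a, 'n) vec set"
    where R: "finite R" "\<And>y. y \<in> box_at (radius k) \<Longrightarrow> \<exists>x\<in>R. y - x \<in> box_at (period k)"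
    using period_cover[of k] by blast
  have "\<exists>g\<in>U. g \<in> level k \<and> g y0 \<noteq> 0 \<and>
      (\<forall>z. g z \<noteq> 0 \<longrightarrow> z \<in> near k y0 \<or> (\<forall>x\<in>R. z - x \<notin> box_at (period k)))"
    using R(1)
  proof (induction R rule: finite_induct)
    case empty
    then show ?case
      using u y0 by auto
  next
    case (insert x R)
    then obtain g where g: "g \<in> U" "g \<in> level k" "g y0 \<noteq> 0"
      "\<And>z. g z \<noteq> 0 \<Longrightarrow> z \<in> near k y0 \<or> (\<forall>x\<in>R. z - x \<notin> box_at (period k))"
      by blast
    show ?case
    proof (cases "\<exists>z. g z \<noteq> 0 \<and> z - x \<in> box_at (period k) \<and> z \<notin> near k y0")
      case False
      then show ?thesis
        using g by blast
    next
      case True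
      then obtain z where z: "g z \<noteq> 0" "z - x \<in> box_at (period k)" "z \<notin> near k y0"
        by blast
      have "\<not> same_chi y0 z"
        using good_separation[OF y0(1) level_support[OF g(2) z(1)]] z(3) by blast
      then obtain a where a: "a \<in> unipotents" "chi a y0 \<noteq> chi a z"
        by (auto simp: same_chi_def)
      define h where "h = (\<lambda>y. chi a y * g y)"
      define g' where "g' = (\<lambda>y. h y - chi a z * g y)"
      have "h \<in> U"
        unfolding h_def by (rule K_subspace_chi[OF U g(1) a(1)])
      moreover have lev: "h \<in> level k"
      proof -
        have "K_subspace (level k)"
          using A_level by (simp add: K_subspace_def fun_subspace_level)
        then show ?thesis
          unfolding h_def using K_subspace_chi[OF _ g(2) a(1)] by blast
      qed
      ultimately have "g' \<in> U" "g' \<in> level k"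
        unfolding g'_def using g K_subspaceD(1)[OF U] fun_subspaceD(4,5) fun_subspace_level by metis+
      moreover have "g' y0 \<noteq> 0"
        using a(2) g(3) by (simp add: g'_def h_def flip: left_diff_distrib)
      moreover have "g' z' = 0" if "z' - x \<in> box_at (period k)" for z'
      proof -
        have "(z' - x) - (z - x) \<in> box_at (period k)"
          using that z(2) by (rule box_at_diff)
        then have "h z' = h z" "g z' = g z"
          using level_periodic[OF lev] level_periodic[OF g(2)] by (simp_all add: algebra_simps)
        then show ?thesis
          by (simp add: g'_def h_def)
      qed
      moreover have "g z' \<noteq> 0" if "g' z' \<noteq> 0" for z'
        using that by (auto simp: g'_def h_def)
      ultimately show ?thesis
        using g(4) by (intro bexI[of _ g']) blast+
    qed
  qed
  then show ?thesis
    using R(2) level_support by blast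
qed

text \<open>
  Such a function \<open>\<phi>\<close> takes the value \<open>\<phi> y\<close> on the class of \<open>y\<close> and \<open>s * \<phi> y\<close> on the class of
  \<open>- y\<close>.
\<close>

lemma near_proportional:
  assumes "\<phi> \<in> parity s (level k)" "\<And>z. \<phi> z \<noteq> 0 \<Longrightarrow> z \<in> near k y"
    and "g \<in> parity s (level k)" "\<And>z. g z \<noteq> 0 \<Longrightarrow> z \<in> near k y" "g y \<noteq> 0"
  shows "\<phi> = (\<lambda>z. \<phi> y / g y * g z)"
proof
  fix z
  have val: "f z = (if z - y \<in> box_at (period k) then f y else s * f y)"
    if "f \<in> parity s (level k)" "z \<in> near k y" for f
  proof -
    have "f z = f (- y)" if "z + y \<in> box_at (period k)"
      using \<open>f \<in> _\<close> that level_periodic[of f k z "- y"] by (simp add: parity_def)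
    moreover have "f (- y) = s * f y"
      using \<open>f \<in> _\<close> by (simp add: parity_def)
    ultimately show ?thesis
      using that level_periodic[of f k z y] by (auto simp: parity_def near_def)
  qed
  show "\<phi> z = \<phi> y / g y * g z"
  proof (cases "z \<in> near k y")
    case True
    then show ?thesis
      using val[OF assms(1)] val[OF assms(3)] assms(5) by simp
  next
    case False
    then have "\<phi> z = 0" "g z = 0"
      using assms(2,4) by blast+
    then show ?thesis
      by simp
  qed
qed

lemma schwartz_cut:
  fixes \<phi> :: "('a, 'n) vec \<Rightarrow> complex"
  assumes "\<phi> \<in> schwartz" "\<And>i. d i \<noteq> 0" "\<And>y v. v \<in> box_at d \<Longrightarrow> y + v \<in> X \<longleftrightarrow> y \<in> X"
  shows "(\<lambda>y. if y \<in> X then \<phi> y else 0) \<in> schwartz"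
proof -
  obtain e :: 'a where e: "e \<noteq> 0" and sub: "(box_at (\<lambda>_. e) :: ('a, 'n) vec set) \<subseteq> box_at d"
    using exists_below[of d, OF assms(2)] by blast
  have "(\<lambda>y. (if y \<in> X then 1 else 0) * \<phi> y) \<in> schwartz"
    by (rule schwartz_mult_invariant[OF assms(1) e]) (use assms(3) sub in auto)
  moreover have "(\<lambda>y. (if y \<in> X then 1 else 0) * \<phi> y) = (\<lambda>y. if y \<in> X then \<phi> y else 0)"
    by auto
  ultimately show ?thesis
    by simp
qed

lemma parity_level_cut:
  assumes \<phi>: "\<phi> \<in> parity s (level k)"
    and X: "\<And>y v. v \<in> box_at (period k) \<Longrightarrow> y + v \<in> X \<longleftrightarrow> y \<in> X" "\<And>y. - y \<in> X \<longleftrightarrow> y \<in> X"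
  shows "(\<lambda>y. if y \<in> X then \<phi> y else 0) \<in> parity s (level k)"
    "(\<lambda>y. if y \<in> X then 0 else \<phi> y) \<in> parity s (level k)"
proof -
  have lev: "\<phi> \<in> level k"
    using \<phi> by (simp add: parity_def)
  have "(\<lambda>y. if y \<in> X then \<phi> y else 0) \<in> schwartz"
    by (rule schwartz_cut[OF level_schwartz[OF lev] period_nonzero X(1)])
  then show 1: "(\<lambda>y. if y \<in> X then \<phi> y else 0) \<in> parity s (level k)"
    using \<phi> X by (auto simp: parity_def level_def supp_inv_def)
  have "(\<lambda>y. \<phi> y - (if y \<in> X then \<phi> y else 0)) \<in> parity s (level k)"
    using fun_subspaceD(5)[OF fun_subspace_parity[OF fun_subspace_level] \<phi> 1] .
  moreover have "(\<lambda>y. \<phi> y - (if y \<in> X then \<phi> y else 0)) = (\<lambda>y. if y \<in> X then 0 else \<phi> y)"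
    by auto
  ultimately show "(\<lambda>y. if y \<in> X then 0 else \<phi> y) \<in> parity s (level k)"
    by simp
qed

lemma near_invariant:
  "v \<in> box_at (period k) \<Longrightarrow> z + v \<in> near k y \<longleftrightarrow> z \<in> near k y"
  "- z \<in> near k y \<longleftrightarrow> z \<in> near k y"
proof -
  assume v: "v \<in> box_at (period k)"
  have "z + v - y = (z - y) + v" "z + v + y = (z + y) + v"
    by simp_all
  then show "z + v \<in> near k y \<longleftrightarrow> z \<in> near k y"
    using box_at_add_iff[OF v] by (metis (mono_tags, lifting) mem_Collect_eq near_def)
next
  have "- z - y = - (z + y)" "- z + y = - (z - y)"
    by simp_all
  then show "- z \<in> near k y \<longleftrightarrow> z \<in> near k y"
    unfolding near_def mem_Collect_eq by (metis box_at_minus)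
qed

text \<open>
  Every function is a finite sum of functions supported in classes up to sign, and an invariant
  subspace contains each of these summands as soon as it contains a function that does not
  vanish on its class.
\<close>

lemma mem_if_nonzero_on_support:
  assumes U: "K_subspace U" "U \<subseteq> parity s (level k)" and \<phi>: "\<phi> \<in> parity s (level k)"
    and pts: "\<And>y. \<phi> y \<noteq> 0 \<Longrightarrow> good k y \<and> (\<exists>g\<in>U. g y \<noteq> 0)"
  shows "\<phi> \<in> U"
proof -
  note sub = K_subspaceD(1)[OF U(1)]
  obtain R :: "('a, 'n) vec set"
    where R: "finite R" "\<And>y. y \<in> box_at (radius k) \<Longrightarrow> \<exists>x\<in>R. y - x \<in> box_at (period k)"
    using period_cover[of k] by blast
  have "\<forall>\<phi>\<in>parity s (level k). (\<forall>y. \<phi> y \<noteq> 0 \<longrightarrow> good k y \<and> (\<exists>g\<in>U. g y \<noteq> 0) \<and>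
      (\<exists>x\<in>R. y - x \<in> box_at (period k))) \<longrightarrow> \<phi> \<in> U"
    using R(1)
  proof (induction R rule: finite_induct)
    case empty
    show ?case
    proof (intro ballI impI)
      fix \<phi> :: "('a, 'n) vec \<Rightarrow> complex"
      assume "\<forall>y. \<phi> y \<noteq> 0 \<longrightarrow> good k y \<and> (\<exists>g\<in>U. g y \<noteq> 0) \<and> (\<exists>x\<in>{}. y - x \<in> box_at (period k))"
      then have "\<phi> = (\<lambda>y. 0)"
        by auto
      then show "\<phi> \<in> U"
        using fun_subspaceD(2)[OF sub] by simp
    qed
  next
    case (insert x R)
    show ?case
    proof (intro ballI impI)
      fix \<phi>
      assume \<phi>: "\<phi> \<in> parity s (level k)"
        and pts: "\<forall>y. \<phi> y \<noteq> 0 \<longrightarrow> good k y \<and> (\<exists>g\<in>U. g y \<noteq> 0) \<and>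
          (\<exists>x\<in>insert x R. y - x \<in> box_at (period k))"
      show "\<phi> \<in> U"
      proof (cases "\<exists>y. \<phi> y \<noteq> 0 \<and> y - x \<in> box_at (period k)")
        case False
        then have "\<forall>y. \<phi> y \<noteq> 0 \<longrightarrow> good k y \<and> (\<exists>g\<in>U. g y \<noteq> 0) \<and> (\<exists>x\<in>R. y - x \<in> box_at (period k))"
          using pts by blast
        then show ?thesis
          using insert.IH \<phi> by blast
      next
        case True
        then obtain y where y: "\<phi> y \<noteq> 0" "y - x \<in> box_at (period k)"
          by blast
        then obtain f where "good k y" "f \<in> U" "f y \<noteq> 0"
          using pts by blast
        moreover have "f \<in> level k"
          using \<open>f \<in> U\<close> U(2) by (auto simp: parity_def)
        ultimately obtain g where g: "g \<in> U" "g y \<noteq> 0" "\<And>z. g z \<noteq> 0 \<Longrightarrow> z \<in> near k y"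
          using exists_supported_in_class[OF U(1)] by blast
        let ?\<phi>1 = "\<lambda>z. if z \<in> near k y then \<phi> z else 0"
        let ?\<phi>2 = "\<lambda>z. if z \<in> near k y then 0 else \<phi> z"
        have par: "?\<phi>1 \<in> parity s (level k)" "?\<phi>2 \<in> parity s (level k)"
          using parity_level_cut[OF \<phi> near_invariant] by auto
        have "?\<phi>1 = (\<lambda>z. ?\<phi>1 y / g y * g z)"
          by (rule near_proportional[OF par(1)]) (use g U(2) in \<open>auto split: if_splits\<close>)
        then have 1: "?\<phi>1 \<in> U"
          using fun_subspaceD(4)[OF sub g(1), of "?\<phi>1 y / g y"] by simp
        have cover: "\<exists>x'\<in>R. z - x' \<in> box_at (period k)" if z: "?\<phi>2 z \<noteq> 0" for z
        proof -
          have "z \<notin> near k y" "\<phi> z \<noteq> 0"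
            using z by (auto split: if_splits)
          then obtain x' where x': "x' \<in> insert x R" "z - x' \<in> box_at (period k)"
            using pts by blast
          have "x' \<noteq> x"
          proof
            assume "x' = x"
            then have "(z - x) - (y - x) \<in> box_at (period k)"
              using x'(2) box_at_diff[OF _ y(2), of "z - x"] by blast
            moreover have "(z - x) - (y - x) = z - y"
              by simp
            ultimately show False
              using \<open>z \<notin> near k y\<close> by (simp add: near_def)
          qed
          then show ?thesis
            using x' by blast
        qed
        have 2: "?\<phi>2 \<in> U"
        proof (rule insert.IH[rule_format, OF par(2)])
          fix z
          assume z: "?\<phi>2 z \<noteq> 0"
          then have "\<phi> z \<noteq> 0"
            by (auto split: if_splits)
          with pts have "good k z \<and> (\<exists>g\<in>U. g z \<noteq> 0)"
            by blast
          then show "good k z \<and> (\<exists>g\<in>U. g z \<noteq> 0) \<and> (\<exists>x\<in>R. z - x \<in> box_at (period k))"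
            using cover[OF z] by simp
        qed
        have "(\<lambda>z. ?\<phi>1 z + ?\<phi>2 z) = \<phi>"
          by auto
        then show ?thesis
          using fun_subspaceD(3)[OF sub 1 2] by simp
      qed
    qed
  qed
  note all = this
  show ?thesis
  proof (rule all[rule_format, OF \<phi>])
    fix y
    assume y: "\<phi> y \<noteq> 0"
    have "\<phi> \<in> level k"
      using \<phi> by (simp add: parity_def)
    then have "\<exists>x\<in>R. y - x \<in> box_at (period k)"
      using R(2) level_support y by simp
    then show "good k y \<and> (\<exists>g\<in>U. g y \<noteq> 0) \<and> (\<exists>x\<in>R. y - x \<in> box_at (period k))"
      using pts[OF y] by simp
  qed
qed

lemma transport_nonzero:
  assumes "K_subspace U" "g \<in> U" "g y' \<noteq> 0" "critical k i"
    and "y \<in> box_at (radius k)" "absv (y $ i) = absv (radius k i)"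
    and "y' \<in> box_at (radius k)" "absv (y' $ i) = absv (radius k i)"
  shows "\<exists>f\<in>U. f y \<noteq> 0"
proof -
  obtain h \<kappa> m where h: "h \<in> K" "\<kappa> \<noteq> 0" "\<And>\<phi>. \<phi> \<in> schwartz \<Longrightarrow> A h \<phi> = (\<lambda>z. \<kappa> * \<phi> (m *v z))" "m *v y = y'"
    using levi_transport[OF assms(4-8)] by blast
  have "g \<in> schwartz"
    using assms(1,2) K_subspaceD(1) fun_subspaceD(1) by blast
  then have "A h g y \<noteq> 0"
    using h assms(3) by simp
  then show ?thesis
    using K_subspaceD(2)[OF assms(1) h(1) assms(2)] by blast
qed

text \<open>
  Two points outside the inner box may have different critical coordinates; both are moved to
  the point \<open>radius k\<close>, all of whose coordinates have maximal absolute value.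
\<close>

lemma nonzero_everywhere:
  assumes U: "K_subspace U" and g: "g \<in> U" "g y0 \<noteq> 0"
    and y0: "y0 \<in> box_at (radius k)" "y0 \<notin> box_at (inner_radius k)"
    and y: "y \<in> box_at (radius k)" "y \<notin> box_at (inner_radius k)"
  shows "\<exists>f\<in>U. f y \<noteq> 0"
proof -
  obtain i where i: "critical k i" "absv (y0 $ i) = absv (radius k i)"
    using exists_critical[OF y0] by blast
  obtain j where j: "critical k j" "absv (y $ j) = absv (radius k j)"
    using exists_critical[OF y] by blast
  have c: "(\<chi> i. radius k i) \<in> box_at (radius k)"
    by (simp add: in_box_at_iff)
  obtain f where f: "f \<in> U" "f (\<chi> i. radius k i) \<noteq> 0"
    using transport_nonzero[OF U g i(1) c _ y0(1) i(2)] by auto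
  show ?thesis
    using transport_nonzero[OF U f j(1) y(1) j(2) c] by simp
qed

lemma box_at_period_iff:
  "(\<And>i. absv (period k i) \<le> absv (d i)) \<Longrightarrow> v \<in> box_at (period k) \<Longrightarrow> y + v \<in> box_at d \<longleftrightarrow> y \<in> box_at d"
  using box_at_mono[of "period k" d] by (intro box_at_add_iff) blast

text \<open>
  If all functions in \<open>U\<close> are supported in the inner box, then so are their images under the
  Weyl element; this means that the functions themselves have the periods of level \<open>l\<close>, and hence
  this level.
\<close>

lemma exists_good_nonzero:
  assumes U: "K_subspace U" "U \<subseteq> parity s (level (Suc l))" "\<not> U \<subseteq> level l"
  shows "\<exists>u\<in>U. \<exists>y. u y \<noteq> 0 \<and> good (Suc l) y"
proof (rule ccontr)
  assume neg: "\<not> ?thesis"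
  have supp: "y \<in> box_at (radius l)" if "u \<in> U" "u y \<noteq> 0" for u y
  proof -
    have "y \<in> box_at (radius (Suc l))"
      using that U(2) level_support by (auto simp: parity_def)
    then show ?thesis
      using neg that by (auto simp: good_def inner_radius_Suc[abs_def])
  qed
  obtain u where u: "u \<in> U" "u \<notin> level l"
    using U(3) by blast
  then have lev: "u \<in> level (Suc l)"
    using U(2) by (auto simp: parity_def)
  obtain w where w: "w \<in> K" "\<And>a b \<phi>. (\<And>i. a i \<noteq> 0) \<Longrightarrow> (\<And>i. b i \<noteq> 0) \<Longrightarrow>
      \<phi> \<in> supp_inv a (\<lambda>i. 2 * delta i / b i) \<Longrightarrow> A w \<phi> \<in> supp_inv b (\<lambda>i. 2 * delta i / a i)"
    by (rule weyl_element) blast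
  have "u \<in> supp_inv (radius l) (\<lambda>i. 2 * delta i / radius (Suc l) i)"
    using lev supp[OF u(1)] by (simp add: supp_inv_def level_def period_def[abs_def])
  then have "A w u \<in> supp_inv (radius (Suc l)) (\<lambda>i. 2 * delta i / radius l i)"
    using w(2) by simp
  moreover have "A w u \<in> U"
    using K_subspaceD(2)[OF U(1) w(1) u(1)] .
  ultimately have "A w u \<in> level l"
    using supp by (simp add: supp_inv_def level_def period_def[abs_def])
  then have "A (inv\<^bsub>Mp\<^esub> w) (A w u) \<in> level l"
    by (rule A_level[OF K_inv[OF w(1)]])
  then show False
    using u(2) A_inv(1)[OF K_carrier[OF w(1)] level_schwartz[OF lev]] by simp
qed

text \<open>
  By transitivity, \<open>U\<close> contains the functions that vanish on the inner box. The functions supported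
  in the inner box are handled by the Weyl element: it maps them to functions with the periods
  of level \<open>l\<close>, and cutting such a function at the inner box gives a function of level \<open>l\<close> and one
  that vanishes on the inner box, both of which are in \<open>U\<close>.
\<close>

lemma invariant_between_levels:
  assumes U: "K_subspace U" "U \<subseteq> parity s (level (Suc l))" "\<not> U \<subseteq> level l"
    and sub: "parity s (level l) \<subseteq> U"
  shows "U = parity s (level (Suc l))"
proof (intro equalityI[OF U(2)] subsetI)
  let ?k = "Suc l"
  note subU = K_subspaceD(1)[OF U(1)]
  note inner = inner_radius_Suc[of l, abs_def]
  obtain u y0 where u: "u \<in> U" "u y0 \<noteq> 0" "good ?k y0"
    using exists_good_nonzero[OF U] by blast
  have outer: "\<phi> \<in> U" if \<phi>: "\<phi> \<in> parity s (level ?k)" "\<And>y. \<phi> y \<noteq> 0 \<Longrightarrow> y \<notin> box_at (radius l)" for \<phi>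
  proof (rule mem_if_nonzero_on_support[OF U(1,2) \<phi>(1)])
    fix y
    assume nz: "\<phi> y \<noteq> 0"
    have y: "y \<in> box_at (radius ?k)"
      using \<phi>(1) nz level_support by (auto simp: parity_def)
    then have "good ?k y"
      using \<phi>(2)[OF nz] by (simp add: good_def inner)
    moreover have "\<exists>f\<in>U. f y \<noteq> 0"
      using u y \<phi>(2)[OF nz] by (intro nonzero_everywhere[OF U(1) u(1,2), of ?k]) (auto simp: good_def inner)
    ultimately show "good ?k y \<and> (\<exists>g\<in>U. g y \<noteq> 0)"
      by blast
  qed
  have cut: "(\<lambda>y. if y \<in> box_at (radius l) then \<phi> y else 0) \<in> parity s (level ?k)"
      "(\<lambda>y. if y \<in> box_at (radius l) then 0 else \<phi> y) \<in> parity s (level ?k)"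
    if "\<phi> \<in> parity s (level ?k)" for \<phi>
    using parity_level_cut[OF that, of "box_at (radius l)"]
      box_at_period_iff[of ?k "radius l"] absv_period_le_inner_radius[of ?k] by (auto simp: inner_radius_Suc)
  obtain w where w: "w \<in> K" "\<And>a b \<phi>. (\<And>i. a i \<noteq> 0) \<Longrightarrow> (\<And>i. b i \<noteq> 0) \<Longrightarrow>
      \<phi> \<in> supp_inv a (\<lambda>i. 2 * delta i / b i) \<Longrightarrow> A w \<phi> \<in> supp_inv b (\<lambda>i. 2 * delta i / a i)"
    by (rule weyl_element) blast
  have mixed: "\<phi> \<in> U" if \<phi>: "\<phi> \<in> parity s (level ?k)" "\<And>y. \<phi> y \<noteq> 0 \<Longrightarrow> y \<in> box_at (radius l)" for \<phi>
  proof -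
    have S: "\<phi> \<in> schwartz"
      using \<phi>(1) level_schwartz by (auto simp: parity_def)
    define \<eta> where "\<eta> = A w \<phi>"
    have \<eta>: "\<eta> \<in> parity s (level ?k)"
      unfolding \<eta>_def using K_subspaceD(2)[OF K_subspace_parity_level w(1) \<phi>(1)] .
    have "\<phi> \<in> supp_inv (radius l) (\<lambda>i. 2 * delta i / radius ?k i)"
      using \<phi> by (auto simp: supp_inv_def parity_def level_def period_def[abs_def])
    then have \<eta>': "\<eta> \<in> supp_inv (radius ?k) (period l)"
      unfolding \<eta>_def period_def[abs_def] using w(2) by simp
    let ?\<eta>1 = "\<lambda>y. if y \<in> box_at (radius l) then \<eta> y else 0"
    let ?\<eta>2 = "\<lambda>y. if y \<in> box_at (radius l) then 0 else \<eta> y"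
    have "?\<eta>1 \<in> supp_inv (radius l) (period l)"
      using \<eta>' cut(1)[OF \<eta>] level_schwartz[of ?\<eta>1 ?k] box_at_period_iff[of l "radius l"] absv_period_le_radius
      by (auto simp: supp_inv_def parity_def)
    then have "?\<eta>1 \<in> parity s (level l)"
      using cut(1)[OF \<eta>] by (simp add: parity_def level_def)
    then have 1: "?\<eta>1 \<in> U"
      using sub by blast
    have 2: "?\<eta>2 \<in> U"
      by (rule outer[OF cut(2)[OF \<eta>]]) (auto split: if_splits)
    have "(\<lambda>y. ?\<eta>1 y + ?\<eta>2 y) = \<eta>"
      by auto
    then have "\<eta> \<in> U"
      using fun_subspaceD(3)[OF subU 1 2] by simp
    then have "A (inv\<^bsub>Mp\<^esub> w) \<eta> \<in> U"
      by (rule K_subspaceD(2)[OF U(1) K_inv[OF w(1)]])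
    then show ?thesis
      unfolding \<eta>_def by (simp add: A_inv K_carrier[OF w(1)] S)
  qed
  fix \<phi>
  assume \<phi>: "\<phi> \<in> parity s (level ?k)"
  let ?\<phi>1 = "\<lambda>y. if y \<in> box_at (radius l) then \<phi> y else 0"
  let ?\<phi>2 = "\<lambda>y. if y \<in> box_at (radius l) then 0 else \<phi> y"
  have "?\<phi>1 \<in> U"
    by (rule mixed[OF cut(1)[OF \<phi>]]) (auto split: if_splits)
  moreover have "?\<phi>2 \<in> U"
    by (rule outer[OF cut(2)[OF \<phi>]]) (auto split: if_splits)
  ultimately have "(\<lambda>y. ?\<phi>1 y + ?\<phi>2 y) \<in> U"
    by (rule fun_subspaceD(3)[OF subU])
  moreover have "(\<lambda>y. ?\<phi>1 y + ?\<phi>2 y) = \<phi>"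
    by auto
  ultimately show "\<phi> \<in> U"
    by simp
qed

section \<open>The smallest level\<close>

text \<open>
  A point of the inner box is congruent to its negative modulo the periods, so odd functions vanish
  there, and a function that is nonzero at one of the other points can be moved to any of them.
\<close>

lemma invariant_odd_level_0:
  assumes U: "K_subspace U" "U \<subseteq> parity (- 1) (level 0)" "\<not> U \<subseteq> {\<lambda>y. 0}"
  shows "U = parity (- 1) (level 0)"
proof (intro equalityI[OF U(2)] subsetI)
  have supp: "y \<in> box_at (radius 0)" "y \<notin> box_at (inner_radius 0)"
    if \<phi>: "\<phi> \<in> parity (- 1) (level 0)" and "\<phi> y \<noteq> 0" for \<phi> y
  proof -
    show "y \<in> box_at (radius 0)"
      using that level_support by (auto simp: parity_def)
    show "y \<notin> box_at (inner_radius 0)"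
    proof
      assume y: "y \<in> box_at (inner_radius 0)"
      have "y - - y \<in> box_at (period 0)"
        unfolding in_box_at_iff
      proof
        fix i
        have "absv (2::'a) * absv (y $ i) \<le> absv (2::'a) * absv (delta i)"
          using y by (intro mult_left_mono) (auto simp: in_box_at_iff inner_radius_0)
        then show "absv ((y - - y) $ i) \<le> absv (period 0 i)"
          by (simp add: period_def radius_def flip: absv_mult)
      qed
      moreover have "\<phi> \<in> level 0" and odd: "\<phi> (- y) = - \<phi> y"
        using \<phi> by (simp_all add: parity_def)
      ultimately have "\<phi> y = \<phi> (- y)"
        by (simp only: level_periodic[of \<phi> 0 y "- y"])
      then show False
        using \<open>\<phi> y \<noteq> 0\<close> unfolding odd by simp
    qed
  qed
  obtain u y0 where u: "u \<in> U" "u y0 \<noteq> 0"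
    using U(3) by (auto simp: fun_eq_iff)
  have y0: "y0 \<in> box_at (radius 0)" "y0 \<notin> box_at (inner_radius 0)"
    using supp[of u y0] u U(2) by blast+
  fix \<phi>
  assume \<phi>: "\<phi> \<in> parity (- 1) (level 0)"
  show "\<phi> \<in> U"
  proof (rule mem_if_nonzero_on_support[OF U(1,2) \<phi>])
    fix y
    assume "\<phi> y \<noteq> 0"
    then show "good 0 y \<and> (\<exists>g\<in>U. g y \<noteq> 0)"
      using supp[OF \<phi>] nonzero_everywhere[OF U(1) u y0] by (simp add: good_def)
  qed
qed

lemma indicator_box_schwartz:
  fixes d :: "'n \<Rightarrow> 'a"
  assumes "\<And>i. d i \<noteq> 0"
  shows "(\<lambda>y. if y \<in> box_at d then 1 else 0 :: complex) \<in> schwartz"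
proof -
  obtain e :: 'a where e: "e \<noteq> 0" and 1: "(box_at (\<lambda>_. e) :: ('a, 'n) vec set) \<subseteq> box_at d"
    using exists_below[of d, OF assms] by blast
  obtain c :: 'a where c: "c \<noteq> 0" "Max (range (\<lambda>i. absv (d i))) < absv c"
    using exists_large by blast
  then have 2: "box_at d \<subseteq> box_at (\<lambda>_. c)"
    by (intro box_at_mono) (auto intro: less_imp_le)
  show ?thesis
  proof (rule schwartzI[OF c(1) _ e])
    fix y v :: "('a, 'n) vec"
    assume "v \<in> box_at (\<lambda>_. e)"
    then have "v \<in> box_at d"
      using 1 by blast
    then show "(if y + v \<in> box_at d then 1 else 0 :: complex) = (if y \<in> box_at d then 1 else 0)"
      by (simp add: box_at_add_iff)
  qed (use 2 in \<open>auto split: if_splits\<close>)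
qed

text \<open>
  The Weyl element maps the indicator function of the period lattice to a nonzero multiple of
  the indicator function of the whole support lattice, and translates of the former to multiples
  of the latter by characters. Hence an even function supported in a class up to sign is mapped to
  a function which does not vanish at \<open>0\<close>; localizing there and applying the Weyl element again
  gives a function without zeros on the support lattice.
\<close>

lemma invariant_even_level_0:
  assumes U: "K_subspace U" "U \<subseteq> parity 1 (level 0)" "\<not> U \<subseteq> {\<lambda>y. 0}"
  shows "U = parity 1 (level 0)"
proof (intro equalityI[OF U(2)] subsetI)
  have lev: "\<And>\<phi>. \<phi> \<in> U \<Longrightarrow> \<phi> \<in> level 0"
    using U(2) by (auto simp: parity_def)
  obtain w where w: "w \<in> K"
    "\<And>x. p w *v x = vec_pair (\<chi> i. x $ Inr i / delta i) (\<chi> i. - delta i * x $ Inl i)"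
    "\<And>a b \<phi>. (\<And>i. a i \<noteq> 0) \<Longrightarrow> (\<And>i. b i \<noteq> 0) \<Longrightarrow>
      \<phi> \<in> supp_inv a (\<lambda>i. 2 * delta i / b i) \<Longrightarrow> A w \<phi> \<in> supp_inv b (\<lambda>i. 2 * delta i / a i)"
    by (rule weyl_element) blast
  have W: "w \<in> carrier Mp"
    by (rule K_carrier[OF w(1)])
  \<comment> \<open>functions supported in the period lattice are mapped to constants on the support lattice\<close>
  have const: "A w f z = A w f 0"
    if f: "f \<in> level 0" "\<And>z. f z \<noteq> 0 \<Longrightarrow> z \<in> box_at (period 0)" and z: "z \<in> box_at (radius 0)" for f z
  proof -
    have "(\<lambda>i. 2 * delta i / period 0 i) = radius 0" "(\<lambda>i. 2 * delta i / radius 0 i) = period 0"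
      by (auto simp: period_def radius_def)
    moreover have "f \<in> supp_inv (period 0) (period 0)"
      using f by (auto simp: level_def supp_inv_def)
    ultimately have "A w f \<in> supp_inv (radius 0) (radius 0)"
      using w(3)[of "period 0" "radius 0" f] by simp
    then have "A w f (0 + z) = A w f 0"
      using z unfolding supp_inv_def by blast
    then show ?thesis
      by simp
  qed
  have nz: "A w f 0 \<noteq> 0" if f: "f \<in> level 0" "\<And>z. f z \<noteq> 0 \<Longrightarrow> z \<in> box_at (period 0)" "f \<noteq> (\<lambda>y. 0)" for f
  proof
    assume "A w f 0 = 0"
    then have "A w f = (\<lambda>y. 0)"
      using const[OF f(1,2)] level_support[OF A_level[OF w(1) f(1)]] by metis
    then have "f = (\<lambda>y. 0)"
      using A_inv(1)[OF W level_schwartz[OF f(1)]] A_zero[of "inv\<^bsub>Mp\<^esub> w"] W by simp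
    then show False
      using f(3) by simp
  qed
  obtain u y0 where u: "u \<in> U" "u y0 \<noteq> 0"
    using U(3) by (auto simp: fun_eq_iff)
  have good0: "good 0 y \<longleftrightarrow> y \<in> box_at (radius 0)" for y
    by (simp add: good_def)
  have y0: "good 0 y0"
    using level_support[OF lev[OF u(1)] u(2)] by (simp add: good0)
  obtain g where g: "g \<in> U" "g y0 \<noteq> 0" "\<And>z. g z \<noteq> 0 \<Longrightarrow> z \<in> near 0 y0"
    using exists_supported_in_class[OF U(1) u(1) lev[OF u(1)] y0 u(2)] by blast
  define e where "e = (\<lambda>z. if z \<in> box_at (period 0) then 1 else 0 :: complex)"
  have eS: "e \<in> schwartz"
    unfolding e_def by (rule indicator_box_schwartz) simp
  have e: "e \<in> level 0"
    using eS box_at_mono[of "period 0" "radius 0"] absv_period_le_radius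
    by (auto simp: level_def supp_inv_def e_def box_at_add_iff)
  have e_minus: "e (- z) = e z" for z
    by (simp add: e_def)
  \<comment> \<open>the sum of the indicator functions of the classes of \<open>y0\<close> and \<open>- y0\<close>\<close>
  define G where "G = (\<lambda>z. heis (vec_pair 0 y0) e z + heis (vec_pair 0 (- y0)) e z)"
  have Gz: "G z = e (z - y0) + e (z + y0)" for z
    by (simp add: G_def heis_def)
  have GS: "G \<in> schwartz"
    unfolding G_def by (intro schwartz_add schwartz_heis eS)
  have Gnear: "z \<in> near 0 y0" if "G z \<noteq> 0" for z
    using that by (auto simp: Gz e_def near_def split: if_splits)
  have "G \<in> parity 1 (level 0)"
  proof -
    have "z \<in> box_at (radius 0)" if "G z \<noteq> 0" for z
    proof -
      have sub: "box_at (period 0) \<subseteq> box_at (radius 0)"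
        using absv_period_le_radius by (intro box_at_mono)
      have "y0 \<in> box_at (radius 0)"
        using y0 by (simp add: good0)
      then show ?thesis
        using Gnear[OF that] sub box_at_add[of "z - y0" "radius 0" y0] box_at_diff[of "z + y0" "radius 0" y0]
        by (auto simp: near_def)
    qed
    moreover have "G (z + v) = G z" if "v \<in> box_at (period 0)" for z v
    proof -
      have "z + v - y0 = (z - y0) + v" "z + v + y0 = (z + y0) + v"
        by simp_all
      then show ?thesis
        by (simp only: Gz e_def box_at_add_iff[OF that])
    qed
    moreover have "G (- z) = G z" for z
      using e_minus[of "z - y0"] e_minus[of "z + y0"] by (simp add: Gz)
    ultimately show ?thesis
      using GS by (simp add: parity_def level_def supp_inv_def)
  qed
  then have "G = (\<lambda>z. G y0 / g y0 * g z)"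
    using g U(2) Gnear by (intro near_proportional) auto
  then have GU: "G \<in> U"
    using fun_subspaceD(4)[OF K_subspaceD(1)[OF U(1)] g(1)] by metis
  have "A w (heis (vec_pair 0 v) e) 0 = A w e 0" for v
  proof -
    have "A w (heis (vec_pair 0 v) e) = heis (vec_pair (\<chi> i. v $ i / delta i) 0) (A w e)"
      using A_heis[OF W eS] w(2) by (simp add: zero_vec_def)
    then show ?thesis
      by (simp add: heis_def)
  qed
  then have "A w G 0 = 2 * A w e 0"
    unfolding G_def by (simp add: A_add W schwartz_heis eS)
  moreover have "A w e 0 \<noteq> 0"
  proof (rule nz[OF e])
    show "e \<noteq> (\<lambda>y. 0)"
      by (auto simp: e_def fun_eq_iff intro!: exI[of _ 0])
  qed (auto simp: e_def split: if_splits)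
  ultimately have AG: "A w G \<in> U" "A w G 0 \<noteq> 0"
    using K_subspaceD(2)[OF U(1) w(1) GU] by auto
  have "good 0 0"
    by (simp add: good0)
  then obtain f where f: "f \<in> U" "f 0 \<noteq> 0" "\<And>z. f z \<noteq> 0 \<Longrightarrow> z \<in> near 0 0"
    using exists_supported_in_class[OF U(1) AG(1) lev[OF AG(1)] _ AG(2)] by blast
  then have fsupp: "z \<in> box_at (period 0)" if "f z \<noteq> 0" for z
    using that by (auto simp: near_def)
  have "f \<noteq> (\<lambda>y. 0)"
    using f(2) by auto
  then have "A w f z \<noteq> 0" if "z \<in> box_at (radius 0)" for z
    using const[OF lev[OF f(1)] fsupp that] nz[OF lev[OF f(1)] fsupp] by simp
  moreover have "A w f \<in> U"
    by (rule K_subspaceD(2)[OF U(1) w(1) f(1)])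
  ultimately have all: "\<exists>h\<in>U. h z \<noteq> 0" if "z \<in> box_at (radius 0)" for z
    using that by blast
  fix \<phi>
  assume \<phi>: "\<phi> \<in> parity 1 (level 0)"
  show "\<phi> \<in> U"
  proof (rule mem_if_nonzero_on_support[OF U(1,2) \<phi>])
    fix y
    assume "\<phi> y \<noteq> 0"
    then have "y \<in> box_at (radius 0)"
      using \<phi> level_support by (auto simp: parity_def)
    then show "good 0 y \<and> (\<exists>g\<in>U. g y \<noteq> 0)"
      using all by (simp add: good0)
  qed
qed

section \<open>Invariant complements from averages over Heisenberg operators\<close>

definition heis_sum :: "('a^('n + 'n)) list \<Rightarrow> (('a, 'n) vec \<Rightarrow> complex) \<Rightarrow> ('a, 'n) vec \<Rightarrow> complex" where
  "heis_sum ws \<phi> = (\<lambda>y. \<Sum>w\<leftarrow>ws. heis w \<phi> y)"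

lemma heis_sum_Nil [simp]: "heis_sum [] \<phi> = (\<lambda>y. 0)"
  and heis_sum_Cons [simp]: "heis_sum (w # ws) \<phi> = (\<lambda>y. heis w \<phi> y + heis_sum ws \<phi> y)"
  by (simp_all add: heis_sum_def)

lemma heis_sum_append: "heis_sum (vs @ ws) \<phi> = (\<lambda>y. heis_sum vs \<phi> y + heis_sum ws \<phi> y)"
  by (simp add: heis_sum_def)

lemma heis_sum_add: "heis_sum ws (\<lambda>y. \<phi> y + \<eta> y) = (\<lambda>y. heis_sum ws \<phi> y + heis_sum ws \<eta> y)"
  by (simp add: heis_sum_def heis_add sum_list_addf)

lemma heis_sum_smult: "heis_sum ws (\<lambda>y. c * \<phi> y) = (\<lambda>y. c * heis_sum ws \<phi> y)"
  by (simp add: heis_sum_def heis_smult sum_list_const_mult)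

lemma heis_sum_zero [simp]: "heis_sum ws (\<lambda>y. 0) = (\<lambda>y. 0)"
  using heis_sum_smult[of ws 0 "\<lambda>y. 0"] by simp

lemma heis_sum_schwartz: "\<phi> \<in> schwartz \<Longrightarrow> heis_sum ws \<phi> \<in> schwartz"
  by (induction ws) (auto intro: schwartz_add schwartz_heis)

lemma heis_sum_translate:
  assumes "v \<in> period_lattice k" "set ws \<subseteq> period_lattice k"
  shows "heis_sum (map ((+) v) ws) \<phi> = heis v (heis_sum ws \<phi>)"
  using assms(2)
  by (induction ws) (simp_all add: heis_add heis_heis_period_lattice[OF assms(1)])

lemma heis_sum_compose:
  assumes "set vs \<subseteq> period_lattice k" "set ws \<subseteq> period_lattice k"
  shows "\<exists>us. (vs \<noteq> [] \<longrightarrow> ws \<noteq> [] \<longrightarrow> us \<noteq> []) \<and> set us \<subseteq> period_lattice k \<and>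
    (\<forall>\<phi>. heis_sum us \<phi> = heis_sum vs (heis_sum ws \<phi>)) \<and>
    (\<forall>\<phi>. heis_sum us \<phi> = heis_sum ws (heis_sum vs \<phi>))"
  using assms(1)
proof (induction vs)
  case Nil
  then show ?case
    by (intro exI[of _ "[]"]) simp
next
  case (Cons v vs)
  then obtain us where us: "vs \<noteq> [] \<longrightarrow> ws \<noteq> [] \<longrightarrow> us \<noteq> []" "set us \<subseteq> period_lattice k"
    "\<And>\<phi>. heis_sum us \<phi> = heis_sum vs (heis_sum ws \<phi>)"
    "\<And>\<phi>. heis_sum us \<phi> = heis_sum ws (heis_sum vs \<phi>)"
    using Cons.IH by (metis list.set_intros(2) subset_iff)
  have v: "v \<in> period_lattice k"
    using Cons.prems by simp
  have comm: "heis v (heis_sum ws \<phi>) = heis_sum ws (heis v \<phi>)" for \<phi>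
    using assms(2)
    by (induction ws) (simp_all add: heis_add heis_heis_period_lattice[OF v]
        heis_heis_period_lattice[OF _ v] add.commute)
  show ?case
  proof (intro exI[of _ "map ((+) v) ws @ us"] conjI allI)
    show "set (map ((+) v) ws @ us) \<subseteq> period_lattice k"
      using us(2) assms(2) v by (auto intro: period_lattice_add)
    show 1: "heis_sum (map ((+) v) ws @ us) \<phi> = heis_sum (v # vs) (heis_sum ws \<phi>)" for \<phi>
      by (simp add: heis_sum_append heis_sum_translate[OF v assms(2)] us(3))
    show "heis_sum (map ((+) v) ws @ us) \<phi> = heis_sum ws (heis_sum (v # vs) \<phi>)" for \<phi>
      unfolding heis_sum_append heis_sum_translate[OF v assms(2)] us(4) heis_sum_Cons heis_sum_add comm ..
  qed auto
qed

text \<open>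
  This is a complement of \<open>level k\<close> in the Schwartz space; see \<open>level_Int_avg_kernel\<close> and
  \<open>level_plus_avg_kernel\<close> below. Allowing lists with repetitions makes
  it closed under addition, because sums of Heisenberg operators over such lists commute and
  compose.
\<close>

definition avg_kernel :: "nat \<Rightarrow> (('a, 'n) vec \<Rightarrow> complex) set" where
  "avg_kernel k = {\<phi> \<in> schwartz. \<exists>ws. ws \<noteq> [] \<and> set ws \<subseteq> period_lattice k \<and> heis_sum ws \<phi> = (\<lambda>y. 0)}"

lemma avg_kernelI:
  "\<phi> \<in> schwartz \<Longrightarrow> ws \<noteq> [] \<Longrightarrow> set ws \<subseteq> period_lattice k \<Longrightarrow> heis_sum ws \<phi> = (\<lambda>y. 0) \<Longrightarrow>
    \<phi> \<in> avg_kernel k"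
  unfolding avg_kernel_def by blast

lemma fun_subspace_avg_kernel: "fun_subspace (avg_kernel k)"
  unfolding fun_subspace_def
proof (intro conjI ballI allI)
  show "(\<lambda>y. 0) \<in> avg_kernel k"
    using period_lattice_0 by (auto simp: avg_kernel_def intro!: exI[of _ "[0]"])
  fix \<phi>
  assume \<phi>: "\<phi> \<in> avg_kernel k"
  then show "(\<lambda>y. c * \<phi> y) \<in> avg_kernel k" for c
    by (auto simp: avg_kernel_def schwartz_smult heis_sum_smult)
  fix \<eta>
  assume \<eta>: "\<eta> \<in> avg_kernel k"
  obtain vs where vs: "vs \<noteq> []" "set vs \<subseteq> period_lattice k" "heis_sum vs \<phi> = (\<lambda>y. 0)"
    using \<phi> by (auto simp: avg_kernel_def)
  obtain ws where ws: "ws \<noteq> []" "set ws \<subseteq> period_lattice k" "heis_sum ws \<eta> = (\<lambda>y. 0)"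
    using \<eta> by (auto simp: avg_kernel_def)
  obtain us where us: "us \<noteq> []" "set us \<subseteq> period_lattice k"
    "\<And>\<phi>. heis_sum us \<phi> = heis_sum vs (heis_sum ws \<phi>)"
    "\<And>\<phi>. heis_sum us \<phi> = heis_sum ws (heis_sum vs \<phi>)"
    using heis_sum_compose[OF vs(2) ws(2)] vs(1) ws(1) by auto
  have "heis_sum us (\<lambda>y. \<phi> y + \<eta> y) = (\<lambda>y. 0)"
    using us(3)[of \<eta>] us(4)[of \<phi>] vs(3) ws(3) by (simp add: heis_sum_add)
  then show "(\<lambda>y. \<phi> y + \<eta> y) \<in> avg_kernel k"
    using \<phi> \<eta> us(1,2) by (auto simp: avg_kernel_def schwartz_add)
qed (auto simp: avg_kernel_def)

lemma avg_kernel_antimono: "j \<le> k \<Longrightarrow> avg_kernel k \<subseteq> avg_kernel j"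
  unfolding avg_kernel_def using period_lattice_mono by blast

lemma level_Int_avg_kernel:
  assumes "\<phi> \<in> level k" "\<phi> \<in> avg_kernel k"
  shows "\<phi> = (\<lambda>y. 0)"
proof -
  obtain ws where ws: "ws \<noteq> []" "set ws \<subseteq> period_lattice k" "heis_sum ws \<phi> = (\<lambda>y. 0)"
    using assms(2) by (auto simp: avg_kernel_def)
  have fix_heis: "heis w \<phi> = \<phi>" if "w \<in> period_lattice k" for w
    using assms(1) level_iff_heis[OF level_schwartz[OF assms(1)]] that by blast
  have "heis_sum ws \<phi> = (\<lambda>y. of_nat (length ws) * \<phi> y)"
    using ws(2) by (induction ws) (auto simp: fix_heis algebra_simps)
  then have "of_nat (length ws) * \<phi> y = 0" for y
    using ws(3) by metis
  then show ?thesis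
    using ws(1) by auto
qed

lemma A_avg_kernel:
  assumes g: "g \<in> K" and \<phi>: "\<phi> \<in> avg_kernel k"
  shows "A g \<phi> \<in> avg_kernel k"
proof -
  have G: "g \<in> carrier Mp"
    using g by (rule K_carrier)
  obtain ws where ws: "ws \<noteq> []" "set ws \<subseteq> period_lattice k" "heis_sum ws \<phi> = (\<lambda>y. 0)"
    and S: "\<phi> \<in> schwartz"
    using \<phi> by (auto simp: avg_kernel_def)
  have "A g (heis_sum ws \<phi>) = heis_sum (map ((*v) (p g)) ws) (A g \<phi>)"
    by (induction ws) (simp_all add: A_zero G A_add S schwartz_heis heis_sum_schwartz A_heis)
  then have "heis_sum (map ((*v) (p g)) ws) (A g \<phi>) = (\<lambda>y. 0)"
    by (simp add: ws(3) A_zero G)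
  moreover have "set (map ((*v) (p g)) ws) \<subseteq> period_lattice k"
    using ws(2) K_period_lattice[OF g] by auto
  ultimately show ?thesis
    using ws(1) by (intro avg_kernelI[OF A_closed[OF G S], of "map ((*v) (p g)) ws"]) auto
qed

lemma avg_kernel_reflect:
  assumes "\<phi> \<in> avg_kernel k"
  shows "(\<lambda>y. \<phi> (- y)) \<in> avg_kernel k"
proof -
  obtain ws where ws: "ws \<noteq> []" "set ws \<subseteq> period_lattice k" "heis_sum ws \<phi> = (\<lambda>y. 0)"
    and S: "\<phi> \<in> schwartz"
    using assms by (auto simp: avg_kernel_def)
  have "heis_sum (map uminus ws) (\<lambda>y. \<phi> (- y)) = (\<lambda>y. heis_sum ws \<phi> (- y))"
    by (induction ws) (simp_all add: heis_reflect)
  then show ?thesis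
    using ws by (intro avg_kernelI[OF schwartz_reflect[OF S], of "map uminus ws"])
      (auto intro: period_lattice_minus)
qed

text \<open>
  A Schwartz function has some level \<open>j\<close>, so its images depend only on the class
  modulo the period lattice of level \<open>j\<close>, which has finite index.
\<close>

lemma finite_heis_orbit:
  assumes "\<phi> \<in> schwartz"
  shows "finite ((\<lambda>w. heis w \<phi>) ` period_lattice k)"
proof -
  obtain j0 where "\<phi> \<in> level j0"
    using in_some_level[OF assms] by blast
  then obtain j where j: "\<phi> \<in> level j" "k \<le> j"
    using level_mono[of j0 "max j0 k"] by (meson max.cobounded1 max.cobounded2 subsetD)
  define c where "c k = case_sum (\<lambda>i. 2 / radius k i) (period k)" for k
  have lat: "period_lattice k = box_at (c k)" for k
    by (auto simp: period_lattice_def in_box_at_iff c_def split: sum.split)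
      (metis obj_sumE old.sum.simps)+
  have "c j i \<noteq> 0" for i
    by (simp add: c_def split: sum.split)
  then obtain R :: "('a^('n + 'n)) set"
    where R: "finite R" "\<And>w. w \<in> period_lattice k \<Longrightarrow> \<exists>x\<in>R. w - x \<in> period_lattice j"
    unfolding lat using finite_residues_vec[of "c j" "c k"] by blast
  define Orb where "Orb x = (\<lambda>w. heis w \<phi>) ` {w \<in> period_lattice k. w - x \<in> period_lattice j}" for x
  have "finite (Orb x)" for x
  proof -
    have "h = h'" if hh: "h \<in> Orb x" "h' \<in> Orb x" for h h'
    proof -
      obtain w w' where w: "w \<in> period_lattice k" "w - x \<in> period_lattice j" "h = heis w \<phi>"
        and w': "w' \<in> period_lattice k" "w' - x \<in> period_lattice j" "h' = heis w' \<phi>"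
        using hh by (auto simp: Orb_def)
      have "(w - x) - (w' - x) \<in> period_lattice j"
        using w(2) w'(2) unfolding lat by (rule box_at_diff)
      then have d: "w - w' \<in> period_lattice j"
        by simp
      then have "heis w' (heis (w - w') \<phi>) = heis w \<phi>"
        using heis_heis_period_lattice[OF w'(1), of "w - w'" \<phi>] period_lattice_mono[OF j(2)] by auto
      moreover have "heis (w - w') \<phi> = \<phi>"
        using d j(1) level_iff_heis[OF assms] by blast
      ultimately show ?thesis
        using w(3) w'(3) by simp
    qed
    then have "\<exists>h. Orb x \<subseteq> {h}"
      by (cases "Orb x = {}") blast+
    then show ?thesis
      using finite_subset by blast
  qed
  moreover have "(\<lambda>w. heis w \<phi>) ` period_lattice k \<subseteq> (\<Union>x\<in>R. Orb x)"
    using R(2) unfolding Orb_def by blast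
  ultimately show ?thesis
    using R(1) finite_subset by blast
qed

text \<open>
  The average over the finite orbit of a function lies in level \<open>k\<close>, and subtracting it gives a
  function killed by the same average.
\<close>

lemma level_plus_avg_kernel:
  assumes S: "\<phi> \<in> schwartz"
  shows "\<exists>f\<in>level k. (\<lambda>y. \<phi> y - f y) \<in> avg_kernel k"
proof -
  define Orb where "Orb = (\<lambda>w. heis w \<phi>) ` period_lattice k"
  have fin: "finite Orb"
    unfolding Orb_def by (rule finite_heis_orbit[OF S])
  have "\<phi> \<in> Orb"
    using period_lattice_0 by (auto simp: Orb_def intro!: image_eqI[of _ _ 0])
  then have card: "card Orb \<noteq> 0"
    using fin by auto
  \<comment> \<open>one vector of the lattice for each element of the orbit\<close>
  obtain W where W: "W \<subseteq> period_lattice k" "inj_on (\<lambda>w. heis w \<phi>) W" "(\<lambda>w. heis w \<phi>) ` W = Orb"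
    using subset_image_inj[of Orb "\<lambda>w. heis w \<phi>" "period_lattice k"] by (auto simp: Orb_def)
  have "finite W"
    using fin W(2,3) finite_imageD by blast
  then obtain ws where ws: "set ws = W" "distinct ws"
    using finite_distinct_list by blast
  define m where "m = (\<lambda>y. inverse (of_nat (card Orb)) * (\<Sum>h\<in>Orb. h y))"
  have sum: "heis_sum ws \<phi> = (\<lambda>y. \<Sum>h\<in>Orb. h y)"
  proof
    fix y
    have "heis_sum ws \<phi> y = (\<Sum>w\<in>W. heis w \<phi> y)"
      by (simp add: heis_sum_def sum_list_distinct_conv_sum_set ws)
    also have "\<dots> = (\<Sum>h\<in>Orb. h y)"
      using W(2) by (simp add: sum.reindex flip: W(3))
    finally show "heis_sum ws \<phi> y = (\<Sum>h\<in>Orb. h y)" .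
  qed
  have Os: "h \<in> schwartz" if "h \<in> Orb" for h
    using that S by (auto simp: Orb_def schwartz_heis)
  have mS: "m \<in> schwartz"
    unfolding m_def using Os by (intro schwartz_smult schwartz_sum)
  have heis_m: "heis w m = m" if w: "w \<in> period_lattice k" for w
  proof -
    have "heis w h \<in> Orb" if "h \<in> Orb" for h
      using that w by (auto simp: Orb_def heis_heis_period_lattice intro: period_lattice_add)
    then have sub: "heis w ` Orb \<subseteq> Orb"
      by blast
    have inj: "inj_on (heis w) Orb"
    proof (rule inj_onI)
      fix h h'
      assume "h \<in> Orb" "h' \<in> Orb" "heis w h = heis w h'"
      moreover have "heis (- w) (heis w h) = h" for h
        using heis_heis_period_lattice[OF period_lattice_minus[OF w] w] by simp
      ultimately show "h = h'"
        by metis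
    qed
    then have img: "heis w ` Orb = Orb"
      using fin sub by (simp add: endo_inj_surj)
    have "heis w (\<lambda>y. \<Sum>h\<in>Orb. h y) = (\<lambda>y. \<Sum>h\<in>Orb. heis w h y)"
      by (rule heis_sum[OF fin])
    also have "\<dots> = (\<lambda>y. \<Sum>h\<in>heis w ` Orb. h y)"
      using inj by (simp add: sum.reindex)
    finally show ?thesis
      unfolding m_def heis_smult by (simp only: img)
  qed
  then have "m \<in> level k"
    using level_iff_heis[OF mS] by blast
  moreover have "(\<lambda>y. \<phi> y - m y) \<in> avg_kernel k"
  proof -
    have "heis_sum ws m = (\<lambda>y. of_nat (length ws) * m y)"
      using ws(1) W(1) heis_m by (induction ws arbitrary: W) (auto simp: algebra_simps)
    moreover have "length ws = card Orb"
      using ws W(2,3) by (metis card_image distinct_card)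
    ultimately have "heis_sum ws (\<lambda>y. \<phi> y + (- 1) * m y) = (\<lambda>y. 0)"
      unfolding heis_sum_add heis_sum_smult sum using card by (simp add: m_def flip: mult.assoc)
    moreover have "ws \<noteq> []"
      using \<open>length ws = card Orb\<close> card by auto
    moreover have "(\<lambda>y. \<phi> y + (- 1) * m y) \<in> schwartz"
      by (intro schwartz_add schwartz_smult S mS)
    ultimately show ?thesis
      using ws(1) W(1) by (auto simp: avg_kernel_def)
  qed
  ultimately show ?thesis
    by blast
qed

definition proj :: "nat \<Rightarrow> (('a, 'n) vec \<Rightarrow> complex) \<Rightarrow> ('a, 'n) vec \<Rightarrow> complex" where
  "proj k \<phi> = (SOME f. f \<in> level k \<and> (\<lambda>y. \<phi> y - f y) \<in> avg_kernel k)"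

lemma proj:
  assumes "\<phi> \<in> schwartz"
  shows "proj k \<phi> \<in> level k" "(\<lambda>y. \<phi> y - proj k \<phi> y) \<in> avg_kernel k"
  using someI_ex[of "\<lambda>f. f \<in> level k \<and> (\<lambda>y. \<phi> y - f y) \<in> avg_kernel k"] level_plus_avg_kernel[OF assms, of k]
  by (auto simp: proj_def)

lemma proj_unique:
  assumes "\<phi> \<in> schwartz" "f \<in> level k" "(\<lambda>y. \<phi> y - f y) \<in> avg_kernel k"
  shows "proj k \<phi> = f"
proof -
  have "(\<lambda>y. (\<phi> y - f y) - (\<phi> y - proj k \<phi> y)) \<in> avg_kernel k"
    using fun_subspaceD(5)[OF fun_subspace_avg_kernel assms(3) proj(2)[OF assms(1)]] .
  then have "(\<lambda>y. proj k \<phi> y - f y) \<in> avg_kernel k"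
    by simp
  moreover have "(\<lambda>y. proj k \<phi> y - f y) \<in> level k"
    using fun_subspaceD(5)[OF fun_subspace_level proj(1)[OF assms(1)] assms(2)] .
  ultimately have "(\<lambda>y. proj k \<phi> y - f y) = (\<lambda>y. 0)"
    using level_Int_avg_kernel by blast
  then show ?thesis
    by (simp add: fun_eq_iff)
qed

lemma proj_add:
  assumes "\<phi> \<in> schwartz" "\<eta> \<in> schwartz"
  shows "proj k (\<lambda>y. \<phi> y + \<eta> y) = (\<lambda>y. proj k \<phi> y + proj k \<eta> y)"
proof (rule proj_unique)
  have "(\<lambda>y. (\<phi> y - proj k \<phi> y) + (\<eta> y - proj k \<eta> y)) \<in> avg_kernel k"
    using fun_subspaceD(3)[OF fun_subspace_avg_kernel proj(2)[OF assms(1)] proj(2)[OF assms(2)]] .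
  then show "(\<lambda>y. \<phi> y + \<eta> y - (proj k \<phi> y + proj k \<eta> y)) \<in> avg_kernel k"
    by (simp add: algebra_simps)
qed (use assms in \<open>auto intro: schwartz_add fun_subspaceD(3)[OF fun_subspace_level] proj(1)\<close>)

lemma proj_smult:
  assumes "\<phi> \<in> schwartz"
  shows "proj k (\<lambda>y. c * \<phi> y) = (\<lambda>y. c * proj k \<phi> y)"
proof (rule proj_unique)
  have "(\<lambda>y. c * (\<phi> y - proj k \<phi> y)) \<in> avg_kernel k"
    using fun_subspaceD(4)[OF fun_subspace_avg_kernel proj(2)[OF assms]] .
  then show "(\<lambda>y. c * \<phi> y - c * proj k \<phi> y) \<in> avg_kernel k"
    by (simp add: algebra_simps)
qed (use assms in \<open>auto intro: schwartz_smult fun_subspaceD(4)[OF fun_subspace_level] proj(1)\<close>)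

lemma A_diff:
  "g \<in> carrier Mp \<Longrightarrow> \<phi> \<in> schwartz \<Longrightarrow> \<eta> \<in> schwartz \<Longrightarrow>
    A g (\<lambda>y. \<phi> y - \<eta> y) = (\<lambda>y. A g \<phi> y - A g \<eta> y)"
  using A_add[of g \<phi> "\<lambda>y. - 1 * \<eta> y"] A_smult[of g \<eta> "- 1"] schwartz_smult[of \<eta> "- 1"] by simp

lemma proj_A:
  assumes "g \<in> K" "\<phi> \<in> schwartz"
  shows "proj k (A g \<phi>) = A g (proj k \<phi>)"
proof (rule proj_unique)
  have "A g (\<lambda>y. \<phi> y - proj k \<phi> y) \<in> avg_kernel k"
    by (rule A_avg_kernel[OF assms(1) proj(2)[OF assms(2)]])
  then show "(\<lambda>y. A g \<phi> y - A g (proj k \<phi>) y) \<in> avg_kernel k"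
    by (simp add: A_diff K_carrier[OF assms(1)] assms(2) level_schwartz[OF proj(1)[OF assms(2)]])
qed (use assms in \<open>auto intro: A_closed K_carrier A_level proj(1)\<close>)

lemma level_reflect: "\<phi> \<in> level k \<Longrightarrow> (\<lambda>y. \<phi> (- y)) \<in> level k"
proof -
  assume \<phi>: "\<phi> \<in> level k"
  have "heis w (\<lambda>y. \<phi> (- y)) = (\<lambda>y. \<phi> (- y))" if "w \<in> period_lattice k" for w
    using \<phi> period_lattice_minus[OF that] level_iff_heis[OF level_schwartz[OF \<phi>]]
    by (simp add: heis_reflect)
  then show ?thesis
    using level_iff_heis[OF schwartz_reflect[OF level_schwartz[OF \<phi>]]] by blast
qed

lemma proj_reflect:
  assumes "\<phi> \<in> schwartz"
  shows "proj k (\<lambda>y. \<phi> (- y)) = (\<lambda>y. proj k \<phi> (- y))"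
  using avg_kernel_reflect[OF proj(2)[OF assms, of k]]
  by (intro proj_unique schwartz_reflect assms level_reflect proj) simp

lemma proj_parity:
  assumes "\<phi> \<in> parity s schwartz"
  shows "proj k \<phi> \<in> parity s (level k)"
proof -
  have \<phi>: "\<phi> \<in> schwartz" "(\<lambda>y. \<phi> (- y)) = (\<lambda>y. s * \<phi> y)"
    using assms by (auto simp: parity_def)
  have "(\<lambda>y. proj k \<phi> (- y)) = (\<lambda>y. s * proj k \<phi> y)"
    using proj_reflect[OF \<phi>(1)] proj_smult[OF \<phi>(1)] \<phi>(2) by simp
  then show ?thesis
    using proj(1)[OF \<phi>(1)] by (simp add: parity_def fun_eq_iff)
qed

lemma proj_level: "\<phi> \<in> level j \<Longrightarrow> j \<le> k \<Longrightarrow> proj k \<phi> = \<phi>"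
  using level_mono fun_subspaceD(2)[OF fun_subspace_avg_kernel]
  by (intro proj_unique level_schwartz) auto

lemma proj_avg_kernel: "\<phi> \<in> avg_kernel j \<Longrightarrow> k \<le> j \<Longrightarrow> proj k \<phi> = (\<lambda>y. 0)"
  using avg_kernel_antimono fun_subspaceD(1)[OF fun_subspace_avg_kernel] fun_subspaceD(2)[OF fun_subspace_level]
  by (intro proj_unique) auto

section \<open>The irreducible components\<close>

text \<open>
  For \<open>k > 0\<close>, intersecting with the invariant complement \<open>avg_kernel (k - 1)\<close> of level \<open>k - 1\<close>
  gives an invariant complement of this level within level \<open>k\<close>, for each parity.
\<close>

definition component :: "nat \<Rightarrow> complex \<Rightarrow> (('a, 'n) vec \<Rightarrow> complex) set" where
  "component k s = parity s (level k) \<inter> (if k = 0 then schwartz else avg_kernel (k - 1))"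

lemma K_subspace_component: "K_subspace (component k s)"
proof -
  have "fun_subspace (if k = 0 then schwartz else avg_kernel (k - 1))"
    by (simp add: fun_subspace_schwartz fun_subspace_avg_kernel)
  then have "fun_subspace (component k s)"
    unfolding component_def by (intro fun_subspace_Int fun_subspace_parity fun_subspace_level)
  then show ?thesis
    unfolding K_subspace_def using K_subspaceD(2)[OF K_subspace_parity_level] A_closed K_carrier A_avg_kernel
    by (auto simp: component_def)
qed

text \<open>
  For \<open>k > 0\<close>, adding the lower level to a nonzero \<open>U\<close> gives an invariant subspace between two consecutive levels, which
  is everything; as the lower level meets the complement trivially, \<open>U\<close> is the whole component.
\<close>

lemma component_irreducible:
  assumes s: "s = 1 \<or> s = - 1" and U: "K_subspace U" "U \<subseteq> component k s"
  shows "U = {\<lambda>y. 0} \<or> U = component k s"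
proof (cases "U \<subseteq> {\<lambda>y. 0}")
  case True
  then show ?thesis
    using fun_subspaceD(2)[OF K_subspaceD(1)[OF U(1)]] by blast
next
  case nontrivial: False
  show ?thesis
  proof (cases k)
    case 0
    then have "component k s = parity s (level 0)"
      using level_schwartz by (auto simp: component_def parity_def)
    then show ?thesis
      using s U nontrivial invariant_even_level_0 invariant_odd_level_0 by metis
  next
    case (Suc l)
    note sub = K_subspaceD(1)[OF U(1)]
    have Upar: "U \<subseteq> parity s (level k)" and Uker: "U \<subseteq> avg_kernel l"
      using U(2) Suc by (auto simp: component_def)
    have fl: "fun_subspace (parity s (level l))"
      by (intro fun_subspace_parity fun_subspace_level)
    define V where "V = {\<lambda>y. u y + f y | u f. u \<in> U \<and> f \<in> parity s (level l)}"
    have VI: "(\<lambda>y. u y + f y) \<in> V" if "u \<in> U" "f \<in> parity s (level l)" for u f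
      using that by (auto simp: V_def)
    have "K_subspace V"
      unfolding K_subspace_def fun_subspace_def
    proof (intro conjI ballI allI)
      show "V \<subseteq> schwartz"
        using fun_subspaceD(1)[OF sub] fun_subspaceD(1)[OF fl] by (auto simp: V_def intro: schwartz_add)
      show "(\<lambda>y. 0) \<in> V"
        using VI[OF fun_subspaceD(2)[OF sub] fun_subspaceD(2)[OF fl]] by simp
      fix \<phi>
      assume "\<phi> \<in> V"
      then obtain u f where u: "u \<in> U" "f \<in> parity s (level l)" "\<phi> = (\<lambda>y. u y + f y)"
        by (auto simp: V_def)
      show "(\<lambda>y. c * \<phi> y) \<in> V" for c
        using VI[OF fun_subspaceD(4)[OF sub u(1), of c] fun_subspaceD(4)[OF fl u(2), of c]]
        by (simp add: u(3) algebra_simps)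
      show "A g \<phi> \<in> V" if "g \<in> K" for g
        using VI[OF K_subspaceD(2)[OF U(1) that u(1)] K_subspaceD(2)[OF K_subspace_parity_level that u(2)]]
          A_add[OF K_carrier[OF that] fun_subspaceD(1)[OF sub u(1)] fun_subspaceD(1)[OF fl u(2)]]
        by (simp add: u(3))
      fix \<eta>
      assume "\<eta> \<in> V"
      then obtain v h where v: "v \<in> U" "h \<in> parity s (level l)" "\<eta> = (\<lambda>y. v y + h y)"
        by (auto simp: V_def)
      show "(\<lambda>y. \<phi> y + \<eta> y) \<in> V"
        using VI[OF fun_subspaceD(3)[OF sub u(1) v(1)] fun_subspaceD(3)[OF fl u(2) v(2)]]
        by (simp add: u(3) v(3) algebra_simps)
    qed
    moreover have "V \<subseteq> parity s (level (Suc l))"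
    proof -
      have "parity s (level l) \<subseteq> parity s (level k)"
        using level_Suc Suc by (auto simp: parity_def)
      then show ?thesis
        using Upar fun_subspaceD(3)[OF fun_subspace_parity[OF fun_subspace_level, of s k]]
        unfolding V_def Suc by blast
    qed
    moreover have "\<not> V \<subseteq> level l"
    proof -
      obtain u where u: "u \<in> U" "u \<noteq> (\<lambda>y. 0)"
        using nontrivial by blast
      then have "u \<in> V"
        using VI[OF u(1) fun_subspaceD(2)[OF fl]] by simp
      moreover have "u \<notin> level l"
        using level_Int_avg_kernel u Uker by blast
      ultimately show ?thesis
        by blast
    qed
    moreover have "parity s (level l) \<subseteq> V"
      using VI[OF fun_subspaceD(2)[OF sub]] by auto
    ultimately have V: "V = parity s (level (Suc l))"
      by (rule invariant_between_levels)
    have "component k s \<subseteq> U"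
    proof
      fix \<phi>
      assume \<phi>: "\<phi> \<in> component k s"
      then have "\<phi> \<in> V" "\<phi> \<in> avg_kernel l"
        using Suc V by (auto simp: component_def)
      then obtain u f where u: "u \<in> U" "f \<in> parity s (level l)" "\<phi> = (\<lambda>y. u y + f y)"
        by (auto simp: V_def)
      have "(\<lambda>y. \<phi> y - u y) \<in> avg_kernel l"
        using fun_subspaceD(5)[OF fun_subspace_avg_kernel \<open>\<phi> \<in> avg_kernel l\<close>] u(1) Uker by blast
      then have "f \<in> avg_kernel l"
        by (simp add: u(3))
      then have "f = (\<lambda>y. 0)"
        using u(2) level_Int_avg_kernel by (auto simp: parity_def)
      then show "\<phi> \<in> U"
        using u by simp
    qed
    then show ?thesis
      using U(2) by blast
  qed
qed

definition parity_part :: "complex \<Rightarrow> (('a, 'n) vec \<Rightarrow> complex) \<Rightarrow> ('a, 'n) vec \<Rightarrow> complex" where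
  "parity_part s \<phi> = (\<lambda>y. (\<phi> y + s * \<phi> (- y)) / 2)"

definition proj_component :: "nat \<Rightarrow> complex \<Rightarrow> (('a, 'n) vec \<Rightarrow> complex) \<Rightarrow> ('a, 'n) vec \<Rightarrow> complex" where
  "proj_component k s \<phi> = (\<lambda>y. proj k (parity_part s \<phi>) y - (if k = 0 then 0 else proj (k - 1) (parity_part s \<phi>) y))"

lemma parity_part_eq: "parity_part s \<phi> = (\<lambda>y. 1/2 * \<phi> y + s / 2 * \<phi> (- y))"
  by (simp add: parity_part_def add_divide_distrib)

lemma parity_part_schwartz: "\<phi> \<in> schwartz \<Longrightarrow> parity_part s \<phi> \<in> schwartz"
  unfolding parity_part_eq by (intro schwartz_add schwartz_smult schwartz_reflect)

lemma parity_part_parity: "s = 1 \<or> s = - 1 \<Longrightarrow> \<phi> \<in> schwartz \<Longrightarrow> parity_part s \<phi> \<in> parity s schwartz"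
  using parity_part_schwartz[of \<phi> s] by (auto simp: parity_def) (auto simp: parity_part_def field_simps)

lemma parity_part_of_parity:
  assumes "s = 1 \<or> s = - 1" "t = 1 \<or> t = - 1" "\<phi> \<in> parity t schwartz"
  shows "parity_part s \<phi> = (if s = t then \<phi> else (\<lambda>y. 0))"
  using assms by (auto simp: parity_part_def parity_def)

lemma parity_part_add: "parity_part s (\<lambda>y. \<phi> y + \<eta> y) = (\<lambda>y. parity_part s \<phi> y + parity_part s \<eta> y)"
  by (auto simp: parity_part_def field_simps)

lemma parity_part_smult: "parity_part s (\<lambda>y. c * \<phi> y) = (\<lambda>y. c * parity_part s \<phi> y)"
  by (auto simp: parity_part_def field_simps)

lemma parity_part_A: "g \<in> carrier Mp \<Longrightarrow> \<phi> \<in> schwartz \<Longrightarrow> parity_part s (A g \<phi>) = A g (parity_part s \<phi>)"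
  unfolding parity_part_eq by (simp only: A_add A_smult A_reflect schwartz_smult schwartz_reflect)

lemma proj_component_add:
  "\<phi> \<in> schwartz \<Longrightarrow> \<eta> \<in> schwartz \<Longrightarrow> proj_component k s (\<lambda>y. \<phi> y + \<eta> y) = (\<lambda>y. proj_component k s \<phi> y + proj_component k s \<eta> y)"
  by (auto simp: proj_component_def parity_part_add proj_add parity_part_schwartz)

lemma proj_component_smult: "\<phi> \<in> schwartz \<Longrightarrow> proj_component k s (\<lambda>y. c * \<phi> y) = (\<lambda>y. c * proj_component k s \<phi> y)"
  by (auto simp: proj_component_def parity_part_smult proj_smult parity_part_schwartz algebra_simps)

lemma proj_component_sum:
  "finite I \<Longrightarrow> (\<And>i. i \<in> I \<Longrightarrow> f i \<in> schwartz) \<Longrightarrow>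
    proj_component k s (\<lambda>y. \<Sum>i\<in>I. f i y) = (\<lambda>y. \<Sum>i\<in>I. proj_component k s (f i) y)"
proof (induction I rule: finite_induct)
  case empty
  then show ?case
    using proj_component_smult[of "\<lambda>y. 0" k s 0] by simp
qed (simp add: proj_component_add schwartz_sum)

lemma proj_component_A:
  assumes "g \<in> K" "\<phi> \<in> schwartz"
  shows "proj_component k s (A g \<phi>) = A g (proj_component k s \<phi>)"
  using assms K_carrier[OF assms(1)]
  by (auto simp: proj_component_def parity_part_A proj_A parity_part_schwartz A_diff level_schwartz[OF proj(1)])

lemma proj_component_in_component:
  assumes "s = 1 \<or> s = - 1" "\<phi> \<in> schwartz"
  shows "proj_component k s \<phi> \<in> component k s"
proof (cases k)
  case 0
  then show ?thesis
    using proj_parity[OF parity_part_parity[OF assms], of 0] level_schwartz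
    by (auto simp: proj_component_def component_def parity_def)
next
  case (Suc l)
  note S = parity_part_schwartz[OF assms(2), of s]
  note par = proj_parity[OF parity_part_parity[OF assms]]
  have "proj l (parity_part s \<phi>) \<in> parity s (level k)"
    using par[of l] level_Suc Suc by (auto simp: parity_def)
  then have "proj_component k s \<phi> \<in> parity s (level k)"
    using fun_subspaceD(5)[OF fun_subspace_parity[OF fun_subspace_level] par[of k]] Suc by (simp add: proj_component_def)
  moreover have "(\<lambda>y. (parity_part s \<phi> y - proj l (parity_part s \<phi>) y) - (parity_part s \<phi> y - proj k (parity_part s \<phi>) y)) \<in> avg_kernel l"
    using proj(2)[OF S, of l] proj(2)[OF S, of k] avg_kernel_antimono[of l k] Suc
    by (intro fun_subspaceD(5)[OF fun_subspace_avg_kernel, of "\<lambda>y. parity_part s \<phi> y - proj l (parity_part s \<phi>) y"]) auto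
  then have "proj_component k s \<phi> \<in> avg_kernel l"
    by (simp add: proj_component_def Suc)
  ultimately show ?thesis
    by (simp add: component_def Suc)
qed

lemma proj_component_component:
  assumes s: "s = 1 \<or> s = - 1" "t = 1 \<or> t = - 1" and \<phi>: "\<phi> \<in> component j t"
  shows "proj_component k s \<phi> = (if k = j \<and> s = t then \<phi> else (\<lambda>y. 0))"
proof -
  have lev: "\<phi> \<in> level j" and S: "\<phi> \<in> parity t schwartz"
    using \<phi> level_schwartz by (auto simp: component_def parity_def)
  have 0: "proj i (\<lambda>y. 0) = (\<lambda>y. 0)" for i
    using proj_smult[of "\<lambda>y. 0" i 0] by simp
  have pr: "proj i \<phi> = (if j \<le> i then \<phi> else (\<lambda>y. 0))" for i
  proof (cases "j \<le> i")
    case False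
    then have "\<phi> \<in> avg_kernel (j - 1)" "i \<le> j - 1"
      using \<phi> by (auto simp: component_def split: if_splits)
    then show ?thesis
      using False proj_avg_kernel by auto
  qed (use proj_level lev in simp)
  show ?thesis
    unfolding proj_component_def parity_part_of_parity[OF s S] using 0 pr \<phi> by (auto simp: fun_eq_iff)
qed

lemma proj_component_vanishes:
  assumes "s = 1 \<or> s = - 1" "\<phi> \<in> level j" "j < k"
  shows "proj_component k s \<phi> = (\<lambda>y. 0)"
proof -
  have "(\<lambda>y. \<phi> (- y)) \<in> level j"
    by (rule level_reflect[OF assms(2)])
  then have "parity_part s \<phi> \<in> level j"
    unfolding parity_part_eq using assms(2) fun_subspaceD(3,4)[OF fun_subspace_level] by metis
  then show ?thesis
    using proj_level[of "parity_part s \<phi>" j k] proj_level[of "parity_part s \<phi>" j "k - 1"] assms(3) by (auto simp: proj_component_def)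
qed

lemma proj_component_injective:
  assumes \<phi>: "\<phi> \<in> schwartz" and zero: "\<And>k s. s = 1 \<or> s = - 1 \<Longrightarrow> proj_component k s \<phi> = (\<lambda>y. 0)"
  shows "\<phi> = (\<lambda>y. 0)"
proof -
  have "parity_part s \<phi> = (\<lambda>y. 0)" if s: "s = 1 \<or> s = - 1" for s
  proof -
    have "proj k (parity_part s \<phi>) = (\<lambda>y. 0)" for k
    proof (induction k)
      case 0
      then show ?case
        using zero[OF s, of 0] by (simp add: proj_component_def)
    next
      case (Suc k)
      then show ?case
        using zero[OF s, of "Suc k"] by (simp add: proj_component_def)
    qed
    moreover obtain j where "parity_part s \<phi> \<in> level j"
      using in_some_level[OF parity_part_schwartz[OF \<phi>]] by blast
    ultimately show ?thesis
      using proj_level[of "parity_part s \<phi>" j j] by simp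
  qed
  then have "parity_part 1 \<phi> y + parity_part (- 1) \<phi> y = 0" for y
    by simp
  then show ?thesis
    by (simp add: parity_part_def fun_eq_iff flip: add_divide_distrib)
qed

abbreviation weil_rep :: "('g, ('a, 'n) vec \<Rightarrow> complex) rep" where
  "weil_rep \<equiv> schwartz_rep A"

abbreviation K_group :: "'g monoid" where
  "K_group \<equiv> metaplectic_K Mp p \<pi> r"

lemma K_group_simps [simp]:
  "carrier K_group = K" "mult K_group = mult Mp" "one K_group = one Mp"
  by (simp_all add: metaplectic_K_def K_def)

lemma group_K: "group K_group"
proof -
  have eq: "K_group = Mp\<lparr>carrier := K\<rparr>"
    by (simp add: metaplectic_K_def K_def)
  show ?thesis
    unfolding eq by (rule Mp.subgroup_imp_group[OF subgroup_K])
qed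

lemma sub_rep_simps [simp]:
  "carrier (sub_rep weil_rep U) = U" "zero (sub_rep weil_rep U) = (\<lambda>y. 0)"
  "add (sub_rep weil_rep U) = (\<lambda>\<phi> \<eta> y. \<phi> y + \<eta> y)" "smult (sub_rep weil_rep U) = (\<lambda>c \<phi> y. c * \<phi> y)"
  "act (sub_rep weil_rep U) = A"
  by (simp_all add: sub_rep_def schwartz_rep_def)

lemma weil_rep_eq: "weil_rep = sub_rep weil_rep schwartz"
  by (simp add: sub_rep_def schwartz_rep_def)

lemma is_rep_sub:
  assumes "K_subspace U"
  shows "is_rep K_group (sub_rep weil_rep U)"
proof -
  note sub = fun_subspaceD[OF K_subspaceD(1)[OF assms]]
  have "abelian_group (sub_rep weil_rep U)"
  proof (rule abelian_groupI)
    fix \<phi>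
    assume "\<phi> \<in> carrier (sub_rep weil_rep U)"
    then show "\<exists>\<eta>\<in>carrier (sub_rep weil_rep U). \<eta> \<oplus>\<^bsub>sub_rep weil_rep U\<^esub> \<phi> = \<zero>\<^bsub>sub_rep weil_rep U\<^esub>"
      using sub(4)[of \<phi> "- 1"] by (intro bexI[of _ "\<lambda>y. - 1 * \<phi> y"]) auto
  qed (auto simp: sub(2,3) algebra_simps)
  then have "Module.module complex_ring (sub_rep weil_rep U)"
    by (intro Module.moduleI cring_complex_ring) (auto simp: sub(3,4) algebra_simps)
  moreover have "A g \<in> linear_maps (sub_rep weil_rep U) (sub_rep weil_rep U)" if "g \<in> K" for g
    using K_subspaceD(2)[OF assms that] K_carrier[OF that] sub(1)
    by (auto simp: linear_maps_def hom_def A_add A_smult)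
  ultimately show ?thesis
    using group_K sub(1) K_carrier by (auto simp: is_rep_def A_one A_mult)
qed

lemma K_subspace_schwartz: "K_subspace schwartz"
  using A_closed K_carrier by (simp add: K_subspace_def fun_subspace_schwartz)

lemma submodule_fun_subspace:
  assumes X: "K_subspace X" and U: "Module.submodule U complex_ring (sub_rep weil_rep X)"
  shows "fun_subspace U" "U \<subseteq> X"
proof -
  interpret X: Module.module complex_ring "sub_rep weil_rep X"
    using is_rep_sub[OF X] by (simp add: is_rep_def)
  note sub = X.submoduleE[OF U, simplified]
  have "(\<lambda>y. 0) \<in> U"
    using subgroup.one_closed[of U "add_monoid (sub_rep weil_rep X)"] U by (simp add: submodule_def)
  then show "fun_subspace U" "U \<subseteq> X"
    using sub fun_subspaceD(1)[OF K_subspaceD(1)[OF X]] by (auto simp: fun_subspace_def)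
qed

lemma irreducible_component:
  assumes "s = 1 \<or> s = - 1" "component k s \<noteq> {\<lambda>y. 0}"
  shows "irreducible_rep K_group (sub_rep weil_rep (component k s))"
  unfolding irreducible_rep_def
proof (intro conjI allI impI)
  show "is_rep K_group (sub_rep weil_rep (component k s))"
    by (rule is_rep_sub[OF K_subspace_component])
  show "nonzero_rep (sub_rep weil_rep (component k s))"
    using assms(2) by (simp add: nonzero_rep_def)
  fix U
  assume U: "Module.submodule U complex_ring (sub_rep weil_rep (component k s)) \<and>
      (\<forall>g\<in>carrier K_group. act (sub_rep weil_rep (component k s)) g ` U \<subseteq> U)"
  have "fun_subspace U" "U \<subseteq> component k s"
    using submodule_fun_subspace[OF K_subspace_component] U by blast+
  moreover have "K_subspace U"
    using \<open>fun_subspace U\<close> U by (auto simp: K_subspace_def)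
  ultimately show "U = {\<zero>\<^bsub>sub_rep weil_rep (component k s)\<^esub>} \<or> U = carrier (sub_rep weil_rep (component k s))"
    using component_irreducible[OF assms(1)] by simp
qed

section \<open>Quotients as components\<close>

definition fun_coset :: "(('a, 'n) vec \<Rightarrow> complex) set \<Rightarrow> (('a, 'n) vec \<Rightarrow> complex) \<Rightarrow>
    (('a, 'n) vec \<Rightarrow> complex) set" where
  "fun_coset Y f = (\<lambda>h y. h y + f y) ` Y"

lemma a_r_coset_eq: "Y +>\<^bsub>sub_rep weil_rep X\<^esub> f = fun_coset Y f"
  by (auto simp: a_r_coset_def r_coset_def fun_coset_def)

lemma quotient_rep_simps:
  "carrier (quotient_rep (sub_rep weil_rep X) Y) = fun_coset Y ` X"
  "zero (quotient_rep (sub_rep weil_rep X) Y) = Y"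
  "add (quotient_rep (sub_rep weil_rep X) Y) B C = (\<Union>\<phi>\<in>B. \<Union>\<eta>\<in>C. {\<lambda>y. \<phi> y + \<eta> y})"
  "smult (quotient_rep (sub_rep weil_rep X) Y) c B = (\<Union>\<phi>\<in>B. fun_coset Y (\<lambda>y. c * \<phi> y))"
  "act (quotient_rep (sub_rep weil_rep X) Y) g B = A g ` B"
proof -
  have "a_rcosets\<^bsub>sub_rep weil_rep X\<^esub> Y = fun_coset Y ` X"
    by (auto simp: A_RCOSETS_def' a_r_coset_eq)
  then show "carrier (quotient_rep (sub_rep weil_rep X) Y) = fun_coset Y ` X"
    by (simp add: quotient_rep_def)
qed (simp_all add: quotient_rep_def a_r_coset_eq set_add_def set_mult_def)

lemma fun_coset_mem: "x \<in> fun_coset Y f \<longleftrightarrow> (\<exists>h\<in>Y. x = (\<lambda>y. h y + f y))"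
  by (auto simp: fun_coset_def)

lemma fun_coset_eqD:
  assumes Y: "fun_subspace Y" and eq: "fun_coset Y f = fun_coset Y g"
  shows "(\<lambda>y. f y - g y) \<in> Y"
proof -
  have "f \<in> fun_coset Y f"
    using fun_subspaceD(2)[OF Y] by (auto simp: fun_coset_mem intro!: bexI[of _ "\<lambda>y. 0"])
  then obtain h where "h \<in> Y" "f = (\<lambda>y. h y + g y)"
    unfolding eq fun_coset_mem by blast
  then show ?thesis
    by simp
qed

lemma fun_coset_add_mem:
  assumes Y: "fun_subspace Y" and h: "h \<in> Y"
  shows "fun_coset Y (\<lambda>y. f y + h y) = fun_coset Y f"
proof (intro equalityI subsetI)
  fix x
  assume "x \<in> fun_coset Y (\<lambda>y. f y + h y)"
  then obtain k where "k \<in> Y" "x = (\<lambda>y. k y + (f y + h y))"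
    by (auto simp: fun_coset_mem)
  then show "x \<in> fun_coset Y f"
    using fun_subspaceD(3)[OF Y _ h] by (auto simp: fun_coset_mem add_ac intro!: bexI[of _ "\<lambda>y. k y + h y"])
next
  fix x
  assume "x \<in> fun_coset Y f"
  then obtain k where "k \<in> Y" "x = (\<lambda>y. k y + f y)"
    by (auto simp: fun_coset_mem)
  then show "x \<in> fun_coset Y (\<lambda>y. f y + h y)"
    using fun_subspaceD(5)[OF Y _ h] by (auto simp: fun_coset_mem intro!: bexI[of _ "\<lambda>y. k y - h y"])
qed

lemma fun_coset_add:
  assumes Y: "fun_subspace Y"
  shows "(\<Union>\<phi>\<in>fun_coset Y f. \<Union>\<eta>\<in>fun_coset Y g. {\<lambda>y. \<phi> y + \<eta> y}) = fun_coset Y (\<lambda>y. f y + g y)"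
proof (intro equalityI subsetI)
  fix x
  assume "x \<in> (\<Union>\<phi>\<in>fun_coset Y f. \<Union>\<eta>\<in>fun_coset Y g. {\<lambda>y. \<phi> y + \<eta> y})"
  then obtain h k where hk: "h \<in> Y" "k \<in> Y" "x = (\<lambda>y. (h y + f y) + (k y + g y))"
    by (auto simp: fun_coset_mem)
  then show "x \<in> fun_coset Y (\<lambda>y. f y + g y)"
    using fun_subspaceD(3)[OF Y hk(1,2)]
    by (auto simp: fun_coset_mem add_ac intro!: bexI[of _ "\<lambda>y. h y + k y"])
next
  fix x
  assume "x \<in> fun_coset Y (\<lambda>y. f y + g y)"
  then obtain h where h: "h \<in> Y" "x = (\<lambda>y. h y + (f y + g y))"
    by (auto simp: fun_coset_mem)
  have "(\<lambda>y. h y + f y) \<in> fun_coset Y f"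
    using h(1) by (auto simp: fun_coset_mem)
  moreover have "g \<in> fun_coset Y g"
    using fun_subspaceD(2)[OF Y] by (auto simp: fun_coset_mem intro!: bexI[of _ "\<lambda>y. 0"])
  moreover have "x = (\<lambda>y. (\<lambda>y. h y + f y) y + g y)"
    by (simp add: h(2) add.assoc)
  ultimately show "x \<in> (\<Union>\<phi>\<in>fun_coset Y f. \<Union>\<eta>\<in>fun_coset Y g. {\<lambda>y. \<phi> y + \<eta> y})"
    by blast
qed

lemma fun_coset_smult:
  assumes Y: "fun_subspace Y"
  shows "(\<Union>\<phi>\<in>fun_coset Y f. fun_coset Y (\<lambda>y. c * \<phi> y)) = fun_coset Y (\<lambda>y. c * f y)"
proof -
  have "fun_coset Y (\<lambda>y. c * \<phi> y) = fun_coset Y (\<lambda>y. c * f y)" if \<phi>: "\<phi> \<in> fun_coset Y f" for \<phi>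
  proof -
    obtain h where h: "h \<in> Y" "\<phi> = (\<lambda>y. h y + f y)"
      using \<phi> by (auto simp: fun_coset_mem)
    have "(\<lambda>y. c * \<phi> y) = (\<lambda>y. c * f y + c * h y)"
      by (simp add: h(2) algebra_simps)
    then show ?thesis
      using fun_coset_add_mem[OF Y fun_subspaceD(4)[OF Y h(1)]] by simp
  qed
  moreover have "f \<in> fun_coset Y f"
    using fun_subspaceD(2)[OF Y] by (auto simp: fun_coset_mem intro!: bexI[of _ "\<lambda>y. 0"])
  ultimately show ?thesis
    by blast
qed

lemma fun_coset_act:
  assumes Y: "K_subspace Y" and f: "f \<in> schwartz" and g: "g \<in> K"
  shows "A g ` fun_coset Y f = fun_coset Y (A g f)"
proof -
  note G = K_carrier[OF g]
  note YS = fun_subspaceD(1)[OF K_subspaceD(1)[OF Y]]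
  have "A g ` Y = Y"
  proof (intro equalityI subsetI)
    fix h
    assume h: "h \<in> Y"
    then have "h = A g (A (inv\<^bsub>Mp\<^esub> g) h)"
      using A_inv(2)[OF G YS] by simp
    then show "h \<in> A g ` Y"
      using K_subspaceD(2)[OF Y K_inv[OF g] h] by blast
  qed (use K_subspaceD(2)[OF Y g] in blast)
  moreover have "A g ` fun_coset Y f = (\<lambda>h y. A g h y + A g f y) ` Y"
    unfolding fun_coset_def image_image using YS f by (intro image_cong) (auto simp: A_add G)
  ultimately show ?thesis
    unfolding fun_coset_def by (simp only: image_image[symmetric, of "\<lambda>h y. h y + A g f y" "A g" Y])
qed

abbreviation level_quotient :: "nat \<Rightarrow> complex \<Rightarrow> ('g, (('a, 'n) vec \<Rightarrow> complex) set) rep" where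
  "level_quotient k s \<equiv> quotient_rep (sub_rep weil_rep (parity s (level k))) (parity s (level (k - 1)))"

text \<open>
  Subtracting the projection to the lower level from a function does not change its class, so each
  class is represented by an element of the component.
\<close>

lemma component_transport:
  assumes s: "s = 1 \<or> s = - 1" and k: "1 \<le> k"
  shows "rep_transport K_group (sub_rep weil_rep (component k s)) (level_quotient k s)
    (fun_coset (parity s (level (k - 1))))"
proof -
  let ?Y = "parity s (level (k - 1))"
  have Y: "K_subspace ?Y" "fun_subspace ?Y"
    using K_subspace_parity_level K_subspaceD(1) by blast+
  have S: "f \<in> schwartz" if "f \<in> component k s" for f
    using that fun_subspaceD(1)[OF K_subspaceD(1)[OF K_subspace_component]] by blast
  have inj: "inj_on (fun_coset ?Y) (component k s)"
  proof (rule inj_onI)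
    fix f g
    assume fg: "f \<in> component k s" "g \<in> component k s" "fun_coset ?Y f = fun_coset ?Y g"
    have "(\<lambda>y. f y - g y) \<in> component k s"
      using fun_subspaceD(5)[OF K_subspaceD(1)[OF K_subspace_component] fg(1,2)] .
    then have "(\<lambda>y. f y - g y) \<in> avg_kernel (k - 1)"
      using k by (simp add: component_def)
    moreover have "(\<lambda>y. f y - g y) \<in> level (k - 1)"
      using fun_coset_eqD[OF Y(2) fg(3)] by (simp add: parity_def)
    ultimately have "(\<lambda>y. f y - g y) = (\<lambda>y. 0)"
      using level_Int_avg_kernel by blast
    then show "f = g"
      by (simp add: fun_eq_iff)
  qed
  have "fun_coset ?Y ` component k s = fun_coset ?Y ` parity s (level k)"
  proof (intro equalityI subsetI)
    fix B
    assume "B \<in> fun_coset ?Y ` parity s (level k)"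
    then obtain f where f: "f \<in> parity s (level k)" "B = fun_coset ?Y f"
      by blast
    have fS: "f \<in> parity s schwartz"
      using f(1) level_schwartz by (auto simp: parity_def)
    then have f': "f \<in> schwartz" "parity_part s f = f"
      using parity_part_of_parity[OF s s fS] by (auto simp: parity_def)
    have "proj k f = f"
      using f(1) by (intro proj_level[of f k]) (auto simp: parity_def)
    then have c: "proj_component k s f = (\<lambda>y. f y - proj (k - 1) f y)"
      using k by (auto simp: proj_component_def f')
    have "f = (\<lambda>y. proj_component k s f y + proj (k - 1) f y)"
      by (simp add: c)
    then have "B = fun_coset ?Y (proj_component k s f)"
      using f(2) fun_coset_add_mem[OF Y(2) proj_parity[OF fS]] by metis
    then show "B \<in> fun_coset ?Y ` component k s"
      using proj_component_in_component[OF s f'(1)] by blast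
  qed (auto simp: component_def)
  then have bij: "bij_betw (fun_coset ?Y) (component k s) (carrier (level_quotient k s))"
    using inj by (simp add: bij_betw_def quotient_rep_simps)
  show ?thesis
  proof
    show "is_rep K_group (sub_rep weil_rep (component k s))"
      by (rule is_rep_sub[OF K_subspace_component])
    show "bij_betw (fun_coset ?Y) (carrier (sub_rep weil_rep (component k s))) (carrier (level_quotient k s))"
      using bij by simp
    show "fun_coset ?Y \<zero>\<^bsub>sub_rep weil_rep (component k s)\<^esub> = \<zero>\<^bsub>level_quotient k s\<^esub>"
      by (simp add: fun_coset_def quotient_rep_simps)
  qed (simp_all add: quotient_rep_simps fun_coset_add[OF Y(2)] fun_coset_smult[OF Y(2)]
      fun_coset_act[OF Y(1)] S del: One_nat_def)
qed

lemma even_part_eq: "even_part U = parity 1 U" and odd_part_eq: "odd_part U = parity (- 1) U"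
  by (simp_all add: even_part_def odd_part_def parity_def)

lemma component_0: "component 0 s = parity s (level 0)"
  using level_schwartz by (auto simp: component_def parity_def)

lemma omega_rep_eq:
  "omega_rep \<pi> r weil_rep even_part = sub_rep weil_rep (component 0 1)"
  "omega_rep \<pi> r weil_rep odd_part = sub_rep weil_rep (component 0 (- 1))"
  by (simp_all add: omega_rep_def S_lower_eq_level even_part_eq odd_part_eq component_0)

lemma mu_rep_eq:
  assumes "1 \<le> m"
  shows "mu_rep \<pi> r weil_rep even_part m = level_quotient (2 * m - 1) 1"
    "mu_rep \<pi> r weil_rep odd_part m = level_quotient (2 * m - 1) (- 1)"
proof -
  have "2 * (m - 1) = 2 * m - 1 - 1"
    using assms by simp
  then show "mu_rep \<pi> r weil_rep even_part m = level_quotient (2 * m - 1) 1"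
    "mu_rep \<pi> r weil_rep odd_part m = level_quotient (2 * m - 1) (- 1)"
    unfolding mu_rep_def S_upper_eq_level[OF assms] S_lower_eq_level even_part_eq odd_part_eq by metis+
qed

lemma nu_rep_eq:
  assumes "1 \<le> m"
  shows "nu_rep \<pi> r weil_rep even_part m = level_quotient (2 * m) 1"
    "nu_rep \<pi> r weil_rep odd_part m = level_quotient (2 * m) (- 1)"
  unfolding nu_rep_def S_upper_eq_level[OF assms] S_lower_eq_level even_part_eq odd_part_eq by simp_all

lemma irreducible_omega:
  assumes "s = 1 \<or> s = - 1" "nonzero_rep (sub_rep weil_rep (component 0 s))"
  shows "irreducible_rep K_group (sub_rep weil_rep (component 0 s))"
  using assms by (intro irreducible_component) (auto simp: nonzero_rep_def)

lemma irreducible_level_quotient: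
  assumes s: "s = 1 \<or> s = - 1" and k: "1 \<le> k" and nz: "nonzero_rep (level_quotient k s)"
  shows "irreducible_rep K_group (level_quotient k s)"
proof -
  interpret T: rep_transport K_group "sub_rep weil_rep (component k s)" "level_quotient k s"
    "fun_coset (parity s (level (k - 1)))"
    by (rule component_transport[OF s k])
  have "component k s \<noteq> {\<lambda>y. 0}"
  proof
    assume "component k s = {\<lambda>y. 0}"
    then have "carrier (level_quotient k s) = {\<zero>\<^bsub>level_quotient k s\<^esub>}"
      using T.bij T.T_zero by (simp add: bij_betw_def)
    then show False
      using nz by (simp add: nonzero_rep_def)
  qed
  then show ?thesis
    using irreducible_component[OF s] T.irreducible_W by blast
qed

section \<open>The decomposition\<close>

definition comp_class :: "nat \<Rightarrow> complex \<Rightarrow> (('a, 'n) vec \<Rightarrow> complex) \<Rightarrow> (('a, 'n) vec \<Rightarrow> complex) set" where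
  "comp_class k s \<phi> = fun_coset (parity s (level (k - 1))) (proj_component k s \<phi>)"

abbreviation level_sum :: "nat \<Rightarrow> ('g, (('a, 'n) vec \<Rightarrow> complex) set \<times> (('a, 'n) vec \<Rightarrow> complex) set \<times>
    (('a, 'n) vec \<Rightarrow> complex) set \<times> (('a, 'n) vec \<Rightarrow> complex) set) rep" where
  "level_sum m \<equiv> level_quotient (2 * m - 1) 1 \<oplus>\<^sub>r level_quotient (2 * m - 1) (- 1) \<oplus>\<^sub>r
     level_quotient (2 * m) 1 \<oplus>\<^sub>r level_quotient (2 * m) (- 1)"

definition decomp :: "(('a, 'n) vec \<Rightarrow> complex) \<Rightarrow>
    (('a, 'n) vec \<Rightarrow> complex) \<times> (('a, 'n) vec \<Rightarrow> complex) \<times>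
    (nat \<Rightarrow> (('a, 'n) vec \<Rightarrow> complex) set \<times> (('a, 'n) vec \<Rightarrow> complex) set \<times>
      (('a, 'n) vec \<Rightarrow> complex) set \<times> (('a, 'n) vec \<Rightarrow> complex) set)" where
  "decomp \<phi> = (proj_component 0 1 \<phi>, proj_component 0 (- 1) \<phi>, \<lambda>m\<in>{1..}.
     (comp_class (2 * m - 1) 1 \<phi>, comp_class (2 * m - 1) (- 1) \<phi>,
      comp_class (2 * m) 1 \<phi>, comp_class (2 * m) (- 1) \<phi>))"

lemma rep_plus_simps:
  "carrier (V \<oplus>\<^sub>r W) = carrier V \<times> carrier W" "zero (V \<oplus>\<^sub>r W) = (\<zero>\<^bsub>V\<^esub>, \<zero>\<^bsub>W\<^esub>)"
  "add (V \<oplus>\<^sub>r W) x y = (fst x \<oplus>\<^bsub>V\<^esub> fst y, snd x \<oplus>\<^bsub>W\<^esub> snd y)"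
  "smult (V \<oplus>\<^sub>r W) c x = (c \<odot>\<^bsub>V\<^esub> fst x, c \<odot>\<^bsub>W\<^esub> snd x)"
  "act (V \<oplus>\<^sub>r W) g x = (act V g (fst x), act W g (snd x))"
  by (simp_all add: rep_plus_def)

lemma rep_direct_sum_simps:
  "carrier (rep_direct_sum I V) = {x \<in> (\<Pi>\<^sub>E i\<in>I. carrier (V i)). finite {i \<in> I. x i \<noteq> \<zero>\<^bsub>V i\<^esub>}}"
  "zero (rep_direct_sum I V) = (\<lambda>i\<in>I. \<zero>\<^bsub>V i\<^esub>)"
  "add (rep_direct_sum I V) x y = (\<lambda>i\<in>I. x i \<oplus>\<^bsub>V i\<^esub> y i)"
  "smult (rep_direct_sum I V) c x = (\<lambda>i\<in>I. c \<odot>\<^bsub>V i\<^esub> x i)"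
  "act (rep_direct_sum I V) g x = (\<lambda>i\<in>I. act (V i) g (x i))"
  by (simp_all add: rep_direct_sum_def)

lemma schwartz_component: "\<phi> \<in> component k s \<Longrightarrow> \<phi> \<in> schwartz"
  using fun_subspaceD(1)[OF K_subspaceD(1)[OF K_subspace_component]] by blast

lemma comp_class_facts:
  assumes s: "s = 1 \<or> s = - 1" and k: "1 \<le> k" and \<phi>: "\<phi> \<in> schwartz"
  shows "comp_class k s \<phi> \<in> carrier (level_quotient k s)"
    "\<eta> \<in> schwartz \<Longrightarrow> comp_class k s (\<lambda>y. \<phi> y + \<eta> y) = comp_class k s \<phi> \<oplus>\<^bsub>level_quotient k s\<^esub> comp_class k s \<eta>"
    "comp_class k s (\<lambda>y. c * \<phi> y) = c \<odot>\<^bsub>level_quotient k s\<^esub> comp_class k s \<phi>"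
    "g \<in> K \<Longrightarrow> comp_class k s (A g \<phi>) = act (level_quotient k s) g (comp_class k s \<phi>)"
    "proj_component k s \<phi> = (\<lambda>y. 0) \<Longrightarrow> comp_class k s \<phi> = \<zero>\<^bsub>level_quotient k s\<^esub>"
    "\<eta> \<in> schwartz \<Longrightarrow> comp_class k s \<phi> = comp_class k s \<eta> \<Longrightarrow> proj_component k s \<phi> = proj_component k s \<eta>"
proof -
  interpret T: rep_transport K_group "sub_rep weil_rep (component k s)" "level_quotient k s"
    "fun_coset (parity s (level (k - 1)))"
    by (rule component_transport[OF s k])
  note C = proj_component_in_component[OF s]
  show "comp_class k s \<phi> \<in> carrier (level_quotient k s)"
    using T.T_carrier[of "proj_component k s \<phi>"] C[OF \<phi>] unfolding comp_class_def sub_rep_simps by blast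
  show "comp_class k s (\<lambda>y. c * \<phi> y) = c \<odot>\<^bsub>level_quotient k s\<^esub> comp_class k s \<phi>"
    using T.T_smult[of "proj_component k s \<phi>" c] C[OF \<phi>] unfolding comp_class_def sub_rep_simps proj_component_smult[OF \<phi>] by blast
  show "comp_class k s (A g \<phi>) = act (level_quotient k s) g (comp_class k s \<phi>)" if "g \<in> K"
    using T.T_act[of g "proj_component k s \<phi>"] C[OF \<phi>] that unfolding comp_class_def sub_rep_simps K_group_simps proj_component_A[OF that \<phi>] by blast
  show "comp_class k s \<phi> = \<zero>\<^bsub>level_quotient k s\<^esub>" if "proj_component k s \<phi> = (\<lambda>y. 0)"
    using T.T_zero unfolding comp_class_def that sub_rep_simps .
  assume \<eta>: "\<eta> \<in> schwartz"
  show "comp_class k s (\<lambda>y. \<phi> y + \<eta> y) = comp_class k s \<phi> \<oplus>\<^bsub>level_quotient k s\<^esub> comp_class k s \<eta>"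
    using T.T_add[of "proj_component k s \<phi>" "proj_component k s \<eta>"] C[OF \<phi>] C[OF \<eta>]
    unfolding comp_class_def sub_rep_simps proj_component_add[OF \<phi> \<eta>] by blast
  show "proj_component k s \<phi> = proj_component k s \<eta>" if "comp_class k s \<phi> = comp_class k s \<eta>"
    using T.bij C[OF \<phi>] C[OF \<eta>] that unfolding comp_class_def sub_rep_simps bij_betw_def inj_on_def by blast
qed

lemma nat_level_cases:
  assumes "1 \<le> (k::nat)"
  obtains m where "1 \<le> m" "k = 2 * m - 1 \<or> k = 2 * m"
proof
  show "1 \<le> (k + 1) div 2"
    using assms by simp
  show "k = 2 * ((k + 1) div 2) - 1 \<or> k = 2 * ((k + 1) div 2)"
    by presburger
qed

text \<open>
  The components determine a function, and a component is determined by its class.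
\<close>

lemma decomp_inj: "inj_on decomp schwartz"
proof (rule inj_onI)
  fix \<phi> \<eta>
  assume \<phi>: "\<phi> \<in> schwartz" and \<eta>: "\<eta> \<in> schwartz" and eq: "decomp \<phi> = decomp \<eta>"
  have same_parts: "proj_component k s \<phi> = proj_component k s \<eta>" if s: "s = 1 \<or> s = - 1" for k s
  proof (cases "k = 0")
    case True
    then show ?thesis
      using eq s by (auto simp: decomp_def)
  next
    case False
    then have k: "1 \<le> k"
      by simp
    then obtain m where m: "1 \<le> m" "k = 2 * m - 1 \<or> k = 2 * m"
      by (rule nat_level_cases)
    have "snd (snd (decomp \<phi>)) m = snd (snd (decomp \<eta>)) m"
      using eq by simp
    then have "comp_class k s \<phi> = comp_class k s \<eta>"
      using m s by (auto simp: decomp_def)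
    then show ?thesis
      using comp_class_facts(6)[OF s k \<phi> \<eta>] by blast
  qed
  have "proj_component k s (\<lambda>y. \<phi> y + - 1 * \<eta> y) = (\<lambda>y. 0)" if "s = 1 \<or> s = - 1" for k s
    using proj_component_add[OF \<phi> schwartz_smult[OF \<eta>, of "- 1"], of k s] proj_component_smult[OF \<eta>, of k s "- 1"]
      same_parts[OF that, of k] by simp
  then have "(\<lambda>y. \<phi> y + - 1 * \<eta> y) = (\<lambda>y. 0)"
    by (rule proj_component_injective[OF schwartz_add[OF \<phi> schwartz_smult[OF \<eta>]]])
  then show "\<phi> = \<eta>"
    by (simp add: fun_eq_iff)
qed

lemma exists_with_components:
  assumes g: "\<And>k s. s = 1 \<or> s = - 1 \<Longrightarrow> g k s \<in> component k s"
    and fin: "\<And>k s. s = 1 \<or> s = - 1 \<Longrightarrow> N < k \<Longrightarrow> g k s = (\<lambda>y. 0)"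
  shows "\<exists>\<phi>\<in>schwartz. \<forall>k s. s = 1 \<or> s = - 1 \<longrightarrow> proj_component k s \<phi> = g k s"
proof -
  define I where "I = {..N} \<times> {1, - 1 :: complex}"
  define f where "f = (\<lambda>y. \<Sum>i\<in>I. g (fst i) (snd i) y)"
  have I: "finite I" "\<And>i. i \<in> I \<Longrightarrow> g (fst i) (snd i) \<in> component (fst i) (snd i)"
    "\<And>i. i \<in> I \<Longrightarrow> snd i = 1 \<or> snd i = - 1"
    using g by (auto simp: I_def)
  then have S: "\<And>i. i \<in> I \<Longrightarrow> g (fst i) (snd i) \<in> schwartz"
    using schwartz_component by blast
  have "proj_component k s f = g k s" if s: "s = 1 \<or> s = - 1" for k s
  proof -
    have "proj_component k s f = (\<lambda>y. \<Sum>i\<in>I. proj_component k s (g (fst i) (snd i)) y)"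
      unfolding f_def by (rule proj_component_sum[OF I(1) S])
    also have "\<dots> = (\<lambda>y. \<Sum>i\<in>I. if (k, s) = i then g k s y else 0)"
      by (intro ext sum.cong refl) (auto simp: proj_component_component[OF s I(3) I(2)])
    also have "\<dots> = (\<lambda>y. if (k, s) \<in> I then g k s y else 0)"
      using I(1) by simp
    also have "\<dots> = g k s"
      using s fin[OF s, of k] by (auto simp: I_def not_le)
    finally show ?thesis .
  qed
  moreover have "f \<in> schwartz"
    unfolding f_def using S by (intro schwartz_sum)
  ultimately show ?thesis
    by blast
qed

lemma weil_decomposition:
  "rep_iso K_group weil_rep (sub_rep weil_rep (component 0 1) \<oplus>\<^sub>r sub_rep weil_rep (component 0 (- 1)) \<oplus>\<^sub>r
     rep_direct_sum {1..} level_sum)" (is "rep_iso _ _ ?D")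
proof -
  have pm: "1 = (1::complex) \<or> 1 = (- 1 :: complex)" "- 1 = (1::complex) \<or> - 1 = (- 1 :: complex)"
    by auto
  have k: "1 \<le> 2 * m - 1" "1 \<le> 2 * m" if "1 \<le> m" for m :: nat
    using that by auto
  note simps = rep_plus_simps rep_direct_sum_simps sub_rep_simps
  have zero: "decomp (\<lambda>y. 0) = \<zero>\<^bsub>?D\<^esub>"
  proof -
    have c0: "proj_component k s (\<lambda>y. 0) = (\<lambda>y. 0)" for k s
      using proj_component_smult[of "\<lambda>y. 0" k s 0] by simp
    show ?thesis
      unfolding decomp_def simps
      by (auto simp: c0 comp_class_def fun_coset_def quotient_rep_simps intro!: restrict_ext)
  qed
  have closed: "decomp \<phi> \<in> carrier ?D" if \<phi>: "\<phi> \<in> schwartz" for \<phi>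
  proof -
    obtain j where j: "\<phi> \<in> level j"
      using in_some_level[OF \<phi>] by blast
    have fin: "finite {m \<in> {1..}. snd (snd (decomp \<phi>)) m \<noteq> \<zero>\<^bsub>level_sum m\<^esub>}"
    proof (rule finite_subset)
      show "{m \<in> {1..}. snd (snd (decomp \<phi>)) m \<noteq> \<zero>\<^bsub>level_sum m\<^esub>} \<subseteq> {..j}"
      proof (intro subsetI, rule ccontr)
        fix m
        assume "m \<in> {m \<in> {1..}. snd (snd (decomp \<phi>)) m \<noteq> \<zero>\<^bsub>level_sum m\<^esub>}" "m \<notin> {..j}"
        then have m: "1 \<le> m" "j < m" "snd (snd (decomp \<phi>)) m \<noteq> \<zero>\<^bsub>level_sum m\<^esub>"
          by simp_all
        then have "j < 2 * m - 1" "j < 2 * m"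
          by auto
        then have "comp_class (2 * m - 1) s \<phi> = \<zero>\<^bsub>level_quotient (2 * m - 1) s\<^esub>"
          "comp_class (2 * m) s \<phi> = \<zero>\<^bsub>level_quotient (2 * m) s\<^esub>" if "s = 1 \<or> s = - 1" for s
          using proj_component_vanishes[OF that j] comp_class_facts(5)[OF that _ \<phi>] k[OF m(1)] by blast+
        then show False
          using m pm unfolding decomp_def simps by simp
      qed
    qed simp
    show ?thesis
      using fin proj_component_in_component[OF pm(1) \<phi>, of 0] proj_component_in_component[OF pm(2) \<phi>, of 0]
        comp_class_facts(1)[OF pm(1) k(1) \<phi>] comp_class_facts(1)[OF pm(2) k(1) \<phi>]
        comp_class_facts(1)[OF pm(1) k(2) \<phi>] comp_class_facts(1)[OF pm(2) k(2) \<phi>]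
      unfolding decomp_def simps by (auto simp del: One_nat_def)
  qed
  have surj: "\<exists>\<phi>\<in>schwartz. decomp \<phi> = w" if w: "w \<in> carrier ?D" for w
  proof -
    obtain f1 f2 x where wx: "w = (f1, f2, x)"
      by (cases w) auto
    have f: "f1 \<in> component 0 1" "f2 \<in> component 0 (- 1)"
      and x: "x \<in> (\<Pi>\<^sub>E m\<in>{1..}. carrier (level_sum m))" "finite {m \<in> {1..}. x m \<noteq> \<zero>\<^bsub>level_sum m\<^esub>}"
      using w unfolding wx simps by auto
    \<comment> \<open>The entry of \<open>x\<close> at level \<open>k\<close> and parity \<open>s\<close>: the index \<open>m = (k + 1) div 2\<close> covers the
      levels \<open>2 * m - 1\<close> and \<open>2 * m\<close>.\<close>
    define X where "X k s = (let q = x ((k + 1) div 2) in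
      if odd k then (if s = 1 then fst q else fst (snd q))
      else (if s = 1 then fst (snd (snd q)) else snd (snd (snd q))))" for k and s :: complex
    have div: "(2 * m - 1 + 1) div 2 = m" "(2 * m + 1) div 2 = m" "odd (2 * m - 1)" "even (2 * m)"
      if "1 \<le> m" for m :: nat
      using that by auto
    have xm: "x m = (X (2 * m - 1) 1, X (2 * m - 1) (- 1), X (2 * m) 1, X (2 * m) (- 1))"
      if "1 \<le> m" for m
      unfolding X_def Let_def div[OF that] using div(3)[OF that] by simp
    have X: "X k s \<in> carrier (level_quotient k s)" if s: "s = 1 \<or> s = - 1" and "1 \<le> k" for k s
    proof -
      obtain m where m: "1 \<le> m" "k = 2 * m - 1 \<or> k = 2 * m"
        using \<open>1 \<le> k\<close> by (rule nat_level_cases)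
      have "x m \<in> carrier (level_sum m)"
        using x(1) m(1) by (auto simp: PiE_iff)
      then have "X (2 * m - 1) s \<in> carrier (level_quotient (2 * m - 1) s) \<and>
          X (2 * m) s \<in> carrier (level_quotient (2 * m) s)"
        using s unfolding xm[OF m(1)] simps by auto
      then show ?thesis
        using m(2) by blast
    qed
    have ex: "\<exists>g. g \<in> component k s \<and> fun_coset (parity s (level (k - 1))) g = X k s"
      if s: "s = 1 \<or> s = - 1" and k: "1 \<le> k" for k s
    proof -
      interpret T: rep_transport K_group "sub_rep weil_rep (component k s)" "level_quotient k s"
        "fun_coset (parity s (level (k - 1)))"
        by (rule component_transport[OF s k])
      show ?thesis
        using X[OF s k] by (elim T.T_cases) auto
    qed
    define h where
      "h k s = (SOME g. g \<in> component k s \<and> fun_coset (parity s (level (k - 1))) g = X k s)" for k s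
    have h: "h k s \<in> component k s" "fun_coset (parity s (level (k - 1))) (h k s) = X k s"
      if "s = 1 \<or> s = - 1" "1 \<le> k" for k s
      using someI_ex[OF ex[OF that]] unfolding h_def by blast+
    define g where "g k s = (if k = 0 then if s = 1 then f1 else f2 else h k s)" for k s
    have gc: "g k s \<in> component k s" if "s = 1 \<or> s = - 1" for k s
      using that f h(1)[OF that] by (auto simp: g_def)
    obtain M where M: "\<And>m. 1 \<le> m \<Longrightarrow> x m \<noteq> \<zero>\<^bsub>level_sum m\<^esub> \<Longrightarrow> m \<le> M"
      using x(2) by (auto simp: finite_nat_set_iff_bounded_le)
    have "g k s = (\<lambda>y. 0)" if s: "s = 1 \<or> s = - 1" and "2 * M < k" for k s
    proof -
      have k1: "1 \<le> k"
        using \<open>2 * M < k\<close> by simp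
      then obtain m where m: "1 \<le> m" "k = 2 * m - 1 \<or> k = 2 * m"
        by (rule nat_level_cases)
      then have "\<not> m \<le> M"
        using \<open>2 * M < k\<close> by auto
      then have "x m = \<zero>\<^bsub>level_sum m\<^esub>"
        using M m(1) by blast
      then have "X (2 * m - 1) s = \<zero>\<^bsub>level_quotient (2 * m - 1) s\<^esub> \<and> X (2 * m) s = \<zero>\<^bsub>level_quotient (2 * m) s\<^esub>"
        using s unfolding xm[OF m(1)] simps by auto
      then have X0: "X k s = \<zero>\<^bsub>level_quotient k s\<^esub>"
        using m(2) by blast
      interpret T: rep_transport K_group "sub_rep weil_rep (component k s)" "level_quotient k s"
        "fun_coset (parity s (level (k - 1)))"
        by (rule component_transport[OF s k1])
      have "fun_coset (parity s (level (k - 1))) (h k s) = fun_coset (parity s (level (k - 1))) (\<lambda>y. 0)"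
        using h(2)[OF s k1] X0 T.T_zero unfolding sub_rep_simps by simp
      moreover have "(\<lambda>y. 0) \<in> component k s"
        using fun_subspaceD(2)[OF K_subspaceD(1)[OF K_subspace_component]] .
      ultimately have "h k s = (\<lambda>y. 0)"
        using T.bij h(1)[OF s k1] unfolding sub_rep_simps bij_betw_def inj_on_def by blast
      then show ?thesis
        using k1 by (simp add: g_def)
    qed
    then obtain \<phi> where \<phi>: "\<phi> \<in> schwartz" "\<And>k s. s = 1 \<or> s = - 1 \<Longrightarrow> proj_component k s \<phi> = g k s"
      using exists_with_components[of g "2 * M"] gc by blast
    have "comp_class k s \<phi> = X k s" if "s = 1 \<or> s = - 1" "1 \<le> k" for k s
      using \<phi>(2)[OF that(1), of k] h(2)[OF that] that(2) by (simp add: g_def comp_class_def)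
    then have cls: "(comp_class (2 * m - 1) 1 \<phi>, comp_class (2 * m - 1) (- 1) \<phi>,
      comp_class (2 * m) 1 \<phi>, comp_class (2 * m) (- 1) \<phi>) = x m" if "1 \<le> m" for m
      unfolding xm[OF that] using k[OF that] pm by blast
    have "(\<lambda>m\<in>{1..}. (comp_class (2 * m - 1) 1 \<phi>, comp_class (2 * m - 1) (- 1) \<phi>,
      comp_class (2 * m) 1 \<phi>, comp_class (2 * m) (- 1) \<phi>)) = x"
    proof
      fix m
      show "(\<lambda>m\<in>{1..}. (comp_class (2 * m - 1) 1 \<phi>, comp_class (2 * m - 1) (- 1) \<phi>,
        comp_class (2 * m) 1 \<phi>, comp_class (2 * m) (- 1) \<phi>)) m = x m"
        using cls[of m] PiE_arb[OF x(1), of m] by (simp add: restrict_def del: One_nat_def)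
    qed
    then have "decomp \<phi> = w"
      unfolding decomp_def wx using \<phi>(2)[OF pm(1), of 0] \<phi>(2)[OF pm(2), of 0]
      by (simp add: g_def del: One_nat_def)
    then show ?thesis
      using \<phi>(1) by blast
  qed
  have "rep_transport K_group (sub_rep weil_rep schwartz) ?D decomp"
  proof
    show "is_rep K_group (sub_rep weil_rep schwartz)"
      by (rule is_rep_sub[OF K_subspace_schwartz])
    show "bij_betw decomp (carrier (sub_rep weil_rep schwartz)) (carrier ?D)"
      unfolding sub_rep_simps(1) bij_betw_def using decomp_inj closed surj by (auto, force)
    show "decomp \<zero>\<^bsub>sub_rep weil_rep schwartz\<^esub> = \<zero>\<^bsub>?D\<^esub>"
      using zero by simp
  next
    fix \<phi> \<eta>
    assume "\<phi> \<in> carrier (sub_rep weil_rep schwartz)" "\<eta> \<in> carrier (sub_rep weil_rep schwartz)"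
    then have S: "\<phi> \<in> schwartz" "\<eta> \<in> schwartz"
      by simp_all
    have "decomp (\<lambda>y. \<phi> y + \<eta> y) = decomp \<phi> \<oplus>\<^bsub>?D\<^esub> decomp \<eta>"
      unfolding decomp_def simps proj_component_add[OF S]
      by (auto simp: proj_component_add[OF S, symmetric] comp_class_facts(2)[OF pm(1) k(1) S]
          comp_class_facts(2)[OF pm(2) k(1) S] comp_class_facts(2)[OF pm(1) k(2) S]
          comp_class_facts(2)[OF pm(2) k(2) S] simp del: One_nat_def intro!: restrict_ext)
    then show "decomp (\<phi> \<oplus>\<^bsub>sub_rep weil_rep schwartz\<^esub> \<eta>) = decomp \<phi> \<oplus>\<^bsub>?D\<^esub> decomp \<eta>"
      by simp
  next
    fix c \<phi>
    assume "\<phi> \<in> carrier (sub_rep weil_rep schwartz)"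
    then have S: "\<phi> \<in> schwartz"
      by simp
    have "decomp (\<lambda>y. c * \<phi> y) = c \<odot>\<^bsub>?D\<^esub> decomp \<phi>"
      unfolding decomp_def simps
      by (auto simp: proj_component_smult[OF S, of 0] comp_class_facts(3)[OF pm(1) k(1) S]
          comp_class_facts(3)[OF pm(2) k(1) S] comp_class_facts(3)[OF pm(1) k(2) S]
          comp_class_facts(3)[OF pm(2) k(2) S] simp del: One_nat_def intro!: restrict_ext)
    then show "decomp (c \<odot>\<^bsub>sub_rep weil_rep schwartz\<^esub> \<phi>) = c \<odot>\<^bsub>?D\<^esub> decomp \<phi>"
      by simp
  next
    fix g \<phi>
    assume "g \<in> carrier K_group" "\<phi> \<in> carrier (sub_rep weil_rep schwartz)"
    then have g: "g \<in> K" and S: "\<phi> \<in> schwartz"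
      by simp_all
    have "decomp (A g \<phi>) = act ?D g (decomp \<phi>)"
      unfolding decomp_def simps
      by (auto simp: proj_component_A[OF g S, of 0] comp_class_facts(4)[OF pm(1) k(1) S g]
          comp_class_facts(4)[OF pm(2) k(1) S g] comp_class_facts(4)[OF pm(1) k(2) S g]
          comp_class_facts(4)[OF pm(2) k(2) S g] simp del: One_nat_def intro!: restrict_ext)
    then show "decomp (act (sub_rep weil_rep schwartz) g \<phi>) = act ?D g (decomp \<phi>)"
      by simp
  qed
  from rep_transport.rep_iso[OF this] show ?thesis
    by (simp only: weil_rep_eq[symmetric])
qed

section \<open>Multiplicity one\<close>

lemma intertwinerD:
  assumes "S \<in> intertwiners K_group P weil_rep"
  shows "x \<in> carrier P \<Longrightarrow> S x \<in> schwartz"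
    "x \<in> carrier P \<Longrightarrow> y \<in> carrier P \<Longrightarrow> S (x \<oplus>\<^bsub>P\<^esub> y) = (\<lambda>z. S x z + S y z)"
    "x \<in> carrier P \<Longrightarrow> S (c \<odot>\<^bsub>P\<^esub> x) = (\<lambda>z. c * S x z)"
    "g \<in> K \<Longrightarrow> x \<in> carrier P \<Longrightarrow> S (act P g x) = A g (S x)"
  using assms by (auto simp: intertwiners_def linear_maps_def hom_def schwartz_rep_def)

text \<open>
  The vectors with the property \<open>Q\<close> form an invariant submodule, which is not zero.
\<close>

lemma irreducible_property:
  fixes P :: "('g, 'v) rep"
  assumes irr: "irreducible_rep K_group P"
    and Q: "Q \<zero>\<^bsub>P\<^esub>" "\<And>x y. x \<in> carrier P \<Longrightarrow> y \<in> carrier P \<Longrightarrow> Q x \<Longrightarrow> Q y \<Longrightarrow> Q (x \<oplus>\<^bsub>P\<^esub> y)"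
      "\<And>c x. x \<in> carrier P \<Longrightarrow> Q x \<Longrightarrow> Q (c \<odot>\<^bsub>P\<^esub> x)"
      "\<And>g x. g \<in> K \<Longrightarrow> x \<in> carrier P \<Longrightarrow> Q x \<Longrightarrow> Q (act P g x)"
    and x0: "x0 \<in> carrier P" "Q x0" "x0 \<noteq> \<zero>\<^bsub>P\<^esub>" and x: "x \<in> carrier P"
  shows "Q x"
proof -
  have rep: "is_rep K_group P"
    using irr by (simp add: irreducible_rep_def)
  interpret P: rep_transport K_group P P "\<lambda>x. x"
    by unfold_locales (use rep in \<open>auto simp: bij_betw_def\<close>)
  define U where "U = {x \<in> carrier P. Q x}"
  have "Module.submodule U complex_ring P"
    using Q(1-3) P.V_smult_closed by (intro complex_submoduleI P.module_V) (auto simp: U_def)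
  moreover have "act P g ` U \<subseteq> U" if "g \<in> K" for g
    using that Q(4) P.act_closed by (auto simp: U_def)
  ultimately have "U = {\<zero>\<^bsub>P\<^esub>} \<or> U = carrier P"
    using irr by (simp add: irreducible_rep_def)
  then show ?thesis
    using x0 x by (auto simp: U_def)
qed

lemma intertwiner_zero:
  assumes "is_rep K_group P" "S \<in> intertwiners K_group P weil_rep"
  shows "S \<zero>\<^bsub>P\<^esub> = (\<lambda>z. 0)"
proof -
  interpret P: Module.module complex_ring P
    using assms(1) by (simp add: is_rep_def)
  have "S (0 \<odot>\<^bsub>P\<^esub> \<zero>\<^bsub>P\<^esub>) = (\<lambda>z. 0)"
    using intertwinerD(3)[OF assms(2), of "\<zero>\<^bsub>P\<^esub>" 0] by simp
  then show ?thesis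
    using P.smult_r_null[of 0] by simp
qed

lemma intertwiner_injective:
  assumes irr: "irreducible_rep K_group P" and S: "S \<in> intertwiners K_group P weil_rep"
    and nz: "x0 \<in> carrier P" "S x0 \<noteq> (\<lambda>z. 0)"
    and x: "x \<in> carrier P" "y \<in> carrier P" "S x = S y"
  shows "x = y"
proof -
  have rep: "is_rep K_group P"
    using irr by (simp add: irreducible_rep_def)
  interpret P: rep_transport K_group P P "\<lambda>x. x"
    by unfold_locales (use rep in \<open>auto simp: bij_betw_def\<close>)
  note D = intertwinerD[OF S]
  have ker: "z = \<zero>\<^bsub>P\<^esub>" if z: "z \<in> carrier P" "S z = (\<lambda>z. 0)" for z
  proof (rule ccontr)
    assume "z \<noteq> \<zero>\<^bsub>P\<^esub>"
    then have "S x0 = (\<lambda>z. 0)"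
      using irreducible_property[OF irr, of "\<lambda>x. S x = (\<lambda>z. 0)" z x0] z nz(1)
      by (auto simp: intertwiner_zero[OF rep S] D A_zero K_carrier)
    then show False
      using nz(2) by simp
  qed
  let ?d = "x \<oplus>\<^bsub>P\<^esub> (- 1) \<odot>\<^bsub>P\<^esub> y"
  have d: "(- 1) \<odot>\<^bsub>P\<^esub> y \<in> carrier P"
    using x P.V_smult_closed by blast
  have "S ?d = (\<lambda>z. 0)"
    using x d by (simp add: D)
  then have "?d = \<zero>\<^bsub>P\<^esub>"
    using ker x d by simp
  moreover have "(- 1) \<odot>\<^bsub>P\<^esub> y \<oplus>\<^bsub>P\<^esub> y = \<zero>\<^bsub>P\<^esub>"
    using P.V.smult_l_distr[of "- 1" 1 y] P.V.smult_l_null[of y] P.V.smult_one[of y] x by simp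
  ultimately show ?thesis
    using x d by (metis P.V.minus_equality P.V.minus_minus P.V.a_comm)
qed

text \<open>
  The image of an irreducible representation under a nonzero intertwiner contains a function
  supported in a single class up to sign. Its eigencharacter under the unipotent elements occurs
  only once, up to scalars, in the space of functions of the same level and parity.
\<close>

lemma intertwiners_proportional:
  assumes irr: "irreducible_rep K_group P"
    and S: "S \<in> intertwiners K_group P weil_rep" and T: "T \<in> intertwiners K_group P weil_rep"
    and nz: "x0 \<in> carrier P" "S x0 \<noteq> (\<lambda>z. 0)"
    and lev: "\<And>x. x \<in> carrier P \<Longrightarrow> S x \<in> level k" "\<And>x. x \<in> carrier P \<Longrightarrow> T x \<in> level k"
    and min: "k = 0 \<or> (\<exists>x\<in>carrier P. S x \<notin> level (k - 1))"
  shows "\<exists>c. \<forall>x\<in>carrier P. T x = (\<lambda>z. c * S x z)"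
proof -
  have rep: "is_rep K_group P"
    using irr by (simp add: irreducible_rep_def)
  interpret P: rep_transport K_group P P "\<lambda>x. x"
    by unfold_locales (use rep in \<open>auto simp: bij_betw_def\<close>)
  note SD = intertwinerD[OF S] and TD = intertwinerD[OF T]
  note S0 = intertwiner_zero[OF rep S]
  note inj = intertwiner_injective[OF irr S nz]
  obtain w \<kappa> where w: "w \<in> K" "\<kappa> \<noteq> 0" "\<And>\<phi>. \<phi> \<in> schwartz \<Longrightarrow> A w \<phi> = (\<lambda>y. \<kappa> * \<phi> (- y))"
    using reflection_K by blast
  have "\<exists>s. (s = 1 \<or> s = - 1) \<and> (\<forall>x\<in>carrier P. S x \<in> parity s schwartz)"
  proof (cases "\<exists>x\<in>carrier P. S x \<in> parity 1 schwartz \<and> x \<noteq> \<zero>\<^bsub>P\<^esub>")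
    case True
    then obtain x1 where x1: "x1 \<in> carrier P" "S x1 \<in> parity 1 schwartz" "x1 \<noteq> \<zero>\<^bsub>P\<^esub>"
      by blast
    note sub = fun_subspaceD[OF fun_subspace_parity[OF fun_subspace_schwartz]]
    have "S x \<in> parity 1 schwartz" if "x \<in> carrier P" for x
      using irreducible_property[OF irr, of "\<lambda>x. S x \<in> parity 1 schwartz" x1 x] x1 that sub
      by (auto simp: S0 SD A_parity K_carrier)
    then show ?thesis
      by blast
  next
    case False
    have "S x \<in> parity (- 1) schwartz" if x: "x \<in> carrier P" for x
    proof -
      \<comment> \<open>\<open>S\<close> maps this vector to twice the even part of \<open>S x\<close>.\<close>
      define x' where "x' = x \<oplus>\<^bsub>P\<^esub> inverse \<kappa> \<odot>\<^bsub>P\<^esub> act P w x"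
      have wx: "act P w x \<in> carrier P"
        using x w(1) by (intro P.act_closed) simp_all
      then have x'P: "x' \<in> carrier P"
        using x P.V_smult_closed by (simp add: x'_def)
      have Sx': "S x' = (\<lambda>z. S x z + S x (- z))"
        using x wx w P.V_smult_closed by (simp add: x'_def SD flip: mult.assoc)
      have "S x' \<in> parity 1 schwartz"
        unfolding Sx' using schwartz_add[OF SD(1)[OF x] schwartz_reflect[OF SD(1)[OF x]]]
        by (simp add: parity_def)
      then have "x' = \<zero>\<^bsub>P\<^esub>"
        using False x'P by blast
      then have "(\<lambda>z. S x z + S x (- z)) = (\<lambda>z. 0)"
        using Sx' S0 by simp
      then have "S x (- z) = - S x z" for z
        by (metis add.commute add_eq_0_iff)
      then show ?thesis
        using SD(1)[OF x] by (simp add: parity_def)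
    qed
    then show ?thesis
      by blast
  qed
  then obtain s where s: "s = 1 \<or> s = - 1" "\<And>x. x \<in> carrier P \<Longrightarrow> S x \<in> parity s schwartz"
    by blast
  define U where "U = S ` carrier P"
  have U: "K_subspace U"
    unfolding K_subspace_def fun_subspace_def
  proof (intro conjI ballI allI)
    show "U \<subseteq> schwartz"
      using SD(1) by (auto simp: U_def)
    show "(\<lambda>y. 0) \<in> U"
      using P.V.zero_closed by (auto simp: U_def S0[symmetric])
    fix \<phi> \<eta>
    assume "\<phi> \<in> U" "\<eta> \<in> U"
    then show "(\<lambda>y. \<phi> y + \<eta> y) \<in> U"
      by (auto simp: U_def SD(2)[symmetric])
  next
    fix \<phi> c
    assume "\<phi> \<in> U"
    then show "(\<lambda>y. c * \<phi> y) \<in> U"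
      using P.V_smult_closed by (auto simp: U_def SD(3)[symmetric])
  next
    fix g \<phi>
    assume g: "g \<in> K" and "\<phi> \<in> U"
    then show "A g \<phi> \<in> U"
      using P.act_closed[of g] by (auto simp: U_def SD(4)[OF g, symmetric])
  qed
  have Ulev: "U \<subseteq> parity s (level k)"
    using s(2) lev(1) by (auto simp: U_def parity_def)
  have "\<exists>u\<in>U. \<exists>y. u y \<noteq> 0 \<and> good k y"
  proof (cases k)
    case 0
    obtain y where "S x0 y \<noteq> 0"
      using nz(2) by auto
    then show ?thesis
      using nz(1) level_support[OF lev(1)[OF nz(1)]] 0 by (auto simp: U_def good_def)
  next
    case (Suc l)
    then have "\<not> U \<subseteq> level l"
      using min by (auto simp: U_def)
    then show ?thesis
      using exists_good_nonzero[OF U] Ulev Suc by blast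
  qed
  then obtain u y where u: "u \<in> U" "u y \<noteq> 0" "good k y"
    by blast
  have "u \<in> level k"
    using u(1) Ulev by (auto simp: parity_def)
  then obtain f where f: "f \<in> U" "f y \<noteq> 0" "\<And>z. f z \<noteq> 0 \<Longrightarrow> z \<in> near k y"
    using exists_supported_in_class[OF U u(1) _ u(3) u(2)] by blast
  then obtain x where x: "x \<in> carrier P" "f = S x"
    by (auto simp: U_def)
  have fp: "f \<in> parity s (level k)"
    using f(1) Ulev by blast
  have TS: "T x \<in> schwartz"
    by (rule TD(1)[OF x(1)])
  \<comment> \<open>As \<open>S\<close> is injective, \<open>T x\<close> is an eigenvector of each operator of which \<open>f = S x\<close> is one.\<close>
  have act: "act P g x = c \<odot>\<^bsub>P\<^esub> x" if g: "g \<in> K" and "A g f = (\<lambda>z. c * f z)" for g c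
  proof (rule inj)
    show "act P g x \<in> carrier P"
      using g x(1) by (intro P.act_closed) simp_all
    show "c \<odot>\<^bsub>P\<^esub> x \<in> carrier P"
      by (rule P.V_smult_closed[OF x(1)])
    show "S (act P g x) = S (c \<odot>\<^bsub>P\<^esub> x)"
      using that x by (simp add: SD)
  qed
  have AT: "A g (T x) = (\<lambda>z. c * T x z)" if "g \<in> K" "A g f = (\<lambda>z. c * f z)" for g c
    using act[OF that] TD(3)[OF x(1), of c] TD(4)[OF that(1) x(1)] by simp
  have "A w f = (\<lambda>z. \<kappa> * s * f z)"
    using w(3)[of f] fp level_schwartz by (auto simp: parity_def)
  then have "(\<lambda>z. \<kappa> * T x (- z)) = (\<lambda>z. \<kappa> * s * T x z)"
    using AT[OF w(1)] w(3)[OF TS] by metis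
  then have "T x (- z) = s * T x z" for z
    using w(2) by (metis mult.assoc mult_cancel_left)
  then have Tp: "T x \<in> parity s (level k)"
    using lev(2)[OF x(1)] by (simp add: parity_def)
  have Tnear: "z \<in> near k y" if "T x z \<noteq> 0" for z
  proof (rule good_separation[OF u(3)])
    show "z \<in> box_at (radius k)"
      using level_support[OF lev(2)[OF x(1)] that] .
    show "same_chi y z"
      unfolding same_chi_def
    proof
      fix a
      assume a: "a \<in> unipotents"
      obtain g where g: "g \<in> K" "\<And>\<phi>. \<phi> \<in> schwartz \<Longrightarrow> A g \<phi> = (\<lambda>y. chi a y * \<phi> y)"
        using unipotent_K[OF a] by blast
      have Af: "A g f = (\<lambda>z. chi a z * f z)"
        using g(2) fp level_schwartz by (auto simp: parity_def)
      have "A g f \<in> parity s (level k)"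
        by (rule K_subspaceD(2)[OF K_subspace_parity_level g(1) fp])
      moreover have "z' \<in> near k y" if "A g f z' \<noteq> 0" for z'
        using that f(3) by (auto simp: Af)
      ultimately have "A g f = (\<lambda>z. A g f y / f y * f z)"
        using near_proportional[OF _ _ fp f(3) f(2)] by blast
      then have "A g f = (\<lambda>z. chi a y * f z)"
        using f(2) by (simp add: Af)
      then have "A g (T x) = (\<lambda>z. chi a y * T x z)"
        by (rule AT[OF g(1)])
      then have "chi a z * T x z = chi a y * T x z"
        using g(2)[OF TS] by metis
      then show "chi a y = chi a z"
        using that by simp
    qed
  qed
  define c where "c = T x y / f y"
  have "T x = (\<lambda>z. c * S x z)"
    unfolding c_def x(2)[symmetric] by (rule near_proportional[OF Tp Tnear fp f(3) f(2)])
  moreover have "x \<noteq> \<zero>\<^bsub>P\<^esub>"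
    using f(2) x(2) S0 by auto
  ultimately have "T x' = (\<lambda>z. c * S x' z)" if "x' \<in> carrier P" for x'
    using irreducible_property[OF irr, of "\<lambda>x'. T x' = (\<lambda>z. c * S x' z)" x x'] x(1) that
    by (auto simp: SD TD S0 intertwiner_zero[OF rep T] A_smult K_carrier distrib_left mult.left_commute)
  then show ?thesis
    by blast
qed

lemma exists_least_level:
  assumes irr: "irreducible_rep K_group P" and S: "S \<in> intertwiners K_group P weil_rep"
    and nz: "x0 \<in> carrier P" "S x0 \<noteq> (\<lambda>z. 0)"
  shows "\<exists>k. (\<forall>x\<in>carrier P. S x \<in> level k) \<and> (k = 0 \<or> (\<exists>x\<in>carrier P. S x \<notin> level (k - 1)))"
proof -
  have rep: "is_rep K_group P"
    using irr by (simp add: irreducible_rep_def)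
  note SD = intertwinerD[OF S]
  obtain j where j: "S x0 \<in> level j"
    using in_some_level[OF SD(1)[OF nz(1)]] by blast
  have x0: "x0 \<noteq> \<zero>\<^bsub>P\<^esub>"
    using nz(2) intertwiner_zero[OF rep S] by auto
  note sub = fun_subspaceD[OF fun_subspace_level]
  have all: "\<forall>x\<in>carrier P. S x \<in> level j"
  proof
    fix x
    assume "x \<in> carrier P"
    then show "S x \<in> level j"
      using irreducible_property[OF irr, of "\<lambda>x. S x \<in> level j" x0 x] nz(1) j x0 sub
      by (auto simp: intertwiner_zero[OF rep S] SD A_level)
  qed
  define Q where "Q k \<longleftrightarrow> (\<forall>x\<in>carrier P. S x \<in> level k)" for k
  have "Q (LEAST k. Q k)"
    by (rule LeastI[of Q j]) (simp add: Q_def all)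
  moreover have "(LEAST k. Q k) = 0 \<or> \<not> Q ((LEAST k. Q k) - 1)"
    using not_less_Least[of "(LEAST k. Q k) - 1" Q] by auto
  ultimately show ?thesis
    unfolding Q_def[symmetric] by (intro exI[of _ "LEAST k. Q k"]) (auto simp: Q_def)
qed

text \<open>
  Of two nonzero intertwiners, the one whose image needs the higher level determines the other.
\<close>

lemma weil_multiplicity_free: "multiplicity_free K_group weil_rep"
  unfolding multiplicity_free_def
proof (intro allI impI ballI)
  fix P :: "('g, ('a, 'n) vec \<Rightarrow> complex) rep" and S T
  assume irr: "irreducible_rep K_group P"
    and S: "S \<in> intertwiners K_group P weil_rep" and T: "T \<in> intertwiners K_group P weil_rep"
  have goal: "\<exists>a b. (a \<noteq> 0 \<or> b \<noteq> 0) \<and> (\<forall>x\<in>carrier P. (a \<odot>\<^bsub>weil_rep\<^esub> S x) \<oplus>\<^bsub>weil_rep\<^esub> (b \<odot>\<^bsub>weil_rep\<^esub> T x) = \<zero>\<^bsub>weil_rep\<^esub>)"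
    if "a \<noteq> 0 \<or> b \<noteq> 0" "\<And>x z. x \<in> carrier P \<Longrightarrow> a * S x z + b * T x z = 0" for a b :: complex
    using that by (intro exI[of _ a] exI[of _ b]) (simp add: schwartz_rep_def)
  show "\<exists>a b. (a \<noteq> 0 \<or> b \<noteq> 0) \<and> (\<forall>x\<in>carrier P. (a \<odot>\<^bsub>weil_rep\<^esub> S x) \<oplus>\<^bsub>weil_rep\<^esub> (b \<odot>\<^bsub>weil_rep\<^esub> T x) = \<zero>\<^bsub>weil_rep\<^esub>)"
  proof (cases "(\<forall>x\<in>carrier P. S x = (\<lambda>z. 0)) \<or> (\<forall>x\<in>carrier P. T x = (\<lambda>z. 0))")
    case True
    then show ?thesis
    proof
      assume "\<forall>x\<in>carrier P. S x = (\<lambda>z. 0)"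
      then show ?thesis
        by (intro goal[of 1 0]) auto
    next
      assume "\<forall>x\<in>carrier P. T x = (\<lambda>z. 0)"
      then show ?thesis
        by (intro goal[of 0 1]) auto
    qed
  next
    case False
    then obtain x0 x1 where nz: "x0 \<in> carrier P" "S x0 \<noteq> (\<lambda>z. 0)" "x1 \<in> carrier P" "T x1 \<noteq> (\<lambda>z. 0)"
      by blast
    obtain k where k: "\<And>x. x \<in> carrier P \<Longrightarrow> S x \<in> level k" "k = 0 \<or> (\<exists>x\<in>carrier P. S x \<notin> level (k - 1))"
      using exists_least_level[of P S x0, OF irr S nz(1,2)] by blast
    obtain j where j: "\<And>x. x \<in> carrier P \<Longrightarrow> T x \<in> level j" "j = 0 \<or> (\<exists>x\<in>carrier P. T x \<notin> level (j - 1))"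
      using exists_least_level[of P T x1, OF irr T nz(3,4)] by blast
    show ?thesis
    proof (cases "j \<le> k")
      case True
      then have "\<And>x. x \<in> carrier P \<Longrightarrow> T x \<in> level k"
        using j(1) level_mono by blast
      then obtain c where "\<And>x. x \<in> carrier P \<Longrightarrow> T x = (\<lambda>z. c * S x z)"
        using intertwiners_proportional[of P S T x0 k, OF irr S T nz(1,2) k(1) _ k(2)] by blast
      then show ?thesis
        by (intro goal[of "- c" 1]) auto
    next
      case False
      then have "\<And>x. x \<in> carrier P \<Longrightarrow> S x \<in> level j"
        using k(1) level_mono[of k j] by auto
      then obtain c where "\<And>x. x \<in> carrier P \<Longrightarrow> S x = (\<lambda>z. c * T x z)"
        using intertwiners_proportional[of P T S x1 j, OF irr T S nz(3,4) j(1) _ j(2)] by blast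
      then show ?thesis
        by (intro goal[of 1 "- c"]) auto
    qed
  qed
qed

end

section \<open>The restriction of the Weil representation\<close>

lemma rep_direct_sum_cong:
  "(\<And>i. i \<in> I \<Longrightarrow> V i = W i) \<Longrightarrow> rep_direct_sum I V = rep_direct_sum I W"
  by (auto simp: rep_direct_sum_def fun_eq_iff restrict_def PiE_iff cong: conj_cong)

theorem theorem1p2:
  fixes \<psi> :: "'a::nonarch_local_field \<Rightarrow> complex"
    and \<pi> :: 'a
    and \<mu> :: "('a, 'n::{finite,linorder}) vec measure"
    and Mp :: "'g monoid"
    and p :: "'g \<Rightarrow> 'a^('n + 'n)^('n + 'n)"
    and A :: "'g \<Rightarrow> (('a, 'n) vec \<Rightarrow> complex) \<Rightarrow> (('a, 'n) vec \<Rightarrow> complex)"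
    and r :: nat
  defines "\<omega> \<equiv> schwartz_rep A"
    and "K \<equiv> metaplectic_K Mp p \<pi> r"
  assumes "uniformizer \<pi>"
    and "additive_character \<psi>"
    and "has_conductor_4 \<psi>"
    and "self_dual_haar_measure \<psi> \<mu>"
    and "metaplectic_group Mp p"
    and "weil_representation \<psi> \<mu> Mp p A"
    and "r \<le> CARD('n)"
  shows "rep_iso K \<omega>
           (omega_rep \<pi> r \<omega> even_part \<oplus>\<^sub>r omega_rep \<pi> r \<omega> odd_part \<oplus>\<^sub>r
            rep_direct_sum {1..} (\<lambda>m.
              mu_rep \<pi> r \<omega> even_part m \<oplus>\<^sub>r mu_rep \<pi> r \<omega> odd_part m \<oplus>\<^sub>r
              nu_rep \<pi> r \<omega> even_part m \<oplus>\<^sub>r nu_rep \<pi> r \<omega> odd_part m)) \<and>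
         (\<forall>\<epsilon>\<in>{even_part, odd_part}.
           (nonzero_rep (omega_rep \<pi> r \<omega> \<epsilon>) \<longrightarrow>
              irreducible_rep K (omega_rep \<pi> r \<omega> \<epsilon>)) \<and>
           (\<forall>m\<ge>1. nonzero_rep (mu_rep \<pi> r \<omega> \<epsilon> m) \<longrightarrow>
              irreducible_rep K (mu_rep \<pi> r \<omega> \<epsilon> m)) \<and>
           (\<forall>m\<ge>1. nonzero_rep (nu_rep \<pi> r \<omega> \<epsilon> m) \<longrightarrow>
              irreducible_rep K (nu_rep \<pi> r \<omega> \<epsilon> m))) \<and>
         multiplicity_free K \<omega>"
proof -
  interpret W: weil_compact \<psi> \<mu> Mp p A \<pi> r
    by unfold_locales (use assms in auto)
  have sum: "rep_direct_sum {1..} (\<lambda>m. mu_rep \<pi> r \<omega> even_part m \<oplus>\<^sub>r mu_rep \<pi> r \<omega> odd_part m \<oplus>\<^sub>r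
      nu_rep \<pi> r \<omega> even_part m \<oplus>\<^sub>r nu_rep \<pi> r \<omega> odd_part m) = rep_direct_sum {1..} W.level_sum"
    unfolding \<omega>_def by (intro rep_direct_sum_cong) (simp only: W.mu_rep_eq W.nu_rep_eq atLeast_iff)
  have "rep_iso K \<omega> (omega_rep \<pi> r \<omega> even_part \<oplus>\<^sub>r omega_rep \<pi> r \<omega> odd_part \<oplus>\<^sub>r
      rep_direct_sum {1..} (\<lambda>m. mu_rep \<pi> r \<omega> even_part m \<oplus>\<^sub>r mu_rep \<pi> r \<omega> odd_part m \<oplus>\<^sub>r
      nu_rep \<pi> r \<omega> even_part m \<oplus>\<^sub>r nu_rep \<pi> r \<omega> odd_part m))"
    unfolding sum unfolding \<omega>_def K_def W.omega_rep_eq by (rule W.weil_decomposition)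
  moreover have "irreducible_rep K (omega_rep \<pi> r \<omega> \<epsilon>)"
    if "\<epsilon> \<in> {even_part, odd_part}" "nonzero_rep (omega_rep \<pi> r \<omega> \<epsilon>)" for \<epsilon>
    using that W.irreducible_omega unfolding \<omega>_def K_def by (auto simp: W.omega_rep_eq)
  moreover have "irreducible_rep K (mu_rep \<pi> r \<omega> \<epsilon> m)"
    if "\<epsilon> \<in> {even_part, odd_part}" "1 \<le> m" "nonzero_rep (mu_rep \<pi> r \<omega> \<epsilon> m)" for \<epsilon> m
    using that W.irreducible_level_quotient[of _ "2 * m - 1"] unfolding \<omega>_def K_def
    by (auto simp: W.mu_rep_eq[OF that(2)] simp del: One_nat_def)
  moreover have "irreducible_rep K (nu_rep \<pi> r \<omega> \<epsilon> m)"
    if "\<epsilon> \<in> {even_part, odd_part}" "1 \<le> m" "nonzero_rep (nu_rep \<pi> r \<omega> \<epsilon> m)" for \<epsilon> m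
    using that W.irreducible_level_quotient[of _ "2 * m"] unfolding \<omega>_def K_def
    by (auto simp: W.nu_rep_eq[OF that(2)] simp del: One_nat_def)
  moreover have "multiplicity_free K \<omega>"
    unfolding \<omega>_def K_def by (rule W.weil_multiplicity_free)
  ultimately show ?thesis
    by blast
qed

end
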